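(* Let $\alpha_1>0$ and $\alpha_3\neq0$. Then the sequence $S(\alpha_1,\alpha_2,\alpha_3)$ is simply represented, and consequently for every $n\ge1$ $$u_n=\frac{1}{2\pi i}\lim_{\varepsilon\to0^+}\int_\varepsilon^\infty [f]_-(x)\,x^{n-1}\,dx\;-\;r^\circ\cdot 0^{n-1}\;-\;\sum_j s_j(-\zeta_j)^{n-1},$$ where $[f]_-(x)=\lim_{\varepsilon\to0^+}\big(f(-x+i\varepsilon)-f(-x-i\varepsilon)\big)$, $r^\circ=\lim_{z\to0}zf(z)$, the sum runs over the simple poles $\zeta_j$ of $f$ in $\mathbb{C}\setminus(-\infty,0]$ with residues $s_j$, and $0^0=1$.
   Context: $S(\alpha_1,\alpha_2,\alpha_3)=(u_n)_{n\ge1}$: $u_1=1$, $u_n=(\alpha_1 n+\alpha_2)u_{n-1}+\alpha_3\sum_{j=1}^{n-1}u_ju_{n-j}$ ($n\ge2$), and $u_0=1/(\alpha_1+\alpha_2)$. Its generating function $f$ is the solution of $f'=\beta_1f^2+(\beta_2+\beta_3/z)f+\beta_4$ (with $\beta_1=-\alpha_3/\alpha_1$, $\beta_2=\frac{\alpha_1+\alpha_2+2\alpha_3}{\alpha_1(\alpha_1+\alpha_2)}$, $\beta_3=1+\alpha_2/\alpha_1$, $\beta_4=-\frac{\alpha_1+\alpha_2+\alpha_3}{\alpha_1(\alpha_1+\alpha_2)^2}$) having asymptotic expansion $f(z)\sim\sum_{n\ge0}(-1)^nu_nz^{-n}$ as $|z|\to\infty$ uniformly in $|\arg z|<\pi$;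 explicitly $f(z)=\frac ka\frac{U'(a,b,kz)}{U(a,b,kz)}-\frac kb$ with $k=1/\alpha_1$, $a=\alpha_3/\alpha_1$, $b=-1-\alpha_2/\alpha_1$, $U$ Tricomi's confluent hypergeometric function on the plane cut along $(-\infty,0]$ (when $\alpha_1+\alpha_2=0$, i.e. $b=0$, the additive constant is dropped; additive constants are irrelevant). The sequence (or $f$) is called simply represented if (i) $f$ has no singularities other than simple poles in $\mathbb{C}\setminus(-\infty,0]$, and (ii) $\lim_{z\to0}zf(z)$ exists and is finite. In the formula, a simple pole of $f$ at a point $-c$ of the negative real axis is interpreted distributionally: it contributes to $[f]_-$ the term $-2\pi i\,\rho\,\delta(x-c)$, where $\rho$ is its residue. *)

theory Defs
  imports "HOL-Complex_Analysis.Complex_Analysis"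
begin

fun conv_seq :: "real \<Rightarrow> real \<Rightarrow> real \<Rightarrow> nat \<Rightarrow> real" where
  "conv_seq \<alpha>1 \<alpha>2 \<alpha>3 n =
     (if n = 0 then 1 / (\<alpha>1 + \<alpha>2)
      else if n = 1 then 1
      else (\<alpha>1 * real n + \<alpha>2) * conv_seq \<alpha>1 \<alpha>2 \<alpha>3 (n - 1)
           + \<alpha>3 * (\<Sum>j\<in>{1..n-1}. conv_seq \<alpha>1 \<alpha>2 \<alpha>3 j * conv_seq \<alpha>1 \<alpha>2 \<alpha>3 (n - j)))"

declare conv_seq.simps [simp del]

abbreviation slit_plane :: "complex set" where
  "slit_plane \<equiv> - \<real>\<^sub>\<le>\<^sub>0"

text \<open>
  Tricomi's function \<open>U(a, b, z)\<close>, principal branch, by its standard characterization (DLMF 13.2.6):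
  the solution of Kummer's equation \<open>z w'' + (b - z) w' - a w = 0\<close> with \<open>w \<sim> z\<^sup>-\<^sup>a\<close>
  as \<open>z \<rightarrow> \<infinity>\<close>, uniformly in \<open>\<bar>arg z\<bar> < \<pi>\<close>. Independent second solutions grow like
  \<open>exp z * z powr (a - b)\<close> along the positive axis, so there is only one such solution.
  The value 0 on the cut is a convention that makes the description unique on all of \<open>\<complex>\<close>.
\<close>

definition is_tricomi_U :: "real \<Rightarrow> real \<Rightarrow> (complex \<Rightarrow> complex) \<Rightarrow> bool" where
  "is_tricomi_U a b u \<longleftrightarrow>
     u holomorphic_on slit_plane \<and>
     (\<forall>z\<in>slit_plane. z * deriv (deriv u) z + (of_real b - z) * deriv u z - of_real a * u z = 0) \<and>
     ((\<lambda>z. u z * z powr of_real a) \<longlongrightarrow> 1) (inf at_infinity (principal slit_plane)) \<and>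
     (\<forall>z\<in>\<real>\<^sub>\<le>\<^sub>0. u z = 0)"

definition tricomi_U :: "real \<Rightarrow> real \<Rightarrow> complex \<Rightarrow> complex" where
  "tricomi_U a b = (THE u. is_tricomi_U a b u)"

definition gen_fun :: "real \<Rightarrow> real \<Rightarrow> real \<Rightarrow> complex \<Rightarrow> complex" where
  "gen_fun \<alpha>1 \<alpha>2 \<alpha>3 z =
     (let k = 1 / \<alpha>1; a = \<alpha>3 / \<alpha>1; b = - 1 - \<alpha>2 / \<alpha>1 in
        of_real (k / a) * (deriv (tricomi_U a b) (of_real k * z) / tricomi_U a b (of_real k * z))
        - (if b = 0 then 0 else of_real (k / b)))"

definition simple_pole_at :: "(complex \<Rightarrow> complex) \<Rightarrow> complex \<Rightarrow> bool" where
  "simple_pole_at f z \<longleftrightarrow> isolated_singularity_at f z \<and> is_pole f z \<and> zorder f z = - 1"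

definition simply_represented :: "(complex \<Rightarrow> complex) \<Rightarrow> bool" where
  "simply_represented f \<longleftrightarrow>
     (\<forall>z\<in>slit_plane. f analytic_on {z} \<or> simple_pole_at f z) \<and>
     (\<exists>r. ((\<lambda>z. z * f z) \<longlongrightarrow> r) (at 0 within slit_plane))"

definition residue_at_origin :: "(complex \<Rightarrow> complex) \<Rightarrow> complex" where
  "residue_at_origin f = Lim (at 0 within slit_plane) (\<lambda>z. z * f z)"

definition slit_poles :: "(complex \<Rightarrow> complex) \<Rightarrow> complex set" where
  "slit_poles f = {\<zeta>\<in>slit_plane. simple_pole_at f \<zeta>}"

text \<open>
  Only the values of \<open>f\<close> off the cut are meaningful, so a simple pole at a point \<open>- c\<close> of the
  negative axis is a simple pole of the analytic continuation of \<open>f\<close> across the cut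
  near \<open>- c\<close>. The third argument is its residue, which is determined by \<open>f\<close> and \<open>c\<close>.
\<close>

definition cut_simple_pole :: "(complex \<Rightarrow> complex) \<Rightarrow> real \<Rightarrow> complex \<Rightarrow> bool" where
  "cut_simple_pole f c \<rho> \<longleftrightarrow>
     c > 0 \<and>
     (\<exists>F r. r > 0 \<and> F holomorphic_on ball (- of_real c) r - {- of_real c} \<and>
            (\<forall>z\<in>ball (- of_real c) r \<inter> slit_plane. F z = f z) \<and>
            simple_pole_at F (- of_real c) \<and> residue F (- of_real c) = \<rho>)"

definition cut_poles :: "(complex \<Rightarrow> complex) \<Rightarrow> real set" where
  "cut_poles f = {c. \<exists>\<rho>. cut_simple_pole f c \<rho>}"

definition cut_residue :: "(complex \<Rightarrow> complex) \<Rightarrow> real \<Rightarrow> complex" where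
  "cut_residue f c = (THE \<rho>. cut_simple_pole f c \<rho>)"

definition jump_diff :: "(complex \<Rightarrow> complex) \<Rightarrow> real \<Rightarrow> real \<Rightarrow> complex" where
  "jump_diff f x \<epsilon> = f (Complex (- x) \<epsilon>) - f (Complex (- x) (- \<epsilon>))"

definition jump :: "(complex \<Rightarrow> complex) \<Rightarrow> real \<Rightarrow> complex" where
  "jump f x = Lim (at_right 0) (jump_diff f x)"

text \<open>
  The integral of \<open>[f]\<^sub>- \<phi>\<close> from \<open>\<epsilon>\<close> to infinity, with \<open>[f]\<^sub>-\<close> read as the pointwise jump
  plus the term \<open>- 2 \<pi> \<i> \<rho> \<delta>(x - c)\<close> for each simple pole \<open>- c\<close> on the negative axis.
  At the finitely many \<open>c\<close> themselves the pointwise jump need not exist; these form a null set.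
\<close>

definition jump_integral :: "(complex \<Rightarrow> complex) \<Rightarrow> (real \<Rightarrow> complex) \<Rightarrow> real \<Rightarrow> complex" where
  "jump_integral f \<phi> \<epsilon> =
     (LINT x:{\<epsilon><..}|lborel. jump f x * \<phi> x)
     + (\<Sum>c | c \<in> cut_poles f \<and> c > \<epsilon>. - 2 * of_real pi * \<i> * cut_residue f c * \<phi> c)"

end

theory Submission
  imports Defs
begin

text \<open>
  With \<open>z = e\<^sup>w\<close>, Kummer's equation becomes
  \<open>V'' = (1 - b + e\<^sup>w) V' + a e\<^sup>w V\<close>, whose solutions are entire, and the two banks of the cut become
  the lines \<open>Im w = \<plusminus>\<pi>\<close>. The solution \<open>V\<close> asymptotic to \<open>e\<^bsup>-aw\<^esup>\<close> is a
  limit of the solutions with \<open>V e\<^bsup>aw\<^esup> = 1\<close>, \<open>(V e\<^bsup>aw\<^esup>)' = 0\<close> at \<open>w = n\<close>; an energy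
  estimate along directions in which \<open>Re e\<^sup>w\<close> decreases bounds it on a strip wider than
  \<open>\<bar>Im w\<bar> \<le> \<pi>\<close>. There the Riccati equation for \<open>V'/V\<close> yields a full expansion in powers of
  \<open>e\<^bsup>-w\<^esup>\<close>, with coefficients given by the recursion of the sequence, and near
  \<open>Re w = -\<infinity>\<close> the Frobenius solution gives a limit of \<open>V'/V\<close>. The moment formula is the residue
  theorem for \<open>e\<^bsup>(n-1)w\<^esup> V'/V\<close> on the rectangle
  \<open>[ln \<epsilon>, ln R] \<times> [-\<pi>, \<pi>]\<close>. If \<open>V\<close> vanishes on \<open>Im w = \<pi>\<close>, then by
  reflection it also vanishes at the conjugate point, so \<open>V(w + 2\<pi>\<i>)\<close> is a multiple of \<open>V(w)\<close>: the
  jump vanishes off the poles, and the rectangle is shifted upwards a little to enclose them.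
\<close>

section \<open>Entire solutions of the equation\<close>

text \<open>The obstacle is that Tricomi's function is characterised only inside the open slit
  plane, while the boundary values, the poles on the cut and the decay of the jump need control on
  the cut and beyond it. Hence an entire function is built independently in the logarithmic plane
  and identified with \<open>tricomi_U\<close> afterwards, by a uniqueness argument on the positive
  axis alone. The half-widths 4, 7/2 and 10/3 are successive strips: boundedness holds up to 4, and
  each passage from a bound on a function to one on its derivative is a Cauchy estimate that costs
  some width. All three exceed pi, which leaves room to shift the rectangle. The expansion in powers
  of e^(-w) takes the same value on both banks, so it cancels in the jump; this is why every moment
  converges at infinity. Near the origin both local exponents and a possible logarithm must be
  handled uniformly in b; dividing by one Frobenius solution and using the Wronskian avoids
  constructing the second one. The set argument below is there because the pull-back of a candidate
  for U solves the equation only on a strip.\<close>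

definition log_kummer_on ::
    "complex set \<Rightarrow> real \<Rightarrow> real \<Rightarrow> (complex \<Rightarrow> complex) \<Rightarrow> (complex \<Rightarrow> complex) \<Rightarrow> bool" where
  "log_kummer_on S a b V V' \<longleftrightarrow>
     (\<forall>w\<in>S. (V has_field_derivative V' w) (at w) \<and>
            (V' has_field_derivative (1 - of_real b + exp w) * V' w + of_real a * exp w * V w) (at w))"

abbreviation log_kummer where "log_kummer \<equiv> log_kummer_on UNIV"

text \<open>Taylor coefficients at 0 of the solution of v'' = (p + q e^w) v' + r e^w v with v(0) =
  c0 and v'(0) = c1. The factors 1/(n-i)! come from the Cauchy product with the exponential
  series.\<close>

fun exp_ode_coeff ::
    "complex \<Rightarrow> complex \<Rightarrow> complex \<Rightarrow> complex \<Rightarrow> complex \<Rightarrow> nat \<Rightarrow> complex" where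
  "exp_ode_coeff p q r c0 c1 0 = c0"
| "exp_ode_coeff p q r c0 c1 (Suc 0) = c1"
| "exp_ode_coeff p q r c0 c1 (Suc (Suc n)) =
     (p * (of_nat (Suc n) * exp_ode_coeff p q r c0 c1 (Suc n))
      + q * (\<Sum>i\<in>{0..n}. of_nat (Suc i) * exp_ode_coeff p q r c0 c1 (Suc i) / fact (n - i))
      + r * (\<Sum>i\<in>{0..n}. exp_ode_coeff p q r c0 c1 i / fact (n - i)))
     / (of_nat (Suc (Suc n)) * of_nat (Suc n))"

lemma sum_power_fact_le_exp:
  fixes x :: real
  assumes "x \<ge> 0"
  shows "(\<Sum>i\<in>{0..n}. x ^ (n - i) / fact (n - i)) \<le> exp x"
proof -
  have "(\<Sum>i\<in>{0..n}. x ^ (n - i) / fact (n - i)) = (\<Sum>i\<in>{..<Suc n}. x ^ i / fact i)"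
    by (rule sum.reindex_bij_witness[of _ "\<lambda>i. n - i" "\<lambda>i. n - i"]) auto
  also have "\<dots> \<le> (\<Sum>i. x ^ i / fact i)"
    using assms summable_exp_generic[of x]
    by (intro sum_le_suminf) (auto simp: field_simps scaleR_conv_of_real)
  also have "\<dots> = exp x"
    unfolding exp_def by (simp add: field_simps scaleR_conv_of_real)
  finally show ?thesis .
qed

text \<open>After multiplication by \<rho>^n, each part of the recursion is at most (m+1) A times a
  constant, and these constants add up to \<open>K\<close>. The denominator (m+2)(m+1) therefore
  leaves the factor K/(m+2), which is at most 1 once m reaches \<open>N\<close>. So the maximum
  \<open>A\<close> over the initial segment propagates to all n.\<close>

lemma exp_ode_coeff_bounded:
  assumes \<rho>: "\<rho> > 0"
  shows "\<exists>A. \<forall>n. norm (exp_ode_coeff p q r c0 c1 n) * \<rho> ^ n \<le> A"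
proof -
  let ?v = "exp_ode_coeff p q r c0 c1"
  define K where "K = norm p * \<rho> + norm q * \<rho> * exp \<rho> + norm r * \<rho>\<^sup>2 * exp \<rho>"
  have K0: "K \<ge> 0" unfolding K_def using \<rho> by (intro add_nonneg_nonneg) auto
  obtain N :: nat where N: "K \<le> N" using real_arch_simple by blast
  define A where "A = Max ((\<lambda>n. norm (?v n) * \<rho> ^ n) ` {..N+2})"
  have A: "norm (?v n) * \<rho> ^ n \<le> A" if "n \<le> N+2" for n
    unfolding A_def using that by (intro Max_ge) auto
  have A0: "A \<ge> 0" using order_trans[OF _ A[of 0], of 0] by simp
  have "norm (?v n) * \<rho> ^ n \<le> A" for n
  proof (induction n rule: less_induct)
    case (less n)
    show ?case
    proof (cases "n \<le> N + 2")
      case True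
      then show ?thesis by (rule A)
    next
      case False
      define m where "m = n - 2"
      have m: "n = Suc (Suc m)" "m \<ge> N" using False by (simp_all add: m_def)
      have IH: "norm (?v i) * \<rho> ^ i \<le> A" if "i < n" for i using less that by blast
      define S where "S = (\<Sum>i\<in>{0..m}. \<rho> ^ (m - i) / fact (m - i))"
      have S: "S \<le> exp \<rho>" "0 \<le> S"
        unfolding S_def using sum_power_fact_le_exp[of \<rho> m] \<rho> by (auto intro!: sum_nonneg)
      have 1: "norm (p * (of_nat (Suc m) * ?v (Suc m))) * \<rho> ^ n \<le> real (Suc m) * (norm p * \<rho>) * A"
      proof -
        have "norm (p * (of_nat (Suc m) * ?v (Suc m))) * \<rho> ^ n
          = (real (Suc m) * norm p * \<rho>) * (norm (?v (Suc m)) * \<rho> ^ Suc m)"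
          by (simp add: m norm_mult del: exp_ode_coeff.simps of_nat_Suc)
        also have "\<dots> \<le> (real (Suc m) * norm p * \<rho>) * A"
          using \<rho> by (intro mult_left_mono IH) (auto simp: m)
        finally show ?thesis by (simp add: mult_ac)
      qed
      have 2: "norm (\<Sum>i\<in>{0..m}. of_nat (Suc i) * ?v (Suc i) / fact (m - i)) * \<rho> ^ n
         \<le> real (Suc m) * (\<rho> * exp \<rho>) * A"
      proof -
        have "norm (\<Sum>i\<in>{0..m}. of_nat (Suc i) * ?v (Suc i) / fact (m - i)) * \<rho> ^ n
          \<le> (\<Sum>i\<in>{0..m}. norm (of_nat (Suc i) * ?v (Suc i) / fact (m - i))) * \<rho> ^ n"
          using \<rho> by (intro mult_right_mono norm_sum) auto
        also have "\<dots> = (\<Sum>i\<in>{0..m}. (real (Suc i) * \<rho> / fact (m - i) * \<rho>^(m-i)) * (norm (?v (Suc i)) * \<rho> ^ Suc i))"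
          unfolding sum_distrib_right
        proof (intro sum.cong refl)
          fix i assume "i \<in> {0..m}"
          then have e: "\<rho> ^ n = \<rho> * (\<rho>^(m-i) * \<rho> ^ Suc i)"
            unfolding m(1) power_add[symmetric] by (simp flip: power_Suc)
          show "norm (of_nat (Suc i) * ?v (Suc i) / fact (m - i)) * \<rho> ^ n =
            (real (Suc i) * \<rho> / fact (m - i) * \<rho>^(m-i)) * (norm (?v (Suc i)) * \<rho> ^ Suc i)"
            unfolding e norm_divide norm_mult norm_of_nat norm_fact by simp
        qed
        also have "\<dots> \<le> (\<Sum>i\<in>{0..m}. (real (Suc m) * \<rho> / fact (m - i) * \<rho>^(m-i)) * A)"
          using \<rho> A0 by (intro sum_mono mult_mono IH) (auto simp: m intro!: divide_right_mono mult_right_mono)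
        also have "\<dots> = real (Suc m) * \<rho> * A * S"
          unfolding S_def sum_distrib_left by (intro sum.cong) auto
        also have "\<dots> \<le> real (Suc m) * \<rho> * A * exp \<rho>"
          using \<rho> A0 S by (intro mult_left_mono) auto
        finally show ?thesis by (simp add: mult_ac)
      qed
      have 3: "norm (\<Sum>i\<in>{0..m}. ?v i / fact (m - i)) * \<rho> ^ n
         \<le> real (Suc m) * (\<rho>\<^sup>2 * exp \<rho>) * A"
      proof -
        have "norm (\<Sum>i\<in>{0..m}. ?v i / fact (m - i)) * \<rho> ^ n
          \<le> (\<Sum>i\<in>{0..m}. norm (?v i / fact (m - i))) * \<rho> ^ n"
          using \<rho> by (intro mult_right_mono norm_sum) auto
        also have "\<dots> = (\<Sum>i\<in>{0..m}. (\<rho>\<^sup>2 / fact (m - i) * \<rho>^(m-i)) * (norm (?v i) * \<rho> ^ i))"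
          unfolding sum_distrib_right
        proof (intro sum.cong refl)
          fix i assume "i \<in> {0..m}"
          then have e: "\<rho> ^ n = \<rho>\<^sup>2 * (\<rho>^(m-i) * \<rho> ^ i)"
            unfolding m(1) power_add[symmetric] by (simp add: power2_eq_square)
          show "norm (?v i / fact (m - i)) * \<rho> ^ n =
            (\<rho>\<^sup>2 / fact (m - i) * \<rho>^(m-i)) * (norm (?v i) * \<rho> ^ i)"
            unfolding e norm_divide norm_mult norm_of_nat norm_fact by simp
        qed
        also have "\<dots> \<le> (\<Sum>i\<in>{0..m}. (\<rho>\<^sup>2 / fact (m - i) * \<rho>^(m-i)) * A)"
          using \<rho> A0 by (intro sum_mono mult_mono IH) (auto simp: m)
        also have "\<dots> = \<rho>\<^sup>2 * A * S"
          unfolding S_def sum_distrib_left by (intro sum.cong) auto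
        also have "\<dots> \<le> \<rho>\<^sup>2 * A * exp \<rho>"
          using \<rho> A0 S by (intro mult_left_mono) auto
        also have "\<dots> \<le> real (Suc m) * (\<rho>\<^sup>2 * A * exp \<rho>)"
          using \<rho> A0 mult_right_mono[of 1 "real (Suc m)" "\<rho>\<^sup>2 * A * exp \<rho>"] by auto
        finally show ?thesis by (simp add: mult_ac)
      qed
      define X where "X = p * (of_nat (Suc m) * ?v (Suc m))
      + q * (\<Sum>i\<in>{0..m}. of_nat (Suc i) * ?v (Suc i) / fact (m - i))
      + r * (\<Sum>i\<in>{0..m}. ?v i / fact (m - i))"
      have "norm X * \<rho> ^ n \<le>
         (norm (p * (of_nat (Suc m) * ?v (Suc m)))
         + norm q * norm (\<Sum>i\<in>{0..m}. of_nat (Suc i) * ?v (Suc i) / fact (m - i))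
         + norm r * norm (\<Sum>i\<in>{0..m}. ?v i / fact (m - i))) * \<rho> ^ n"
        unfolding X_def norm_mult[symmetric]
        using \<rho> by (intro mult_right_mono norm_triangle_mono) auto
      also have "\<dots> \<le> real (Suc m) * (norm p * \<rho>) * A + norm q * (real (Suc m) * (\<rho> * exp \<rho>) * A)
          + norm r * (real (Suc m) * (\<rho>\<^sup>2 * exp \<rho>) * A)"
        using 1 mult_left_mono[OF 2 norm_ge_zero[of q]] mult_left_mono[OF 3 norm_ge_zero[of r]]
        by (simp only: distrib_right mult.assoc)
      also have "\<dots> = real (Suc m) * A * K" by (simp add: K_def algebra_simps)
      finally have X: "norm X * \<rho> ^ n \<le> real (Suc m) * A * K" .
      have "norm (?v n) = norm X / (real (Suc (Suc m)) * real (Suc m))"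
        unfolding m(1) exp_ode_coeff.simps X_def norm_divide norm_mult norm_of_nat ..
      then have "norm (?v n) * \<rho> ^ n = norm X * \<rho> ^ n / (real (Suc (Suc m)) * real (Suc m))"
        by simp
      also have "\<dots> \<le> real (Suc m) * A * K / (real (Suc (Suc m)) * real (Suc m))"
        by (intro divide_right_mono X) auto
      also have "\<dots> = A * (K / real (Suc (Suc m)))" by simp
      also have "\<dots> \<le> A * 1"
        using A0 N m K0 by (intro mult_left_mono) auto
      finally show ?thesis by simp
    qed
  qed
  then show ?thesis by blast
qed

lemma fps_conv_radius_infinity_if_bounded:
  fixes F :: "complex fps"
  assumes "\<And>\<rho>. \<rho> > 0 \<Longrightarrow> \<exists>A. \<forall>n. norm (fps_nth F n) * \<rho> ^ n \<le> A"
  shows "fps_conv_radius F = \<infinity>"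
  unfolding fps_conv_radius_def
proof (rule conv_radius_inftyI'')
  fix z :: complex
  \<comment> \<open>This radius makes the comparison series geometric with ratio |z|/\<rho> <
    1.\<close>
  define \<rho> where "\<rho> = 2 * norm z + 1"
  have \<rho>: "\<rho> > 0" by (simp add: \<rho>_def add_nonneg_pos)
  obtain A where A: "\<And>n. norm (fps_nth F n) * \<rho> ^ n \<le> A" using assms[OF \<rho>] by blast
  have x: "norm z / \<rho> < 1" using \<rho> by (simp add: \<rho>_def)
  show "summable (\<lambda>n. fps_nth F n * z ^ n)"
  proof (rule summable_comparison_test'[where g = "\<lambda>n. A * (norm z / \<rho>) ^ n" and N = 0])
    show "summable (\<lambda>n. A * (norm z / \<rho>) ^ n)"
      using x \<rho> by (intro summable_mult summable_geometric) auto
    show "norm (fps_nth F n * z ^ n) \<le> A * (norm z / \<rho>) ^ n" for n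
    proof -
      have "norm (fps_nth F n * z ^ n) = (norm (fps_nth F n) * \<rho> ^ n) * (norm z / \<rho>) ^ n"
        using \<rho> by (simp add: norm_mult norm_power power_divide)
      also have "\<dots> \<le> A * (norm z / \<rho>) ^ n"
        using \<rho> by (intro mult_right_mono A) auto
      finally show ?thesis .
    qed
  qed
qed

lemma exp_ode_existence:
  "\<exists>V V'. (\<forall>w. (V has_field_derivative V' w) (at w)) \<and>
     (\<forall>w. (V' has_field_derivative (p + q * exp w) * V' w + r * exp w * V w) (at w)) \<and>
     V 0 = c0 \<and> V' 0 = (c1 :: complex)"
proof -
  define F where "F = Abs_fps (exp_ode_coeff p q r c0 c1)"
  have R: "fps_conv_radius F = \<infinity>"
    by (rule fps_conv_radius_infinity_if_bounded)
       (use exp_ode_coeff_bounded in \<open>simp add: F_def\<close>)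
  have R': "fps_conv_radius (fps_deriv F) = \<infinity>"
    using fps_conv_radius_deriv[of F] R by simp
  have RQ: "fps_conv_radius (fps_exp 1 * F) = \<infinity>"  "fps_conv_radius (fps_exp 1 * fps_deriv F) = \<infinity>"
    using fps_conv_radius_mult[of "fps_exp 1" F] fps_conv_radius_mult[of "fps_exp 1" "fps_deriv F"] R R'
    by simp_all
  have cm: "eval_fps (fps_const c * G) w = c * eval_fps G w"
    and cr: "fps_conv_radius (fps_const c * G) = \<infinity>"
    if "fps_conv_radius G = \<infinity>" for c w and G :: "complex fps"
    using that fps_conv_radius_mult[of "fps_const c" G]  by (simp_all add: eval_fps_mult)
  have ode: "fps_deriv (fps_deriv F) = fps_const p * fps_deriv F + fps_const q * (fps_exp 1 * fps_deriv F)
      + fps_const r * (fps_exp 1 * F)"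
  proof (rule fps_ext)
    fix n
    have "fps_nth (fps_exp 1 * G) n = (\<Sum>i\<in>{0..n}. fps_nth G i / fact (n - i))" for G :: "complex fps"
      by (subst mult.commute) (simp add: fps_mult_nth field_simps)
    moreover have "fps_nth (fps_deriv (fps_deriv F)) n
        = of_nat (Suc (Suc n)) * of_nat (Suc n) * exp_ode_coeff p q r c0 c1 (Suc (Suc n))"
      by (simp add: F_def del: exp_ode_coeff.simps of_nat_Suc)
    moreover have "of_nat (Suc (Suc n)) * of_nat (Suc n) \<noteq> (0::complex)" by (simp del: of_nat_Suc)
    ultimately show "fps_nth (fps_deriv (fps_deriv F)) n = fps_nth (fps_const p * fps_deriv F
        + fps_const q * (fps_exp 1 * fps_deriv F) + fps_const r * (fps_exp 1 * F)) n"
      by (simp add: F_def del: of_nat_Suc)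
  qed
  have "(eval_fps F has_field_derivative eval_fps (fps_deriv F) w) (at w)" for w
    by (rule has_field_derivative_eval_fps) (simp add: R)
  moreover have "(eval_fps (fps_deriv F) has_field_derivative
     (p + q * exp w) * eval_fps (fps_deriv F) w + r * exp w * eval_fps F w) (at w)" for w
  proof -
    have "(eval_fps (fps_deriv F) has_field_derivative eval_fps (fps_deriv (fps_deriv F)) w) (at w)"
      by (rule has_field_derivative_eval_fps) (simp add: R')
    also have "eval_fps (fps_deriv (fps_deriv F)) w
       = (p + q * exp w) * eval_fps (fps_deriv F) w + r * exp w * eval_fps F w"
    proof -
      have r12: "fps_conv_radius (fps_const p * fps_deriv F + fps_const q * (fps_exp 1 * fps_deriv F)) = \<infinity>"
        using fps_conv_radius_add[of "fps_const p * fps_deriv F" "fps_const q * (fps_exp 1 * fps_deriv F)"]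
          cr[OF R'] cr[OF RQ(2)] by simp
      show ?thesis
        unfolding ode using r12 R R' RQ
        by (simp add: eval_fps_add cr cm eval_fps_mult distrib_right mult.assoc)
    qed
    finally show ?thesis .
  qed
  moreover have "eval_fps F 0 = c0" "eval_fps (fps_deriv F) 0 = c1"
    by (simp_all add: eval_fps_at_0 F_def)
  ultimately show ?thesis by blast
qed

text \<open>Translating by \<open>w0\<close> replaces e^w by e^(w0) e^w, which the free parameters q
  and r of \<open>exp_ode_existence\<close> absorb; so initial data may be prescribed at any
  point.\<close>

lemma log_kummer_existence:
  "\<exists>V V'. log_kummer a b V V' \<and> V w0 = c0 \<and> V' w0 = c1"
proof -
  obtain V V' where V: "\<And>w. (V has_field_derivative V' w) (at w)"
    "\<And>w. (V' has_field_derivative (1 - of_real b + exp w0 * exp w) * V' w + (of_real a * exp w0) * exp w * V w) (at w)"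
    "V 0 = c0" "V' 0 = c1"
    using exp_ode_existence[of "1 - of_real b" "exp w0" "of_real a * exp w0" c0 c1] by blast
  have "log_kummer a b (\<lambda>w. V (w - w0)) (\<lambda>w. V' (w - w0))"
    unfolding log_kummer_on_def
  proof (intro ballI conjI)
    fix w
    show "((\<lambda>w. V (w - w0)) has_field_derivative V' (w - w0)) (at w)"
      by (rule DERIV_cong, rule DERIV_chain'[OF _ V(1)]) (auto intro!: derivative_eq_intros)
    have "exp w0 * exp (w - w0) = exp w" by (simp flip: exp_add)
    then show "((\<lambda>w. V' (w - w0)) has_field_derivative
          (1 - of_real b + exp w) * V' (w - w0) + of_real a * exp w * V (w - w0)) (at w)"
      by (intro DERIV_cong[OF DERIV_chain'[OF _ V(2)]]) (auto intro!: derivative_eq_intros simp: mult.assoc)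
  qed
  then show ?thesis using V(3,4)
    by (intro exI[of _ "\<lambda>w. V (w - w0)"] exI[of _ "\<lambda>w. V' (w - w0)"]) auto
qed

section \<open>Uniqueness and energy estimates along line segments\<close>

lemma gronwall_bound:
  fixes E E' Q q :: "real \<Rightarrow> real"
  assumes "s \<le> T"
    and E: "\<And>t. s \<le> t \<Longrightarrow> t \<le> T \<Longrightarrow> (E has_real_derivative E' t) (at t)"
    and Q: "\<And>t. s \<le> t \<Longrightarrow> t \<le> T \<Longrightarrow> (Q has_real_derivative q t) (at t)"
    and le: "\<And>t. s \<le> t \<Longrightarrow> t \<le> T \<Longrightarrow> E' t \<le> q t * E t"
  shows "E T \<le> E s * exp (Q T - Q s)"
proof -
  have "E T * exp (- Q T) \<le> E s * exp (- Q s)"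
  proof (rule DERIV_nonpos_imp_nonincreasing[OF assms(1)])
    fix t assume t: "s \<le> t" "t \<le> T"
    have "((\<lambda>t. E t * exp (- Q t)) has_real_derivative (E' t - q t * E t) * exp (- Q t)) (at t)"
      by (rule derivative_eq_intros E[OF t] Q[OF t] refl | simp add: algebra_simps)+
    moreover have "(E' t - q t * E t) * exp (- Q t) \<le> 0"
      using le[OF t] by (intro mult_nonpos_nonneg) auto
    ultimately show "\<exists>y. ((\<lambda>t. E t * exp (- Q t)) has_real_derivative y) (at t) \<and> y \<le> 0" by blast
  qed
  then have "E T * exp (- Q T) * exp (Q T) \<le> E s * exp (- Q s) * exp (Q T)"
    by (intro mult_right_mono) auto
  then show ?thesis by (simp add: mult.assoc flip: exp_add)
qed

lemma has_real_derivative_norm_square_along_line: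
  fixes f :: "complex \<Rightarrow> complex"
  assumes "(f has_field_derivative f') (at (w0 + of_real t * v))"
  shows "((\<lambda>t. (norm (f (w0 + of_real t * v)))\<^sup>2) has_real_derivative
           2 * Re (cnj (f (w0 + of_real t * v)) * (f' * v))) (at t)"
proof -
  have 1: "((\<lambda>t. w0 + of_real t * v) has_vector_derivative v) (at t)"
    by (auto intro!: derivative_eq_intros simp: has_vector_derivative_def scaleR_conv_of_real)
  have g: "((\<lambda>t. f (w0 + of_real t * v)) has_vector_derivative v * f') (at t)"
    using field_vector_diff_chain_at[OF 1 assms] by (simp add: o_def)
  show ?thesis
    using bounded_bilinear.has_vector_derivative[OF bounded_bilinear_inner g g]
    by (simp add: has_real_derivative_iff_has_vector_derivative power2_norm_eq_inner
        inner_complex_def algebra_simps)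
qed

lemma Re_mult_le_norms: "\<bar>Re (x * y)\<bar> \<le> norm x * norm y"
  using abs_Re_le_cmod[of "x * y"] by (simp add: norm_mult)

lemma log_kummer_on_lincomb:
  assumes "log_kummer_on S a b V V'" "log_kummer_on S a b W W'"
  shows "log_kummer_on S a b (\<lambda>w. c * V w + d * W w) (\<lambda>w. c * V' w + d * W' w)"
  unfolding log_kummer_on_def
proof (intro ballI conjI)
  fix w assume w: "w \<in> S"
  note d = assms[unfolded log_kummer_on_def, rule_format, OF w]
  show "((\<lambda>w. c * V w + d * W w) has_field_derivative c * V' w + d * W' w) (at w)"
    using d by (auto intro!: derivative_eq_intros)
  show "((\<lambda>w. c * V' w + d * W' w) has_field_derivative
          (1 - of_real b + exp w) * (c * V' w + d * W' w) + of_real a * exp w * (c * V w + d * W w)) (at w)"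
    by (rule derivative_eq_intros d[THEN conjunct2] refl | simp add: algebra_simps)+
qed

text \<open>Gronwall for |V|^2 + |V'|^2 along the segment from \<open>w0\<close> to w. On it |e^u|
  is at most \<open>M\<close>, so the coefficients of the system are bounded and the energy, zero at
  the start, stays zero.\<close>

lemma log_kummer_zero_data:
  assumes V: "log_kummer a b V V'" and 0: "V w0 = 0" "V' w0 = 0"
  shows "V w = 0"
proof -
  define v where "v = w - w0"
  define M where "M = exp (norm w0 + norm v)"
  define c where "c = norm v * (1 + 2 * (norm (1 - b) + M) + \<bar>a\<bar> * M)"
  define E where "E t = (norm (V (w0 + of_real t * v)))\<^sup>2 + (norm (V' (w0 + of_real t * v)))\<^sup>2" for t
  define E' where "E' t = (let u = w0 + of_real t * v in
     2 * Re (cnj (V u) * (V' u * v)) +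
     2 * Re (cnj (V' u) * (((1 - of_real b + exp u) * V' u + of_real a * exp u * V u) * v)))" for t
  have "E 1 \<le> E 0 * exp (c * 1 - c * 0)"
  proof (rule gronwall_bound[where E' = E' and q = "\<lambda>_. c"])
    fix t :: real assume t: "0 \<le> t" "t \<le> 1"
    show "(E has_real_derivative E' t) (at t)"
      unfolding E_def[abs_def] E'_def Let_def
      using V[unfolded log_kummer_on_def]
      by (intro derivative_intros has_real_derivative_norm_square_along_line) auto
    show "((*) c has_real_derivative c) (at t)" by (auto intro!: derivative_eq_intros)
    define u where "u = w0 + of_real t * v"
    define x y where "x = norm (V u)" and "y = norm (V' u)"
    have xy: "x \<ge> 0" "y \<ge> 0" by (simp_all add: x_def y_def)
    have ex: "norm (exp u) \<le> M"
    proof -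
      have "Re u \<le> norm u" by (rule complex_Re_le_cmod)
      also have "\<dots> \<le> norm w0 + norm (of_real t * v)" unfolding u_def by (rule norm_triangle_ineq)
      also have "norm (of_real t * v) \<le> norm v" using t by (simp add: norm_mult mult_left_le_one_le)
      finally show ?thesis by (simp add: M_def)
    qed
    define p where "p = norm (1 - b) + M"
    have p: "norm (1 - of_real b + exp u) \<le> p"
      using norm_triangle_ineq[of "1 - of_real b" "exp u"] ex unfolding p_def
      by (metis add_left_mono norm_of_real of_real_1 of_real_diff order_trans real_norm_def)
    have q: "norm (of_real a * exp u) \<le> \<bar>a\<bar> * M"
      unfolding norm_mult using ex by (auto intro!: mult_left_mono)
    have "Re (cnj (V u) * (V' u * v)) \<le> norm v * (x * y)"
      using Re_mult_le_norms[of "cnj (V u)" "V' u * v"]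
      by (simp add: norm_mult x_def y_def mult_ac)
    moreover have "Re (cnj (V' u) * (((1 - of_real b + exp u) * V' u + of_real a * exp u * V u) * v))
       \<le> norm v * (p * y\<^sup>2 + \<bar>a\<bar> * M * (x * y))"
    proof -
      have "Re (cnj (V' u) * (((1 - of_real b + exp u) * V' u + of_real a * exp u * V u) * v))
         \<le> y * (norm ((1 - of_real b + exp u) * V' u + of_real a * exp u * V u) * norm v)"
        using Re_mult_le_norms[of "cnj (V' u)" "((1 - of_real b + exp u) * V' u + of_real a * exp u * V u) * v"]
        by (simp add: norm_mult[of _ v] y_def)
      also have "norm ((1 - of_real b + exp u) * V' u + of_real a * exp u * V u) \<le> p * y + \<bar>a\<bar> * M * x"
        by (intro norm_triangle_mono) (simp_all only: norm_mult x_def y_def mult_right_mono[OF p norm_ge_zero]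
            mult_right_mono[OF q[unfolded norm_mult] norm_ge_zero])
      finally show ?thesis using xy by (simp add: mult_left_mono mult_right_mono algebra_simps power2_eq_square)
    qed
    ultimately have "E' t \<le> norm v * (2 * (x * y) + 2 * (p * y\<^sup>2) + \<bar>a\<bar> * M * (2 * (x * y)))"
      unfolding E'_def Let_def u_def[symmetric] by (simp add: algebra_simps)
    also have "\<dots> \<le> norm v * ((x\<^sup>2 + y\<^sup>2) + 2 * (p * (x\<^sup>2 + y\<^sup>2)) + \<bar>a\<bar> * M * (x\<^sup>2 + y\<^sup>2))"
    proof -
      have "2 * (x * y) \<le> x\<^sup>2 + y\<^sup>2" using sum_squares_bound[of x y] by simp
      moreover have "p * y\<^sup>2 \<le> p * (x\<^sup>2 + y\<^sup>2)" by (intro mult_left_mono) (auto simp: p_def M_def)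
      moreover have "p \<ge> 0" by (simp add: p_def M_def)
      ultimately show ?thesis
        by (intro mult_left_mono add_mono) (auto simp: M_def)
    qed
    also have "\<dots> = c * E t" unfolding c_def E_def u_def[symmetric] x_def y_def p_def
      by (simp add: algebra_simps)
    finally show "E' t \<le> c * E t" .
  qed auto
  then have "E 1 \<le> 0" by (simp add: E_def 0)
  then have "(norm (V w))\<^sup>2 \<le> 0" unfolding E_def v_def by (smt (verit, best) add_diff_cancel_left' diff_add_cancel mult_1 of_real_1 zero_le_power2 add.commute)
  then show ?thesis by simp
qed

lemma log_kummer_unique:
  assumes "log_kummer a b V V'" "log_kummer a b W W'" "V w0 = W w0" "V' w0 = W' w0"
  shows "V w = W w" "V' w = W' w"
proof -
  have 1: "V w = W w" for w
    using log_kummer_zero_data[OF log_kummer_on_lincomb[OF assms(1,2), of 1 "-1"], of w0 w] assms(3,4)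
    by simp
  then have "V = W" by blast
  moreover have "(V has_field_derivative V' w) (at w)" "(W has_field_derivative W' w) (at w)"
    using assms(1,2) unfolding log_kummer_on_def by auto
  ultimately show "V w = W w" "V' w = W' w" using DERIV_unique by auto
qed

text \<open>In terms of \<open>Y = V e\<^bsup>aw\<^esup>\<close> and \<open>D = Y'\<close> the equation becomes a first order system
  whose fast component \<open>D\<close> is damped in every direction \<open>v\<close> in which \<open>Re e\<^sup>w\<close> decreases.\<close>

lemma log_kummer_scaled:
  assumes "log_kummer a b V V'"
  defines "Y \<equiv> \<lambda>w. V w * exp (of_real a * w)"
    and "D \<equiv> \<lambda>w. (V' w + of_real a * V w) * exp (of_real a * w)"
  shows "(Y has_field_derivative D w) (at w)"
    "(D has_field_derivative (of_real (1 + 2 * a - b) + exp w) * D w - of_real (a * (a + 1 - b)) * Y w) (at w)"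
proof -
  have d: "(V has_field_derivative V' w) (at w)"
    "(V' has_field_derivative (1 - of_real b + exp w) * V' w + of_real a * exp w * V w) (at w)"
    using assms(1) unfolding log_kummer_on_def by auto
  show "(Y has_field_derivative D w) (at w)"
    unfolding Y_def D_def
    by (rule derivative_eq_intros d refl | simp add: algebra_simps)+
  show "(D has_field_derivative (of_real (1 + 2 * a - b) + exp w) * D w - of_real (a * (a + 1 - b)) * Y w) (at w)"
    unfolding Y_def D_def
    by (rule derivative_eq_intros d refl | simp add: algebra_simps)+
qed

text \<open>Here y, d and z stand for Y, D and e^w, and P, Q are the rates of |Y|^2 and |D|^2 in
  direction v. Half of the damping -2\<sigma>|z||d|^2 pays for \<kappa>, and the other half absorbs
  both cross terms in |y||d|, leaving a growth rate of order 1/|z|. The bound on P + Q keeps the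
  energy from growing; the one on P - Q keeps |Y|^2 - |D|^2 from falling, so that a limit of such
  solutions cannot vanish.\<close>

lemma damped_energy_rates:
  fixes y d z v \<kappa> :: complex and m :: real
  assumes v: "norm v = 1" and \<sigma>: "\<sigma> > 0" and z: "z \<noteq> 0"
    and dir: "Re (v * z) \<le> - \<sigma> * norm z" and \<kappa>: "norm \<kappa> \<le> \<sigma> / 2 * norm z"
  defines "P \<equiv> 2 * Re (cnj y * (d * v))"
    and "Q \<equiv> 2 * Re (cnj d * (((\<kappa> + z) * d - of_real m * y) * v))"
    and "C \<equiv> (1 + \<bar>m\<bar>)\<^sup>2 / \<sigma>"
  shows "P + Q \<le> C / norm z * (norm y)\<^sup>2" "P - Q \<ge> - (C / norm z * (norm y)\<^sup>2)"
proof -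
  define s where "s = \<sigma> * norm z"
  define q where "q = (1 + \<bar>m\<bar>) * norm y"
  have s: "s > 0" using \<sigma> z by (simp add: s_def)
  have P: "\<bar>P\<bar> \<le> 2 * norm y * norm d"
    using Re_mult_le_norms[of "cnj y" "d * v"] v unfolding P_def by (simp add: norm_mult)
  have "cnj d * (((\<kappa> + z) * d - of_real m * y) * v) = (v * \<kappa> + v * z) * of_real ((norm d)\<^sup>2) - of_real m * (y * v * cnj d)"
    by (simp only: complex_norm_square) (simp add: algebra_simps)
  then have "Q = 2 * (Re (v * \<kappa>) + Re (v * z)) * (norm d)\<^sup>2 - 2 * m * Re (y * v * cnj d)"
    unfolding Q_def by (simp add: algebra_simps)
  also have "\<dots> \<le> 2 * (\<sigma> / 2 * norm z + (- \<sigma> * norm z)) * (norm d)\<^sup>2 + 2 * (\<bar>m\<bar> * (norm y * norm d))"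
  proof -
    have "Re (v * \<kappa>) \<le> \<sigma> / 2 * norm z"
      using Re_mult_le_norms[of v \<kappa>] v \<kappa> by simp
    then have "2 * (Re (v * \<kappa>) + Re (v * z)) * (norm d)\<^sup>2 \<le> 2 * (\<sigma> / 2 * norm z + (- \<sigma> * norm z)) * (norm d)\<^sup>2"
      using dir by (intro mult_right_mono mult_left_mono add_mono) auto
    moreover have "\<bar>m * Re (y * v * cnj d)\<bar> \<le> \<bar>m\<bar> * (norm y * norm d)"
      unfolding abs_mult using Re_mult_le_norms[of "y * v" "cnj d"] v
      by (intro mult_left_mono) (auto simp: norm_mult)
    ultimately show ?thesis by linarith
  qed
  finally have Q: "Q \<le> - s * (norm d)\<^sup>2 + 2 * \<bar>m\<bar> * norm y * norm d"
    by (simp add: s_def algebra_simps)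
  \<comment> \<open>Completing the square: \<open>q\<close> is chosen so that 2 q |d| is exactly the
    sum of the two cross terms.\<close>
  have "0 \<le> (s * norm d - q)\<^sup>2 / s" using s by simp
  also have "\<dots> = s * (norm d)\<^sup>2 + q\<^sup>2 / s - 2 * q * norm d"
    using s by (simp add: power2_diff field_simps power2_eq_square)
  also have "q\<^sup>2 / s = C / norm z * (norm y)\<^sup>2"
    by (simp add: q_def s_def C_def power_mult_distrib)
  finally have A: "2 * norm y * norm d + 2 * \<bar>m\<bar> * norm y * norm d \<le> s * (norm d)\<^sup>2 + C / norm z * (norm y)\<^sup>2"
    by (simp add: q_def algebra_simps)
  show "P + Q \<le> C / norm z * (norm y)\<^sup>2" "P - Q \<ge> - (C / norm z * (norm y)\<^sup>2)"
    using P Q A by linarith+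
qed

section \<open>The solution recessive at \<open>+\<infinity>\<close>\<close>

lemma exp_quarter_le_2: "exp (1/4::real) \<le> 2"
proof -
  have "exp (1/4::real) \<le> 1 + 1/4 + (1/4)\<^sup>2" by (rule exp_bound) auto
  also have "\<dots> \<le> 2" by (simp add: power2_eq_square)
  finally show ?thesis .
qed

lemma sum_squares_le_2D:
  fixes x y :: real
  assumes "x\<^sup>2 + y\<^sup>2 \<le> 2" "x \<ge> 0" "y \<ge> 0"
  shows "x \<le> 2" "y \<le> 2"
proof -
  have "x\<^sup>2 \<le> 4" "y\<^sup>2 \<le> 4"
    using assms(1) zero_le_power2[of x] zero_le_power2[of y] by linarith+
  then have "x\<^sup>2 \<le> 2\<^sup>2" "y\<^sup>2 \<le> 2\<^sup>2" by simp_all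
  then show "x \<le> 2" "y \<le> 2" using power2_le_imp_le[of _ 2] by auto
qed

text \<open>Start at the real point n with Y = 1, D = 0 and move left, where the damping is full (v
  = -1, \<sigma> = 1). The growth rate C e^(-x) is integrable at +\<infinity>, so the bounds on
  [L, n] do not depend on n. The Cauchy data at L then lie in a compact set, and since the solution
  space is two-dimensional, convergence of a subsequence of data gives convergence of the solutions
  everywhere.\<close>

lemma right_solution_on_reals:
  "\<exists>V V' L. log_kummer a b V V' \<and>
     (\<forall>x\<ge>L. let Y = norm (V (of_real x) * exp (of_real (a * x)));
                D = norm ((V' (of_real x) + of_real a * V (of_real x)) * exp (of_real (a * x)))
            in 1/2 \<le> Y\<^sup>2 - D\<^sup>2 \<and> Y\<^sup>2 + D\<^sup>2 \<le> 2)"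
proof -
  define \<kappa> where "\<kappa> = 1 + 2 * a - b"
  define m where "m = a * (a + 1 - b)"
  define C where "C = (1 + \<bar>m\<bar>)\<^sup>2"
  have C0: "C \<ge> 0" by (simp add: C_def)
  \<comment> \<open>The first logarithm makes \<kappa> small against e^x as the damping estimate
    demands. The second makes C e^(-L), the integral of the growth rate over [L, \<infinity>), at
    most 1/4, which keeps the energy below e^(1/4) and hence below 2.\<close>
  define L where "L = max 0 (max (ln (2 * \<bar>\<kappa>\<bar> + 1)) (ln (4 * C + 1)))"
  have L: "2 * \<bar>\<kappa>\<bar> \<le> exp x" "4 * C * exp (- x) \<le> 1" if "x \<ge> L" for x
  proof -
    have "ln (2 * \<bar>\<kappa>\<bar> + 1) \<le> x" "ln (4 * C + 1) \<le> x" using that by (auto simp: L_def)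
    then have "2 * \<bar>\<kappa>\<bar> + 1 \<le> exp x" "4 * C + 1 \<le> exp x" using C0
      by (metis abs_ge_zero add_nonneg_pos exp_le_cancel_iff exp_ln less_numeral_extra(1) mult_nonneg_nonneg zero_le_numeral)+
    then show "2 * \<bar>\<kappa>\<bar> \<le> exp x" "4 * C * exp (- x) \<le> 1" by (auto simp: exp_minus field_simps)
  qed
  let ?Y = "\<lambda>V x. V (of_real x) * exp (of_real (a * x)) :: complex"
  let ?D = "\<lambda>V V' x. (V' (of_real x) + of_real a * V (of_real x)) * exp (of_real (a * x)) :: complex"
  have "\<exists>V V'. log_kummer a b V V' \<and> V (of_nat n) = exp (- of_real a * of_nat n)
      \<and> V' (of_nat n) = - of_real a * exp (- of_real a * of_nat n)" for n :: nat
    by (rule log_kummer_existence)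
  then obtain V V' where V: "\<And>n. log_kummer a b (V n) (V' n)"
     and V0: "\<And>n. V n (of_nat n) = exp (- of_real a * of_nat n)"
       "\<And>n. V' n (of_nat n) = - of_real a * exp (- of_real a * of_nat n)" by metis
  have est: "1/2 \<le> (norm (?Y (V n) x))\<^sup>2 - (norm (?D (V n) (V' n) x))\<^sup>2 \<and>
       (norm (?Y (V n) x))\<^sup>2 + (norm (?D (V n) (V' n) x))\<^sup>2 \<le> 2"
    if x: "L \<le> x" "x \<le> real n" for x n
  proof -
    define Y where "Y = (\<lambda>w. V n w * exp (of_real a * w))"
    define D where "D = (\<lambda>w. (V' n w + of_real a * V n w) * exp (of_real a * w))"
    have d1: "(Y has_field_derivative D w) (at w)"
      and d2: "(D has_field_derivative (of_real \<kappa> + exp w) * D w - of_real m * Y w) (at w)" for w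
      unfolding Y_def D_def \<kappa>_def m_def by (rule log_kummer_scaled[OF V])+
    define u where "u t = complex_of_real (real n) + of_real t * (-1)" for t
    have n0: "Y (u 0) = 1" "D (u 0) = 0"
      by (simp_all add: u_def Y_def D_def V0 flip: exp_add)
    define EY where "EY t = (norm (Y (u t)))\<^sup>2" for t
    define ED where "ED t = (norm (D (u t)))\<^sup>2" for t
    define P where "P t = 2 * Re (cnj (Y (u t)) * (D (u t) * (-1)))" for t
    define Q where "Q t = 2 * Re (cnj (D (u t)) * (((of_real \<kappa> + exp (u t)) * D (u t) - of_real m * Y (u t)) * (-1)))" for t
    have dP: "(EY has_real_derivative P t) (at t)" for t
      unfolding EY_def P_def u_def by (rule has_real_derivative_norm_square_along_line[OF d1])
    have dQ: "(ED has_real_derivative Q t) (at t)" for t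
      unfolding ED_def Q_def u_def by (rule has_real_derivative_norm_square_along_line[OF d2])
    have rates: "P t + Q t \<le> C * exp (t - real n) * EY t" "P t - Q t \<ge> - (C * exp (t - real n) * EY t)"
      if t: "0 \<le> t" "t \<le> n - x" for t :: real
    proof -
      have nu: "norm (exp (u t)) = exp (real n - t)" by (simp add: u_def)
      have 1: "norm (-1::complex) = 1" "(1::real) > 0" "exp (u t) \<noteq> 0" by auto
      have 2: "Re (- 1 * exp (u t)) \<le> - 1 * norm (exp (u t))"
        by (simp add: u_def Re_exp Im_exp)
      have 3: "norm (of_real \<kappa> :: complex) \<le> 1 / 2 * norm (exp (u t))"
        unfolding nu using L(1)[of "real n - t"] t x by simp
      have 4: "(1 + \<bar>m\<bar>)\<^sup>2 / 1 / norm (exp (u t)) = C * exp (t - real n)"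
        unfolding nu C_def by (simp add: exp_diff)
      show "P t + Q t \<le> C * exp (t - real n) * EY t" "P t - Q t \<ge> - (C * exp (t - real n) * EY t)"
        using damped_energy_rates[OF 1 2 3, where y = "Y (u t)" and d = "D (u t)" and m = m]
        unfolding P_def Q_def EY_def 4 by auto
    qed
    have exq: "C * exp (t - real n) \<le> 1/4" if "t \<le> n - x" for t :: real
      using L(2)[of "real n - t"] that x by simp
    have up: "EY T + ED T \<le> 2" if T: "0 \<le> T" "T \<le> n - x" for T :: real
    proof -
      have "EY T + ED T \<le> (EY 0 + ED 0) * exp (C * exp (T - real n) - C * exp (0 - real n))"
      proof (rule gronwall_bound[where E' = "\<lambda>t. P t + Q t" and q = "\<lambda>t. C * exp (t - real n)"])
        fix t assume t: "0 \<le> t" "t \<le> T"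
        show "((\<lambda>t. EY t + ED t) has_real_derivative P t + Q t) (at t)"
          by (intro derivative_intros dP dQ)
        show "((\<lambda>t. C * exp (t - real n)) has_real_derivative C * exp (t - real n)) (at t)"
          by (auto intro!: derivative_eq_intros)
        have "P t + Q t \<le> C * exp (t - real n) * EY t" using rates(1) t T by simp
        also have "\<dots> \<le> C * exp (t - real n) * (EY t + ED t)"
          using C0 by (intro mult_left_mono) (auto simp: ED_def)
        finally show "P t + Q t \<le> C * exp (t - real n) * (EY t + ED t)" .
      qed (use T in auto)
      also have "EY 0 + ED 0 = 1" by (simp add: EY_def ED_def n0)
      also have "1 * exp (C * exp (T - real n) - C * exp (0 - real n)) \<le> exp (1/4)"
      proof -
        have "0 \<le> C * exp (0 - real n)" using C0 by simp
        then have "C * exp (T - real n) - C * exp (0 - real n) \<le> 1/4" using exq[OF T(2)] by linarith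
        then show ?thesis by simp
      qed
      finally show ?thesis using exp_quarter_le_2 by simp
    qed
    define T :: real where "T = n - x"
    have T: "0 \<le> T" using x by (simp add: T_def)
    \<comment> \<open>Since |Y|^2 is at most 2 by \<open>up\<close>, the difference falls at a rate
      of at most 2 C e^(t-n). Adding a primitive of this rate makes it monotone; the total loss from
      the initial value 1 is at most 1/2.\<close>
    have "EY 0 - ED 0 + 2 * C * exp (0 - real n) \<le> EY T - ED T + 2 * C * exp (T - real n)"
    proof (rule DERIV_nonneg_imp_nondecreasing[OF T])
      fix t assume t: "0 \<le> t" "t \<le> T"
      have "((\<lambda>t. EY t - ED t + 2 * C * exp (t - real n)) has_real_derivative P t - Q t + 2 * C * exp (t - real n)) (at t)"
        by (auto intro!: derivative_eq_intros dP dQ)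
      moreover have "C * exp (t - real n) * EY t \<le> C * exp (t - real n) * 2"
        using up[of t] t C0 by (intro mult_left_mono) (auto simp: ED_def T_def intro: order_trans[rotated])
      then have "P t - Q t + 2 * C * exp (t - real n) \<ge> 0"
        using rates(2)[of t] t by (simp add: T_def)
      ultimately show "\<exists>y. ((\<lambda>t. EY t - ED t + 2 * C * exp (t - real n)) has_real_derivative y) (at t) \<and> 0 \<le> y"
        by blast
    qed
    moreover have "EY 0 - ED 0 = 1" by (simp add: EY_def ED_def n0)
    moreover have "0 \<le> 2 * C * exp (0 - real n)" using C0 by simp
    moreover have "C * exp (T - real n) \<le> 1/4" using exq[of T] by (simp add: T_def)
    ultimately have low: "1/2 \<le> EY T - ED T" by linarith
    have "u T = of_real x" by (simp add: u_def T_def)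
    then show ?thesis using low up[of T] T by (simp add: EY_def ED_def Y_def D_def T_def)
  qed
  define A where "A n = (V n (of_real L), V' n (of_real L))" for n
  define N where "N = nat \<lceil>L\<rceil>"
  have N: "L \<le> real (n + N)" for n unfolding N_def by linarith
  have "bounded (range (\<lambda>n. A (n + N)))"
  proof -
    have "norm (A (n + N)) \<le> 2 * exp (- a * L) + (2 + \<bar>a\<bar> * 2) * exp (- a * L)" for n
    proof -
      let ?y = "?Y (V (n+N)) L" and ?d = "?D (V (n+N)) (V' (n+N)) L"
      have yd: "(norm ?y)\<^sup>2 + (norm ?d)\<^sup>2 \<le> 2" using est[of L "n + N"] N[of n] by auto
      have y2: "norm ?y \<le> 2" "norm ?d \<le> 2"
        by (rule sum_squares_le_2D[OF yd norm_ge_zero norm_ge_zero])+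
      define e where "e = exp (complex_of_real (a * L))"
      define e' where "e' = exp (- complex_of_real (a * L))"
      have ee: "e * e' = 1" unfolding e_def e'_def by (rule exp_minus_inverse)
      define y d where "y = ?y" and "d = ?d"
      have v: "V (n+N) (of_real L) = y * e'"
        unfolding y_def e_def[symmetric] by (simp only: mult.assoc ee mult_1_right)
      have "d - of_real a * y = V' (n+N) (of_real L) * e"
        unfolding y_def d_def e_def[symmetric] by (simp only: distrib_right mult.assoc add_diff_cancel_right')
      then have v': "V' (n+N) (of_real L) = (d - of_real a * y) * e'"
        by (simp only: mult.assoc ee mult_1_right)
      have ne: "norm e' = exp (- a * L)" by (simp add: e'_def)
      have y2: "norm y \<le> 2" "norm d \<le> 2" using y2 by (simp_all only: y_def d_def)
      have 1: "norm (V (n+N) (of_real L)) \<le> 2 * exp (- a * L)"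
        unfolding v norm_mult ne by (intro mult_right_mono y2) auto
      have "norm (d - of_real a * y) \<le> norm d + norm (of_real a * y)" by (rule norm_triangle_ineq4)
      also have "\<dots> \<le> 2 + \<bar>a\<bar> * 2"
        using y2 unfolding norm_mult by (intro add_mono mult_mono) auto
      finally have 2: "norm (V' (n+N) (of_real L)) \<le> (2 + \<bar>a\<bar> * 2) * exp (- a * L)"
        unfolding v' norm_mult[of _ e'] ne by (intro mult_right_mono) auto
      have "norm (A (n + N)) \<le> norm (V (n+N) (of_real L)) + norm (V' (n+N) (of_real L))"
        unfolding A_def by (rule norm_Pair_le)
      also have "\<dots> \<le> 2 * exp (- a * L) + (2 + \<bar>a\<bar> * 2) * exp (- a * L)"
        using 1 2 by (rule add_mono)
      finally show ?thesis .
    qed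
    then show ?thesis unfolding bounded_iff by blast
  qed
  then obtain l r where r: "strict_mono r" and lim: "(\<lambda>n. A (r n + N)) \<longlonglongrightarrow> l"
    using bounded_imp_convergent_subsequence[of "\<lambda>n. A (n + N)"] unfolding o_def by metis
  \<comment> \<open>\<open>E1\<close> and \<open>E2\<close> form the basis of solutions dual to
    Cauchy data at L, so the coordinates of \<open>V n\<close> are the entries of
    \<open>A n\<close>.\<close>
  obtain E1 E1' where E1: "log_kummer a b E1 E1'" "E1 (of_real L) = 1" "E1' (of_real L) = 0"
    using log_kummer_existence[of a b "of_real L" 1 0] by blast
  obtain E2 E2' where E2: "log_kummer a b E2 E2'" "E2 (of_real L) = 0" "E2' (of_real L) = 1"
    using log_kummer_existence[of a b "of_real L" 0 1] by blast
  have rep: "V n w = fst (A n) * E1 w + snd (A n) * E2 w" (is ?r1)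
    "V' n w = fst (A n) * E1' w + snd (A n) * E2' w" (is ?r2) for n w
  proof -
    have 0: "V n (of_real L) = fst (A n) * E1 (of_real L) + snd (A n) * E2 (of_real L)"
      "V' n (of_real L) = fst (A n) * E1' (of_real L) + snd (A n) * E2' (of_real L)"
      unfolding E1(2,3) E2(2,3) by (simp_all add: A_def)
    show ?r1 ?r2
      by (rule log_kummer_unique[OF V[of n] log_kummer_on_lincomb[OF E1(1) E2(1)] 0])+
  qed
  define W where "W = (\<lambda>w. fst l * E1 w + snd l * E2 w)"
  define W' where "W' = (\<lambda>w. fst l * E1' w + snd l * E2' w)"
  have W: "log_kummer a b W W'" unfolding W_def W'_def by (rule log_kummer_on_lincomb[OF E1(1) E2(1)])
  have limV: "(\<lambda>n. V (r n + N) w) \<longlonglongrightarrow> W w" "(\<lambda>n. V' (r n + N) w) \<longlonglongrightarrow> W' w" for w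
    unfolding rep W_def W'_def by (intro tendsto_intros lim)+
  have "1/2 \<le> (norm (?Y W x))\<^sup>2 - (norm (?D W W' x))\<^sup>2 \<and>
        (norm (?Y W x))\<^sup>2 + (norm (?D W W' x))\<^sup>2 \<le> 2" if x: "x \<ge> L" for x
  proof
    have ev: "eventually (\<lambda>n. x \<le> real (r n + N)) sequentially"
    proof -
      obtain K where K: "x \<le> real K" using real_arch_simple by blast
      have "x \<le> real (r n + N)" if "n \<ge> K" for n
        using seq_suble[OF r, of n] that K by linarith
      then show ?thesis unfolding eventually_sequentially by blast
    qed
    show "1/2 \<le> (norm (?Y W x))\<^sup>2 - (norm (?D W W' x))\<^sup>2"
      by (rule tendsto_lowerbound[where F = sequentially and f = "\<lambda>n. (norm (?Y (V (r n + N)) x))\<^sup>2 - (norm (?D (V (r n + N)) (V' (r n + N)) x))\<^sup>2"])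
        (intro tendsto_intros limV, rule eventually_mono[OF ev], use est x in auto)
    show "(norm (?Y W x))\<^sup>2 + (norm (?D W W' x))\<^sup>2 \<le> 2"
      by (rule tendsto_upperbound[where F = sequentially and f = "\<lambda>n. (norm (?Y (V (r n + N)) x))\<^sup>2 + (norm (?D (V (r n + N)) (V' (r n + N)) x))\<^sup>2"])
        (intro tendsto_intros limV, rule eventually_mono[OF ev], use est x in auto)
  qed
  with W show ?thesis unfolding Let_def by blast
qed

section \<open>From bounds on the real axis to bounds on a strip\<close>

lemma Cauchy_deriv_bound:
  fixes g :: "complex \<Rightarrow> complex"
  assumes r: "r > 0" and g: "\<And>z. z \<in> cball w r \<Longrightarrow> (g has_field_derivative g' z) (at z)"
    and B: "\<And>z. z \<in> cball w r \<Longrightarrow> norm (g z) \<le> B"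
  shows "norm (g' w) \<le> B / r"
proof -
  have h: "g holomorphic_on cball w r"
  proof (rule holomorphic_onI)
    fix z assume "z \<in> cball w r"
    from has_field_derivative_at_within[OF g[OF this]]
    show "g field_differentiable (at z within cball w r)"
      unfolding field_differentiable_def by (rule exI)
  qed
  have "norm ((deriv ^^ 1) g w) \<le> fact 1 * B / r ^ 1"
    by (rule Cauchy_inequality)
       (use r B in \<open>auto intro: holomorphic_on_subset[OF h] holomorphic_on_imp_continuous_on[OF h] simp: dist_norm\<close>)
  moreover have "deriv g w = g' w" using g[of w] r by (intro DERIV_imp_deriv) auto
  ultimately show ?thesis by simp
qed

text \<open>With |e^w| at least 1, the rate from \<open>damped_energy_rates\<close> is bounded by a
  constant, which suffices on segments of bounded length.\<close>

lemma damped_segment: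
  fixes Y D :: "complex \<Rightarrow> complex" and v :: complex and \<kappa> m :: real
  assumes Y: "\<And>w. (Y has_field_derivative D w) (at w)"
    and D: "\<And>w. (D has_field_derivative (of_real \<kappa> + exp w) * D w - of_real m * Y w) (at w)"
    and v: "norm v = 1" and \<sigma>: "\<sigma> > 0" and T: "T \<ge> 0"
    and dir: "\<And>t. 0 \<le> t \<Longrightarrow> t \<le> T \<Longrightarrow> Re (v * exp (w0 + of_real t * v)) \<le> - \<sigma> * norm (exp (w0 + of_real t * v))"
    and far: "\<And>t. 0 \<le> t \<Longrightarrow> t \<le> T \<Longrightarrow> 2 * \<bar>\<kappa>\<bar> / \<sigma> \<le> exp (Re (w0 + of_real t * v)) \<and> 1 \<le> exp (Re (w0 + of_real t * v))"
  defines "E \<equiv> \<lambda>w. (norm (Y w))\<^sup>2 + (norm (D w))\<^sup>2"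
  shows "E (w0 + of_real T * v) \<le> E w0 * exp ((1 + \<bar>m\<bar>)\<^sup>2 / \<sigma> * T)"
proof -
  define u where "u t = w0 + of_real t * v" for t
  define C where "C = (1 + \<bar>m\<bar>)\<^sup>2 / \<sigma>"
  have C0: "C \<ge> 0" using \<sigma> by (simp add: C_def)
  define P where "P t = 2 * Re (cnj (Y (u t)) * (D (u t) * v))" for t
  define Q where "Q t = 2 * Re (cnj (D (u t)) * (((of_real \<kappa> + exp (u t)) * D (u t) - of_real m * Y (u t)) * v))" for t
  have "E (u T) \<le> E (u 0) * exp (C * T - C * 0)"
  proof (rule gronwall_bound[OF T, where E' = "\<lambda>t. P t + Q t" and q = "\<lambda>_. C"])
    fix t assume t: "0 \<le> t" "t \<le> T"
    show "((\<lambda>t. E (u t)) has_real_derivative P t + Q t) (at t)"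
      unfolding E_def P_def Q_def u_def
      by (intro derivative_intros has_real_derivative_norm_square_along_line Y D)
    show "((*) C has_real_derivative C) (at t)" by (auto intro!: derivative_eq_intros)
    have nz: "norm (exp (u t)) = exp (Re (u t))" by simp
    have \<kappa>: "norm (of_real \<kappa> :: complex) \<le> \<sigma> / 2 * norm (exp (u t))"
      using far[OF t] \<sigma> unfolding nz u_def[symmetric] by (simp add: field_simps)
    have "P t + Q t \<le> (1 + \<bar>m\<bar>)\<^sup>2 / \<sigma> / norm (exp (u t)) * (norm (Y (u t)))\<^sup>2"
      unfolding P_def Q_def
      by (rule damped_energy_rates(1)[OF v \<sigma> _ dir[OF t, folded u_def] \<kappa>]) simp
    also have "\<dots> \<le> C * (norm (Y (u t)))\<^sup>2"
      unfolding C_def[symmetric] nz using far[OF t] C0 unfolding u_def[symmetric]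
      by (intro mult_right_mono) (auto simp: divide_le_eq mult_right_le_one_le intro!: mult_le_cancel_left1[THEN iffD2])
    also have "\<dots> \<le> C * E (u t)" using C0 by (intro mult_left_mono) (auto simp: E_def)
    finally show "P t + Q t \<le> C * E (u t)" .
  qed
  then show ?thesis by (simp add: u_def C_def)
qed

text \<open>The interval lies strictly between pi/2 and 3 pi/2. It contains every angle \<alpha> +
  Im w met by the paths used for the upper half of the strip.\<close>

lemma cos_negative_bound: "\<exists>\<sigma>>0. \<forall>\<phi>\<in>{2..17/4}. cos \<phi> \<le> - (\<sigma>::real)"
proof -
  have "\<exists>x\<in>{2..17/4}. \<forall>y\<in>{2..17/4}. cos y \<le> cos (x::real)"
    by (intro continuous_attains_sup continuous_intros) auto
  then obtain x :: real where x: "x \<in> {2..17/4}" "\<And>y. y \<in> {2..17/4} \<Longrightarrow> cos y \<le> cos x" by blast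
  have "cos (x - pi) > 0" using x(1) pi_gt3 pi_less_4 by (intro cos_gt_zero_pi) auto
  then have "cos x < 0" by (simp add: cos_diff)
  then show ?thesis using x(2) by (intro exI[of _ "- cos x"]) auto
qed

lemma Re_cis_mult_exp: "Re (cis \<alpha> * exp w) = cos (\<alpha> + Im w) * exp (Re w)"
  by (simp add: Re_exp Im_exp cos_add algebra_simps)

text \<open>In direction cis \<alpha> the damping condition is that cos(\<alpha> + Im w) be
  negative. No single direction serves for all heights from 0 to 4: \<alpha> = 2 carries the bound
  from the real axis to height 2 with angles in [2, 4], and \<alpha> = 1/4 carries it from height 2
  to height 4 with angles in [9/4, 17/4].\<close>

lemma scaled_bounded_upper_strip:
  fixes L :: real
  assumes V: "log_kummer a b V V'"
  defines "Y \<equiv> \<lambda>w. V w * exp (of_real a * w)"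
    and "D \<equiv> \<lambda>w. (V' w + of_real a * V w) * exp (of_real a * w)"
  assumes real: "\<And>x. x \<ge> L \<Longrightarrow> (norm (Y (of_real x)))\<^sup>2 + (norm (D (of_real x)))\<^sup>2 \<le> 2"
  shows "\<exists>L' B. \<forall>w. Re w \<ge> L' \<longrightarrow> 0 \<le> Im w \<longrightarrow> Im w \<le> 4 \<longrightarrow> (norm (Y w))\<^sup>2 + (norm (D w))\<^sup>2 \<le> B"
proof -
  define \<kappa> where "\<kappa> = 1 + 2 * a - b"
  define m where "m = a * (a + 1 - b)"
  have d1: "(Y has_field_derivative D w) (at w)"
    and d2: "(D has_field_derivative (of_real \<kappa> + exp w) * D w - of_real m * Y w) (at w)" for w
    unfolding Y_def D_def \<kappa>_def m_def by (rule log_kummer_scaled[OF V])+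
  obtain \<sigma> :: real where \<sigma>: "\<sigma> > 0" "\<And>\<phi>. 2 \<le> \<phi> \<Longrightarrow> \<phi> \<le> 17/4 \<Longrightarrow> cos \<phi> \<le> - \<sigma>"
    using cos_negative_bound by force
  define E where "E w = (norm (Y w))\<^sup>2 + (norm (D w))\<^sup>2" for w
  define L0 where "L0 = max L (max 0 (ln (2 * \<bar>\<kappa>\<bar> / \<sigma> + 1)))"
  have far: "2 * \<bar>\<kappa>\<bar> / \<sigma> \<le> exp x \<and> 1 \<le> exp x" if "x \<ge> L0" for x
  proof -
    have p: "2 * \<bar>\<kappa>\<bar> / \<sigma> + 1 > 0" using \<sigma>(1) by (intro add_nonneg_pos) auto
    have "ln (2 * \<bar>\<kappa>\<bar> / \<sigma> + 1) \<le> x" "0 \<le> x" using that by (auto simp: L0_def)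
    then have "2 * \<bar>\<kappa>\<bar> / \<sigma> + 1 \<le> exp x" using p by (metis exp_le_cancel_iff exp_ln)
    then show ?thesis using \<open>0 \<le> x\<close> by auto
  qed
  define M where "M = (1 + \<bar>m\<bar>)\<^sup>2 / \<sigma>"
  have M0: "M \<ge> 0" using \<sigma> by (simp add: M_def)
  have sin2: "sin (2::real) > 0" using pi_gt3 by (intro sin_gt_zero) auto
  have sin4: "sin (1/4::real) > 0" using pi_gt3 by (intro sin_gt_zero) auto
  have seg: "E w \<le> E (w - of_real T * cis \<alpha>) * exp (M * T)"
    if T: "T \<ge> 0" and Re0: "Re w \<ge> L0" "Re w - T * cos \<alpha> \<ge> L0"
      and ang: "2 \<le> \<alpha> + (Im w - T * sin \<alpha>)" "\<alpha> + Im w \<le> 17/4" and sin0: "sin \<alpha> \<ge> 0" for w T \<alpha>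
  proof -
    define w0 where "w0 = w - of_real T * cis \<alpha>"
    have path: "Re (w0 + of_real t * cis \<alpha>) \<ge> L0 \<and> 2 \<le> \<alpha> + Im (w0 + of_real t * cis \<alpha>)
         \<and> \<alpha> + Im (w0 + of_real t * cis \<alpha>) \<le> 17/4"
      if t: "0 \<le> t" "t \<le> T" for t
    proof -
      have s: "0 \<le> t * sin \<alpha>" "t * sin \<alpha> \<le> T * sin \<alpha>" using t sin0 by (auto intro: mult_right_mono)
      have "L0 \<le> Re w - (T - t) * cos \<alpha>"
      proof (cases "cos \<alpha> \<ge> 0")
        case True
        then have "(T - t) * cos \<alpha> \<le> T * cos \<alpha>" using t by (intro mult_right_mono) auto
        then show ?thesis using Re0 by linarith
      next
        case False
        then have "(T - t) * cos \<alpha> \<le> 0" using t by (intro mult_nonneg_nonpos) auto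
        then show ?thesis using Re0 by linarith
      qed
      then show ?thesis using s ang by (simp add: w0_def algebra_simps)
    qed
    have "E (w0 + of_real T * cis \<alpha>) \<le> E w0 * exp (M * T)"
      unfolding E_def M_def
    proof (rule damped_segment[OF d1 d2 _ \<sigma>(1) T])
      fix t assume t: "0 \<le> t" "t \<le> T"
      show "Re (cis \<alpha> * exp (w0 + of_real t * cis \<alpha>)) \<le> - \<sigma> * norm (exp (w0 + of_real t * cis \<alpha>))"
        unfolding Re_cis_mult_exp norm_exp_eq_Re
        using path[OF t] by (intro mult_right_mono \<sigma>(2)) auto
    qed (use path far in auto)
    then show ?thesis by (simp add: w0_def)
  qed
  define B1 where "B1 = 2 * exp (M * (2 / sin 2))"
  have low: "E w \<le> B1" if w: "Re w \<ge> L0" "0 \<le> Im w" "Im w \<le> 2" for w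
  proof -
    \<comment> \<open>The length that puts the starting point on the real axis. Direction cis 2
      leads to the left, so this point lies to the right of w and stays in the region where the real
      bound holds.\<close>
    define T where "T = Im w / sin 2"
    have T: "T \<ge> 0" "T * sin 2 = Im w" "T \<le> 2 / sin 2"
      using w sin2 by (auto simp: T_def divide_right_mono)
    have c2: "cos (2::real) \<le> 0" using \<sigma>(2)[of 2] \<sigma>(1) by auto
    have "Re w - T * cos 2 \<ge> Re w" using T(1) c2 by (simp add: mult_nonneg_nonpos)
    then have r: "Re w - T * cos 2 \<ge> L0" using w by linarith
    have "E w \<le> E (w - of_real T * cis 2) * exp (M * T)"
      by (rule seg) (use T r w sin2 in auto)
    also have "w - of_real T * cis 2 = of_real (Re w - T * cos 2)"
      by (rule complex_eqI) (use T in auto)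
    also have "E (of_real (Re w - T * cos 2)) * exp (M * T) \<le> 2 * exp (M * T)"
      using real[of "Re w - T * cos 2"] r by (intro mult_right_mono) (auto simp: E_def L0_def)
    also have "\<dots> \<le> B1"
    proof -
      have "M * T \<le> M * (2 / sin 2)" using T(3) M0 by (rule mult_left_mono)
      then show ?thesis unfolding B1_def by simp
    qed
    finally show ?thesis .
  qed
  have B1: "B1 > 0" by (simp add: B1_def)
  define T4 where "T4 = 2 / sin (1/4::real)"
  define B where "B = B1 * exp (M * T4)"
  have T40: "T4 > 0" using sin4 by (simp add: T4_def)
  \<comment> \<open>Direction cis (1/4) leads to the right, so the starting point at height 2 lies
    to the left of w by at most \<open>T4\<close>; this accounts for the shifted threshold.\<close>
  have "E w \<le> B" if w: "Re w \<ge> L0 + T4" "0 \<le> Im w" "Im w \<le> 4" for w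
  proof (cases "Im w \<le> 2")
    case True
    have "B1 * 1 \<le> B" unfolding B_def using M0 T40 B1 by (intro mult_left_mono) auto
    then show ?thesis using low[of w] w T40 True by auto
  next
    case False
    define T where "T = (Im w - 2) / sin (1/4)"
    have T: "T \<ge> 0" "T * sin (1/4) = Im w - 2" "T \<le> T4"
      using w False sin4 by (auto simp: T_def T4_def divide_right_mono)
    have "T * cos (1/4) \<le> T * 1" using T by (intro mult_left_mono) auto
    then have r: "Re w - T * cos (1/4) \<ge> L0" using T w by linarith
    have "E w \<le> E (w - of_real T * cis (1/4)) * exp (M * T)"
      by (rule seg) (use T r w sin4 T40 in auto)
    also have "\<dots> \<le> B1 * exp (M * T)"
      using r T by (intro mult_right_mono low) auto
    also have "\<dots> \<le> B" unfolding B_def using T M0 B1 by (auto intro!: mult_left_mono)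
    finally show ?thesis .
  qed
  then show ?thesis unfolding E_def by blast
qed

lemma log_kummer_cnj:
  assumes "log_kummer a b V V'"
  shows "log_kummer a b (\<lambda>w. cnj (V (cnj w))) (\<lambda>w. cnj (V' (cnj w)))"
  unfolding log_kummer_on_def
proof (intro ballI conjI)
  fix w
  have d: "(V has_field_derivative V' z) (at z)"
    "(V' has_field_derivative (1 - of_real b + exp z) * V' z + of_real a * exp z * V z) (at z)" for z
    using assms unfolding log_kummer_on_def by auto
  show "((\<lambda>w. cnj (V (cnj w))) has_field_derivative cnj (V' (cnj w))) (at w)"
    using has_field_derivative_cnj_cnj[OF d(1)[of "cnj w"]] by (simp add: o_def)
  show "((\<lambda>w. cnj (V' (cnj w))) has_field_derivative
         (1 - of_real b + exp w) * cnj (V' (cnj w)) + of_real a * exp w * cnj (V (cnj w))) (at w)"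
    using has_field_derivative_cnj_cnj[OF d(2)[of "cnj w"]] by (simp add: o_def exp_cnj)
qed

text \<open>The lower half follows by applying the upper half to the conjugate solution, whose
  values there are the conjugates of those of V.\<close>

lemma scaled_bounded_strip:
  assumes V: "log_kummer a b V V'"
  defines "Y \<equiv> \<lambda>w. V w * exp (of_real a * w)"
    and "D \<equiv> \<lambda>w. (V' w + of_real a * V w) * exp (of_real a * w)"
  assumes real: "\<And>x. x \<ge> L \<Longrightarrow> (norm (Y (of_real x)))\<^sup>2 + (norm (D (of_real x)))\<^sup>2 \<le> 2"
  shows "\<exists>L' B. \<forall>w. Re w \<ge> L' \<longrightarrow> \<bar>Im w\<bar> \<le> 4 \<longrightarrow> norm (Y w) \<le> B \<and> norm (D w) \<le> B"
proof -
  let ?V = "\<lambda>w. cnj (V (cnj w))" and ?V' = "\<lambda>w. cnj (V' (cnj w))"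
  have eq: "norm (?V w * exp (of_real a * w)) = norm (Y (cnj w))"
    "norm ((?V' w + of_real a * ?V w) * exp (of_real a * w)) = norm (D (cnj w))" for w
  proof -
    have "?V w * exp (of_real a * w) = cnj (Y (cnj w))"
      "(?V' w + of_real a * ?V w) * exp (of_real a * w) = cnj (D (cnj w))"
      by (simp_all add: Y_def D_def exp_cnj)
    then show "norm (?V w * exp (of_real a * w)) = norm (Y (cnj w))"
      "norm ((?V' w + of_real a * ?V w) * exp (of_real a * w)) = norm (D (cnj w))"
      by (simp_all only: complex_mod_cnj)
  qed
  obtain L1 B1 where 1: "\<And>w. Re w \<ge> L1 \<Longrightarrow> 0 \<le> Im w \<Longrightarrow> Im w \<le> 4 \<Longrightarrow> (norm (Y w))\<^sup>2 + (norm (D w))\<^sup>2 \<le> B1"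
    using scaled_bounded_upper_strip[OF V, of L] real unfolding Y_def D_def by blast
  have "\<exists>L' B. \<forall>w. Re w \<ge> L' \<longrightarrow> 0 \<le> Im w \<longrightarrow> Im w \<le> 4 \<longrightarrow>
     (norm (?V w * exp (of_real a * w)))\<^sup>2 + (norm ((?V' w + of_real a * ?V w) * exp (of_real a * w)))\<^sup>2 \<le> B"
    by (rule scaled_bounded_upper_strip[OF log_kummer_cnj[OF V], of L]) (simp only: eq, simp only: complex_cnj_complex_of_real real)
  then obtain L2 B2 where 2: "\<And>w. Re w \<ge> L2 \<Longrightarrow> 0 \<le> Im w \<Longrightarrow> Im w \<le> 4 \<Longrightarrow> (norm (Y (cnj w)))\<^sup>2 + (norm (D (cnj w)))\<^sup>2 \<le> B2"
    unfolding eq by blast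
  \<comment> \<open>The summand 1 makes B at least 1, so that a square bounded by B has its root
    bounded by B.\<close>
  define B where "B = \<bar>B1\<bar> + \<bar>B2\<bar> + 1"
  have est: "norm (Y w) \<le> B \<and> norm (D w) \<le> B" if w: "Re w \<ge> max L1 L2" "\<bar>Im w\<bar> \<le> 4" for w
  proof -
    have e: "(norm (Y w))\<^sup>2 + (norm (D w))\<^sup>2 \<le> B"
      using 1[of w] 2[of "cnj w"] w by (cases "Im w \<ge> 0") (auto simp: B_def)
    have sq: "x \<le> B" if "x\<^sup>2 \<le> B" "x \<ge> 0" for x
    proof -
      have "B * 1 \<le> B * B" by (intro mult_left_mono) (auto simp: B_def)
      then have "B \<le> B\<^sup>2" by (simp add: power2_eq_square)
      then have "x\<^sup>2 \<le> B\<^sup>2" using that(1) by (rule order_trans[rotated])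
      then show ?thesis by (rule power2_le_imp_le) (simp add: B_def)
    qed
    have "(norm (Y w))\<^sup>2 \<le> B" "(norm (D w))\<^sup>2 \<le> B"
      using e zero_le_power2[of "norm (Y w)"] zero_le_power2[of "norm (D w)"] by linarith+
    then show ?thesis using sq norm_ge_zero by blast
  qed
  show ?thesis
    by (rule exI[of _ "max L1 L2"], rule exI[of _ B], intro allI impI, rule est)
qed

text \<open>Boundedness improves itself: D' is bounded by Cauchy, so D' = (\<kappa> + e^w) D - m Y
  forces D to be of order e^(-Re w). As D is the derivative of Y, this makes Y converge with the
  same rate, and the solution is normalised by dividing by the limit.\<close>

lemma recessive_solution:
  "\<exists>V V' C L. log_kummer a b V V' \<and> (\<forall>w. Re w \<ge> L \<longrightarrow> \<bar>Im w\<bar> \<le> 7/2 \<longrightarrow>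
      norm (V w * exp (of_real a * w) - 1) \<le> C * exp (- Re w) \<and>
      norm ((V' w + of_real a * V w) * exp (of_real a * w)) \<le> C * exp (- Re w))"
proof -
  define \<kappa> where "\<kappa> = 1 + 2 * a - b"
  define m where "m = a * (a + 1 - b)"
  obtain V V' L0 where V: "log_kummer a b V V'" and V0:
     "\<And>x. x \<ge> L0 \<Longrightarrow> let Y = norm (V (of_real x) * exp (of_real (a * x)));
                D = norm ((V' (of_real x) + of_real a * V (of_real x)) * exp (of_real (a * x)))
            in 1/2 \<le> Y\<^sup>2 - D\<^sup>2 \<and> Y\<^sup>2 + D\<^sup>2 \<le> 2"
    using right_solution_on_reals by metis
  define Y where "Y = (\<lambda>w. V w * exp (of_real a * w))"
  define D where "D = (\<lambda>w. (V' w + of_real a * V w) * exp (of_real a * w))"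
  have d1: "(Y has_field_derivative D w) (at w)"
    and d2: "(D has_field_derivative (of_real \<kappa> + exp w) * D w - of_real m * Y w) (at w)" for w
    unfolding Y_def D_def \<kappa>_def m_def by (rule log_kummer_scaled[OF V])+
  have real: "1/2 \<le> (norm (Y (of_real x)))\<^sup>2 - (norm (D (of_real x)))\<^sup>2"
    "(norm (Y (of_real x)))\<^sup>2 + (norm (D (of_real x)))\<^sup>2 \<le> 2" if "x \<ge> L0" for x
    using V0[OF that] unfolding Y_def D_def Let_def of_real_mult by blast+
  have "\<exists>L' B. \<forall>w. Re w \<ge> L' \<longrightarrow> \<bar>Im w\<bar> \<le> 4 \<longrightarrow> norm (Y w) \<le> B \<and> norm (D w) \<le> B"
    unfolding Y_def D_def
    by (rule scaled_bounded_strip[OF V, of L0]) (use real(2) in \<open>simp only: Y_def D_def\<close>)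
  then obtain L1 B where B: "\<And>w. Re w \<ge> L1 \<Longrightarrow> \<bar>Im w\<bar> \<le> 4 \<Longrightarrow> norm (Y w) \<le> B \<and> norm (D w) \<le> B"
    by blast
  have B0: "B \<ge> 0" using B[of "of_real L1"] by (auto intro: order_trans[OF norm_ge_zero])
  define L where "L = max (max L0 (L1 + 1)) (max 0 (ln (2 * \<bar>\<kappa>\<bar> + 1)))"
  \<comment> \<open>2 B comes from Cauchy on a disc of radius 1/2, and |m| B from the Y term. The
    outer factor 2 comes from |\<kappa> + e^w| being at least e^(Re w)/2.\<close>
  define K where "K = 2 * (2 * B + \<bar>m\<bar> * B)"
  have K0: "K \<ge> 0" using B0 by (simp add: K_def)
  have Dsmall: "norm (D w) \<le> K * exp (- Re w)" if w: "Re w \<ge> L" "\<bar>Im w\<bar> \<le> 7/2" for w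
  proof -
    have "norm ((of_real \<kappa> + exp w) * D w - of_real m * Y w) \<le> B / (1/2)"
    proof (rule Cauchy_deriv_bound[OF _ d2])
      fix z assume "z \<in> cball w (1/2)"
      then have "\<bar>Re (w - z)\<bar> \<le> 1/2" "\<bar>Im (w - z)\<bar> \<le> 1/2"
        using abs_Re_le_cmod[of "w - z"] abs_Im_le_cmod[of "w - z"] by (auto simp: dist_norm)
      then have "Re z \<ge> Re w - 1/2" "\<bar>Im z\<bar> \<le> \<bar>Im w\<bar> + 1/2" unfolding minus_complex.sel by linarith+
      then show "norm (D z) \<le> B" using w by (intro B[THEN conjunct2]) (auto simp: L_def)
    qed auto
    moreover have "norm (of_real m * Y w) \<le> \<bar>m\<bar> * B"
      using B[of w] w unfolding norm_mult by (intro mult_mono) (auto simp: L_def)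
    ultimately have 1: "norm ((of_real \<kappa> + exp w) * D w) \<le> 2 * B + \<bar>m\<bar> * B"
      using norm_triangle_ineq[of "(of_real \<kappa> + exp w) * D w - of_real m * Y w" "of_real m * Y w"] by simp
    have "ln (2 * \<bar>\<kappa>\<bar> + 1) \<le> Re w" using w by (auto simp: L_def)
    then have "2 * \<bar>\<kappa>\<bar> + 1 \<le> exp (Re w)"
      by (metis abs_ge_zero add_nonneg_pos exp_le_cancel_iff exp_ln less_numeral_extra(1) mult_nonneg_nonneg zero_le_numeral)
    then have "exp (Re w) / 2 \<le> norm (exp w) - norm (of_real \<kappa> :: complex)" by simp
    also have "\<dots> \<le> norm (of_real \<kappa> + exp w)" by (metis add.commute norm_diff_ineq)
    finally have "exp (Re w) / 2 * norm (D w) \<le> norm ((of_real \<kappa> + exp w) * D w)"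
      unfolding norm_mult by (intro mult_right_mono) auto
    with 1 have "exp (Re w) * norm (D w) \<le> K" by (simp add: K_def)
    then show ?thesis by (simp add: exp_minus field_simps)
  qed
  have incr: "norm (Y (of_real x') - Y (of_real x)) \<le> K * exp (- x)" if x: "L \<le> x" "x \<le> x'" for x x'
  proof (cases "x = x'")
    case False
    have "norm (Y (of_real x') - Y (of_real x)) \<le> (- K * exp (- x')) - (- K * exp (- x))"
    proof (rule differentiable_bound_general)
      show "x < x'" using x False by simp
      have d: "((\<lambda>t. Y (of_real t)) has_vector_derivative D (of_real t)) (at t)" for t
        using has_vector_derivative_real_field[OF d1] .
      show "continuous_on {x..x'} (\<lambda>t. Y (of_real t))"
        using d by (meson continuous_at_imp_continuous_on has_vector_derivative_continuous)
      show "((\<lambda>t. Y (of_real t)) has_vector_derivative D (of_real t)) (at t)" for t by (rule d)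
      show "((\<lambda>t. - K * exp (- t)) has_vector_derivative K * exp (- t)) (at t)" for t
        by (auto intro!: derivative_eq_intros simp flip: has_real_derivative_iff_has_vector_derivative)
      show "norm (D (of_real t)) \<le> K * exp (- t)" if "x < t" "t < x'" for t
        using Dsmall[of "of_real t"] that x by auto
    qed (auto intro!: continuous_intros)
    also have "\<dots> \<le> K * exp (- x)" using K0 by simp
    finally show ?thesis .
  qed (use K0 in simp)
  have "Cauchy (\<lambda>n::nat. Y (of_real (L + n)))"
  proof (rule CauchyI')
    fix e :: real assume "e > 0"
    have "(\<lambda>n. K * exp (- (L + real n))) \<longlonglongrightarrow> 0"
      by real_asymp
    from order_tendstoD(2)[OF this \<open>e > 0\<close>]
    obtain M where M': "\<forall>n\<ge>M. K * exp (- (L + real n)) < e"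
      unfolding eventually_sequentially ..
    have M: "K * exp (- (L + real M)) < e" by (rule M'[rule_format, OF order_refl])
    show "\<exists>M. \<forall>p\<ge>M. \<forall>n>p. dist (Y (of_real (L + real p))) (Y (of_real (L + real n))) < e"
    proof (rule exI[of _ M], intro allI impI)
      fix p n assume pn: "p \<ge> M" "n > p"
      have "dist (Y (of_real (L + real p))) (Y (of_real (L + real n))) \<le> K * exp (- (L + real p))"
      proof -
        have "norm (Y (of_real (L + real n)) - Y (of_real (L + real p))) \<le> K * exp (- (L + real p))"
          by (rule incr) (use pn in auto)
        then show ?thesis unfolding dist_norm by (subst norm_minus_commute)
      qed
      also have "\<dots> \<le> K * exp (- (L + real M))" using pn K0 by (intro mult_left_mono) auto
      finally show "dist (Y (of_real (L + real p))) (Y (of_real (L + real n))) < e" using M by simp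
    qed
  qed
  then obtain y where y: "(\<lambda>n::nat. Y (of_real (L + n))) \<longlonglongrightarrow> y"
    using Cauchy_convergent_iff convergent_def by blast
  have yreal: "norm (y - Y (of_real x)) \<le> K * exp (- x)" if "x \<ge> L" for x
  proof (rule tendsto_upperbound[where F = sequentially and f = "\<lambda>n::nat. norm (Y (of_real (L + n)) - Y (of_real x))"])
    show "(\<lambda>n::nat. norm (Y (of_real (L + n)) - Y (of_real x))) \<longlonglongrightarrow> norm (y - Y (of_real x))"
      by (intro tendsto_intros y)
    obtain M :: nat where M: "x - L \<le> real M" using real_arch_simple by blast
    show "\<forall>\<^sub>F n in sequentially. norm (Y (of_real (L + n)) - Y (of_real x)) \<le> K * exp (- x)"
      using eventually_ge_at_top[of M]
    proof eventually_elim
      case (elim n)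
      then have "real M \<le> real n" by simp
      then show ?case by (intro incr that) (use M in linarith)
    qed
  qed simp
  \<comment> \<open>One K is spent along the real axis out to infinity, and four on the vertical
    segment from w to the axis, whose length is below 4.\<close>
  have yall: "norm (Y w - y) \<le> (5 * K) * exp (- Re w)" if w: "Re w \<ge> L" "\<bar>Im w\<bar> \<le> 7/2" for w
  proof -
    define S where "S = cbox (Complex (Re w) (-7/2)) (Complex (Re w) (7/2))"
    have S: "Re z = Re w \<and> \<bar>Im z\<bar> \<le> 7/2" if "z \<in> S" for z
      using that unfolding S_def in_cbox_complex_iff by auto
    have "norm (Y w - Y (of_real (Re w))) \<le> K * exp (- Re w) * norm (w - of_real (Re w))"
    proof (rule field_differentiable_bound)
      show "convex S" unfolding S_def by (rule convex_box)
      show "(Y has_field_derivative D z) (at z within S)" for z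
        by (rule has_field_derivative_at_within[OF d1])
      show "norm (D z) \<le> K * exp (- Re w)" if "z \<in> S" for z
        using Dsmall[of z] S[OF that] w by simp
      show "w \<in> S" "of_real (Re w) \<in> S"
        using w unfolding S_def in_cbox_complex_iff by auto
    qed
    also have "norm (w - of_real (Re w)) = \<bar>Im w\<bar>" by (simp add: cmod_def)
    also have "K * exp (- Re w) * \<bar>Im w\<bar> \<le> K * exp (- Re w) * 4"
      using w K0 by (intro mult_left_mono) auto
    finally have "norm (Y w - Y (of_real (Re w))) \<le> 4 * (K * exp (- Re w))" by simp
    moreover have "norm (Y (of_real (Re w)) - y) \<le> K * exp (- Re w)"
      using yreal[of "Re w"] w by (simp add: norm_minus_commute)
    ultimately show ?thesis
      using norm_triangle_ineq[of "Y w - Y (of_real (Re w))" "Y (of_real (Re w)) - y"] by simp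
  qed
  \<comment> \<open>The lower bound on |Y|^2 - |D|^2, carried through the construction on the real
    axis, is used here.\<close>
  have y0: "y \<noteq> 0"
  proof
    assume "y = 0"
    then have "(\<lambda>n::nat. (norm (Y (of_real (L + n))))\<^sup>2) \<longlonglongrightarrow> 0"
      using tendsto_power[OF tendsto_norm[OF y], of 2] by simp
    moreover have "\<forall>n. 1/2 \<le> (norm (Y (of_real (L + real n))))\<^sup>2"
    proof
      fix n
      show "1/2 \<le> (norm (Y (of_real (L + real n))))\<^sup>2"
        using real(1)[of "L + n"] zero_le_power2[of "norm (D (of_real (L + real n)))"] unfolding L_def by linarith
    qed
    ultimately have "(1/2::real) \<le> 0"
      by (rule tendsto_lowerbound[OF _ always_eventually]) simp
    then show False by simp
  qed
  define c where "c = 1 / y"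
  have cy: "c * y = 1" using y0 by (simp add: c_def)
  define W W' where "W = (\<lambda>w. c * V w)" and "W' = (\<lambda>w. c * V' w)"
  have W: "log_kummer a b W W'"
    using log_kummer_on_lincomb[OF V V, of c 0] by (simp add: W_def W'_def)
  define C where "C = norm c * (5 * K)"
  have est: "norm (W w * exp (of_real a * w) - 1) \<le> C * exp (- Re w) \<and>
      norm ((W' w + of_real a * W w) * exp (of_real a * w)) \<le> C * exp (- Re w)"
    if w: "Re w \<ge> L" "\<bar>Im w\<bar> \<le> 7/2" for w
  proof
    have "W w * exp (of_real a * w) - 1 = c * (Y w - y)"
      by (simp add: Y_def W_def right_diff_distrib mult.assoc cy)
    then show "norm (W w * exp (of_real a * w) - 1) \<le> C * exp (- Re w)"
      using mult_left_mono[OF yall[OF w] norm_ge_zero[of c]] by (simp only: norm_mult C_def mult.assoc)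
    have "(W' w + of_real a * W w) * exp (of_real a * w) = c * D w"
      by (simp add: D_def W_def W'_def algebra_simps)
    moreover have "norm (D w) \<le> 5 * K * exp (- Re w)"
      using Dsmall[OF w] mult_nonneg_nonneg[OF K0, of "exp (- Re w)"] by simp
    ultimately show "norm ((W' w + of_real a * W w) * exp (of_real a * w)) \<le> C * exp (- Re w)"
      using mult_left_mono[of "norm (D w)" _ "norm c"] by (simp only: norm_mult C_def mult.assoc norm_ge_zero)
  qed
  show ?thesis
    by (rule exI[of _ W], rule exI[of _ W'], rule exI[of _ C], rule exI[of _ L],
        rule conjI[OF W], intro allI impI, rule est)
qed

section \<open>Asymptotic expansion of the logarithmic derivative\<close>

text \<open>The square of the truncated sum and the truncated Cauchy product differ by the pairs i,
  j < N with i + j \<ge> N, each of which carries at least the power N of x.\<close>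

lemma truncated_square_bound:
  fixes c :: "nat \<Rightarrow> complex" and x :: complex
  assumes x: "norm x \<le> 1"
  shows "norm ((\<Sum>n<N. c n * x ^ n)\<^sup>2 - (\<Sum>n<N. (\<Sum>i\<le>n. c i * c (n - i)) * x ^ n))
           \<le> (\<Sum>n<N. norm (c n))\<^sup>2 * norm x ^ N"
proof -
  define f where "f = (\<lambda>i j. c i * c j * x ^ (i + j))"
  define S where "S = {..<N} \<times> {..<N}"
  define T where "T = {(i, j). i + j < N}"
  have TS: "T \<subseteq> S" "finite S" by (auto simp: S_def T_def)
  have 1: "(\<Sum>n<N. c n * x ^ n)\<^sup>2 = (\<Sum>(i,j)\<in>S. f i j)"
    unfolding power2_eq_square sum_product S_def sum.cartesian_product f_def
    by (intro sum.cong) (auto simp: power_add)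
  have 2: "(\<Sum>n<N. (\<Sum>i\<le>n. c i * c (n - i)) * x ^ n) = (\<Sum>(i,j)\<in>T. f i j)"
    unfolding T_def sum.triangle_reindex f_def sum_distrib_right by (intro sum.cong) auto
  have "norm ((\<Sum>n<N. c n * x ^ n)\<^sup>2 - (\<Sum>n<N. (\<Sum>i\<le>n. c i * c (n - i)) * x ^ n))
     = norm (\<Sum>(i,j)\<in>S - T. f i j)"
    unfolding 1 2 using sum_diff[OF TS(2,1), of "\<lambda>(i,j). f i j"] by simp
  also have "\<dots> \<le> (\<Sum>(i,j)\<in>S - T. norm (c i) * norm (c j) * norm x ^ N)"
  proof (rule sum_norm_le, clarify)
    fix i j assume "(i, j) \<in> S" "(i, j) \<notin> T"
    then have "N \<le> i + j" by (auto simp: T_def)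
    then have "norm x ^ (i + j) \<le> norm x ^ N" using x by (intro power_decreasing) auto
    then show "norm (f i j) \<le> norm (c i) * norm (c j) * norm x ^ N"
      unfolding f_def norm_mult norm_power by (intro mult_left_mono) auto
  qed
  also have "\<dots> \<le> (\<Sum>(i,j)\<in>S. norm (c i) * norm (c j) * norm x ^ N)"
    using TS by (intro sum_mono2) auto
  also have "\<dots> = (\<Sum>(i,j)\<in>S. norm (c i) * norm (c j)) * norm x ^ N"
    unfolding sum_distrib_right by (intro sum.cong) auto
  also have "(\<Sum>(i,j)\<in>S. norm (c i) * norm (c j)) = (\<Sum>n<N. norm (c n))\<^sup>2"
    unfolding power2_eq_square sum_product S_def sum.cartesian_product ..
  finally show ?thesis .
qed

lemma abs_components_in_cball:
  assumes "z \<in> cball w r"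
  shows "Re z \<ge> Re w - r" "\<bar>Im z\<bar> \<le> \<bar>Im w\<bar> + r"
proof -
  have "norm (w - z) \<le> r" using assms by (simp add: dist_norm)
  then have "\<bar>Re w - Re z\<bar> \<le> r" "\<bar>Im w - Im z\<bar> \<le> r"
    using abs_Re_le_cmod[of "w - z"] abs_Im_le_cmod[of "w - z"] by simp_all
  then show "Re z \<ge> Re w - r" "\<bar>Im z\<bar> \<le> \<bar>Im w\<bar> + r" by linarith+
qed

text \<open>The Riccati equation, solved for its dominant term, reads h = -a + e^(-w) (h' + h^2 +
  (b-1) h). Inserting an expansion of h with error of order N gives one of order N + 1, because the
  factor e^(-w) gains a power and the derivative of the error is controlled by Cauchy. The recursion
  for c is what this map does to the coefficients.\<close>

lemma log_derivative_expansion: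
  fixes a b :: real and c :: "nat \<Rightarrow> complex"
  assumes V: "log_kummer a b V V'"
    and asym: "\<And>w. Re w \<ge> L \<Longrightarrow> \<bar>Im w\<bar> \<le> 7/2 \<Longrightarrow>
      norm (V w * exp (of_real a * w) - 1) \<le> C * exp (- Re w) \<and>
      norm ((V' w + of_real a * V w) * exp (of_real a * w)) \<le> C * exp (- Re w)"
    and c0: "c 0 = - of_real a"
    and cS: "\<And>n. c (Suc n) = (of_real b - 1 - of_nat n) * c n + (\<Sum>i\<le>n. c i * c (n - i))"
    and \<omega>: "\<omega> < 7/2"
  shows "\<exists>K L'. \<forall>w. Re w \<ge> L' \<longrightarrow> \<bar>Im w\<bar> \<le> \<omega> \<longrightarrow>
           V w \<noteq> 0 \<and> norm (V' w / V w - (\<Sum>n<N. c n * exp (- w) ^ n)) \<le> K * exp (- Re w) ^ N"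
proof -
  \<comment> \<open>Beyond \<open>L1\<close> the scaled solution is within 1/2 of 1, so V has no
    zeros there and h is bounded by 1 + |a|. The 0 ensures |e^(-w)| \<le> 1.\<close>
  define L1 where "L1 = max L (max 0 (ln (2 * \<bar>C\<bar> + 1)))"
  have half: "C * exp (- x) \<le> 1/2" if "x \<ge> L1" for x
  proof -
    have "ln (2 * \<bar>C\<bar> + 1) \<le> x" using that by (auto simp: L1_def)
    then have "exp (ln (2 * \<bar>C\<bar> + 1)) \<le> exp x" by (simp only: exp_le_cancel_iff)
    moreover have "2 * \<bar>C\<bar> + 1 > 0" by linarith
    ultimately have "2 * \<bar>C\<bar> + 1 \<le> exp x" by (simp only: exp_ln)
    then show ?thesis by (simp add: exp_minus field_simps)
  qed
  define h where "h = (\<lambda>w. V' w / V w)"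
  define Hb where "Hb = 1 + \<bar>a\<bar>"
  have V0: "V w \<noteq> 0" and hb: "norm (h w) \<le> Hb" if w: "Re w \<ge> L1" "\<bar>Im w\<bar> \<le> 7/2" for w
  proof -
    define Y where "Y = V w * exp (of_real a * w)"
    define D where "D = (V' w + of_real a * V w) * exp (of_real a * w)"
    have "Re w \<ge> L" using w by (simp add: L1_def)
    from asym[OF this w(2)] half[OF w(1)] have Y: "norm (Y - 1) \<le> 1/2" and D: "norm D \<le> 1/2"
      unfolding Y_def D_def by auto
    have Yn: "norm Y \<ge> 1/2" using norm_triangle_ineq3[of Y 1] Y by (simp add: abs_le_iff)
    then have "Y \<noteq> 0" by auto
    then show v: "V w \<noteq> 0" by (auto simp: Y_def)
    have "h w = D / Y - of_real a" using v by (simp add: h_def D_def Y_def add_divide_distrib)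
    then have "norm (h w) \<le> norm (D / Y) + \<bar>a\<bar>" using norm_triangle_ineq4[of "D / Y" "of_real a"] by simp
    also have "norm (D / Y) \<le> (1/2) / (1/2)" unfolding norm_divide using D Yn by (intro frac_le) auto
    finally show "norm (h w) \<le> Hb" by (simp add: Hb_def)
  qed
  define h' where "h' = (\<lambda>w. (1 - of_real b + exp w) * h w + of_real a * exp w - (h w)\<^sup>2)"
  have dh: "(h has_field_derivative h' w) (at w)" if "Re w \<ge> L1" "\<bar>Im w\<bar> \<le> 7/2" for w
  proof -
    have d: "(V has_field_derivative V' w) (at w)"
      "(V' has_field_derivative (1 - of_real b + exp w) * V' w + of_real a * exp w * V w) (at w)"
      using V unfolding log_kummer_on_def by auto
    have v: "V w \<noteq> 0" by (rule V0[OF that])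
    have "(h has_field_derivative (((1 - of_real b + exp w) * V' w + of_real a * exp w * V w) * V w - V' w * V' w) / (V w * V w)) (at w)"
      unfolding h_def by (rule DERIV_divide[OF d(2,1) v])
    also have "(((1 - of_real b + exp w) * V' w + of_real a * exp w * V w) * V w - V' w * V' w) / (V w * V w) = h' w"
    proof -
      have "V' w = h w * V w" using v by (simp add: h_def)
      then have "((1 - of_real b + exp w) * V' w + of_real a * exp w * V w) * V w - V' w * V' w = h' w * (V w * V w)"
        unfolding h'_def by (simp add: power2_eq_square algebra_simps)
      then show ?thesis using v by simp
    qed
    finally show ?thesis .
  qed
  define P where "P N w = (\<Sum>n<N. c n * exp (- w) ^ n)" for N and w :: complex
  have "\<exists>K L'. L' \<ge> L1 \<and> (\<forall>w. Re w \<ge> L' \<longrightarrow> \<bar>Im w\<bar> \<le> \<omega> \<longrightarrow>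
           norm (h w - P N w) \<le> K * exp (- Re w) ^ N)" if "\<omega> < 7/2" for \<omega> N
    using that
  proof (induction N arbitrary: \<omega>)
    case 0
    show ?case
      by (rule exI[of _ Hb], rule exI[of _ L1]) (use 0 hb in \<open>auto simp: P_def\<close>)
  next
    case (Suc N)
    \<comment> \<open>Half of the remaining width 7/2 - \<omega>. The Cauchy discs need the
      induction hypothesis on a wider strip, which is why \<omega> is generalised in the
      induction.\<close>
    define r where "r = 7/4 - \<omega> / 2"
    have r: "r > 0" "\<omega> + r < 7/2" using Suc.prems by (auto simp: r_def)
    obtain K L' where L': "L' \<ge> L1" and IH: "\<And>w. Re w \<ge> L' \<Longrightarrow> \<bar>Im w\<bar> \<le> \<omega> + r \<Longrightarrow> norm (h w - P N w) \<le> K * exp (- Re w) ^ N"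
      using Suc.IH[OF r(2)] by metis
    define \<rho> where "\<rho> = (\<lambda>w. h w - P N w)"
    define P' where "P' w = (\<Sum>n<N. - (of_nat n) * c n * exp (- w) ^ n)" for w :: complex
    define Pb where "Pb = (\<Sum>n<N. norm (c n))"
    \<comment> \<open>On the disc of radius r, e^(-Re z) exceeds e^(-Re w) by at most the factor
      e^r.\<close>
    define B where "B = \<bar>K\<bar> * exp r ^ N"
    define K' where "K' = B / r + B * (Hb + Pb) + \<bar>b - 1\<bar> * B + Pb\<^sup>2"
    have "norm (h w - P (Suc N) w) \<le> K' * exp (- Re w) ^ Suc N"
      if w: "Re w \<ge> L' + r" "\<bar>Im w\<bar> \<le> \<omega>" for w
    proof -
      define x where "x = exp (- w)"
      define q where "q = exp (- Re w)"
      have "L1 \<ge> 0" unfolding L1_def by (simp only: max.coboundedI1 max.coboundedI2 order_refl)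
      then have Re0: "Re w \<ge> 0" using w L' r by linarith
      have x: "norm x = q" "norm x \<le> 1" "q \<ge> 0" "x * exp w = 1"
        using Re0 by (auto simp: x_def q_def simp flip: exp_add)
      have strip: "Re w \<ge> L1" "\<bar>Im w\<bar> \<le> 7/2" using w L' r by auto
      have \<rho>b: "norm (\<rho> z) \<le> B * q ^ N" if z: "z \<in> cball w r" for z
      proof -
        note zz = abs_components_in_cball[OF z]
        have "norm (\<rho> z) \<le> K * exp (- Re z) ^ N"
          unfolding \<rho>_def by (rule IH) (use zz w in auto)
        also have "\<dots> \<le> \<bar>K\<bar> * exp (- Re z) ^ N" by (intro mult_right_mono) auto
        also have "\<dots> \<le> \<bar>K\<bar> * (exp r * q) ^ N"
          using zz by (intro mult_left_mono power_mono) (auto simp: q_def simp flip: exp_add)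
        finally show ?thesis by (simp add: B_def power_mult_distrib)
      qed
      have dP: "(P N has_field_derivative P' z) (at z)" for z
        unfolding P_def[abs_def] P'_def
      proof (rule DERIV_sum)
        fix n
        show "((\<lambda>w. c n * exp (- w) ^ n) has_field_derivative - of_nat n * c n * exp (- z) ^ n) (at z)"
          unfolding exp_of_nat_mult[symmetric] by (auto intro!: derivative_eq_intros)
      qed
      have d\<rho>: "norm (h' w - P' w) \<le> B * q ^ N / r"
      proof (rule Cauchy_deriv_bound[where g = \<rho> and g' = "\<lambda>z. h' z - P' z" and w = w, OF r(1) _ \<rho>b])
        fix z assume z: "z \<in> cball w r"
        note zz = abs_components_in_cball[OF z]
        show "(\<rho> has_field_derivative h' z - P' z) (at z)"
          unfolding \<rho>_def by (intro DERIV_diff dh dP) (use zz w L' r in auto)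
      qed auto
      have \<rho>w: "norm (\<rho> w) \<le> B * q ^ N" using r by (intro \<rho>b) auto
      have Pw: "norm (P N w) \<le> Pb"
        unfolding P_def Pb_def
      proof (rule sum_norm_le)
        fix n
        show "norm (c n * exp (- w) ^ n) \<le> norm (c n)"
          using x power_le_one[of "norm x" n] unfolding x_def[symmetric] norm_mult norm_power
          by (intro mult_right_le_one_le) auto
      qed
      define R where "R = (P N w)\<^sup>2 - (\<Sum>n<N. (\<Sum>i\<le>n. c i * c (n - i)) * x ^ n)"
      have Rb: "norm R \<le> Pb\<^sup>2 * q ^ N"
        unfolding R_def P_def Pb_def x_def[symmetric] x(1)[symmetric] by (rule truncated_square_bound[OF x(2)])
      \<comment> \<open>\<open>hx\<close> and \<open>PS\<close> apply the same map to h and to its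
        partial sum; in \<open>PS\<close> the square is replaced by its truncated Cauchy product,
        and \<open>R\<close> is the difference between the two.\<close>
      have hx: "h w = - of_real a + x * (h' w + (h w)\<^sup>2 + (of_real b - 1) * h w)"
      proof -
        have "h' w + (h w)\<^sup>2 + (of_real b - 1) * h w = exp w * (h w + of_real a)"
          by (simp add: h'_def algebra_simps)
        then have "x * (h' w + (h w)\<^sup>2 + (of_real b - 1) * h w) = x * exp w * (h w + of_real a)" by simp
        then show ?thesis by (simp add: x(4))
      qed
      have PS: "P (Suc N) w = - of_real a + x * (P' w + (of_real b - 1) * P N w + (\<Sum>n<N. (\<Sum>i\<le>n. c i * c (n - i)) * x ^ n))"
      proof -
        have "P (Suc N) w = c 0 + (\<Sum>n<N. c (Suc n) * x ^ Suc n)"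
          unfolding P_def x_def[symmetric] sum.lessThan_Suc_shift by simp
        also have "(\<Sum>n<N. c (Suc n) * x ^ Suc n)
           = x * (P' w + (of_real b - 1) * P N w + (\<Sum>n<N. (\<Sum>i\<le>n. c i * c (n - i)) * x ^ n))"
          unfolding P_def P'_def x_def[symmetric] sum_distrib_left sum.distrib[symmetric] cS
          by (intro sum.cong refl) (simp add: algebra_simps)
        finally show ?thesis by (simp add: c0)
      qed
      have "h w - P (Suc N) w = x * ((h' w - P' w) + \<rho> w * (h w + P N w) + (of_real b - 1) * \<rho> w + R)"
        unfolding PS by (subst hx) (simp add: \<rho>_def R_def algebra_simps power2_eq_square)
      then have "norm (h w - P (Suc N) w) = q * norm ((h' w - P' w) + \<rho> w * (h w + P N w) + (of_real b - 1) * \<rho> w + R)"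
        by (simp add: norm_mult x(1))
      also have "\<dots> \<le> q * (B * q ^ N / r + (B * q ^ N) * (Hb + Pb) + \<bar>b - 1\<bar> * (B * q ^ N) + Pb\<^sup>2 * q ^ N)"
      proof (intro mult_left_mono norm_triangle_mono d\<rho> Rb x(3))
        have "norm (h w + P N w) \<le> Hb + Pb" by (intro norm_triangle_mono hb strip Pw)
        then show "norm (\<rho> w * (h w + P N w)) \<le> (B * q ^ N) * (Hb + Pb)"
          unfolding norm_mult using \<rho>w by (intro mult_mono) (auto intro: order_trans[OF norm_ge_zero])
        have "norm (of_real b - 1 :: complex) = \<bar>b - 1\<bar>" by (metis norm_of_real of_real_1 of_real_diff)
        then show "norm ((of_real b - 1) * \<rho> w) \<le> \<bar>b - 1\<bar> * (B * q ^ N)"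
          unfolding norm_mult using \<rho>w by (simp add: mult_left_mono)
      qed
      also have "\<dots> = K' * q ^ Suc N" by (simp add: K'_def algebra_simps)
      finally show ?thesis by (simp add: q_def)
    qed
    then show ?case using L' r by (intro exI[of _ K'] exI[of _ "L' + r"]) auto
  qed
  from this[OF \<omega>, of N] obtain K L' where KL: "L' \<ge> L1" "\<forall>w. Re w \<ge> L' \<longrightarrow> \<bar>Im w\<bar> \<le> \<omega> \<longrightarrow>
           norm (h w - P N w) \<le> K * exp (- Re w) ^ N" by metis
  show ?thesis
  proof (rule exI[of _ K], rule exI[of _ L'], intro allI impI conjI)
    fix w assume w: "Re w \<ge> L'" "\<bar>Im w\<bar> \<le> \<omega>"
    show "V w \<noteq> 0" by (rule V0) (use w KL(1) \<omega> in auto)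
    show "norm (V' w / V w - (\<Sum>n<N. c n * exp (- w) ^ n)) \<le> K * exp (- Re w) ^ N"
      using KL(2)[rule_format, OF w] by (simp only: h_def P_def)
  qed
qed

section \<open>The logarithmic derivative near the origin\<close>

text \<open>Corresponds under w = Ln z to z tending to 0. The half-width 4 exceeds pi, so uniform
  limits along this filter also hold on the edges Im w = \<plusminus>pi and on the shifted
  rectangle.\<close>

definition left_end :: "complex filter" where
  "left_end = inf (filtercomap Re at_bot) (principal {w. \<bar>Im w\<bar> \<le> 4})"

lemma eventually_left_end:
  "eventually P left_end \<longleftrightarrow> (\<exists>l. \<forall>w. Re w \<le> l \<longrightarrow> \<bar>Im w\<bar> \<le> 4 \<longrightarrow> P w)"
  unfolding left_end_def eventually_inf_principal eventually_filtercomap_at_bot_linorder by auto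

lemma tendsto_of_real_function_left_end:
  assumes "(g \<longlongrightarrow> l) at_bot"
  shows "((\<lambda>w. g (Re w)) \<longlongrightarrow> l) left_end"
proof -
  have "filterlim Re at_bot left_end"
    unfolding left_end_def by (rule filterlim_mono[OF filterlim_filtercomap]) auto
  then show ?thesis using assms by (rule filterlim_compose[rotated])
qed

lemma tendsto_exp_left_end: "(exp \<longlongrightarrow> 0) left_end"
  by (rule tendsto_norm_zero_cancel)
     (use tendsto_of_real_function_left_end[OF exp_at_bot] in simp)

lemma power_fact_le_exp:
  fixes x :: real
  assumes "x \<ge> 0"
  shows "x ^ n / fact n \<le> exp x"
proof -
  have "x ^ (n - 0) / fact (n - 0) \<le> (\<Sum>i\<in>{0..n}. x ^ (n - i) / fact (n - i))"
    by (rule member_le_sum[of 0 "{0..n}" "\<lambda>i. x ^ (n - i) / fact (n - i)"]) (use assms in auto)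
  then show ?thesis using sum_power_fact_le_exp[OF assms, of n] by simp
qed

text \<open>Kummer's function \<open>M(\<alpha>, \<beta>, z)\<close>.\<close>

lemma kummer_entire_solution:
  fixes \<alpha> \<beta> :: real
  assumes \<beta>: "\<beta> \<ge> 1"
  shows "\<exists>M M' M''. (\<forall>z. (M has_field_derivative M' z) (at z) \<and> (M' has_field_derivative M'' z) (at z) \<and>
            z * M'' z + (of_real \<beta> - z) * M' z - of_real \<alpha> * M z = 0) \<and> M (0::complex) = (1::complex)"
proof -
  define c :: "nat \<Rightarrow> real" where "c n = (\<Prod>i<n. (\<alpha> + real i) / ((\<beta> + real i) * (real i + 1)))" for n
  define F where "F = Abs_fps (\<lambda>n. complex_of_real (c n))"
  have cS: "c (Suc n) * ((\<beta> + n) * (n + 1)) = c n * (\<alpha> + n)" for n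
  proof -
    have "(\<beta> + n) * (n + 1) \<noteq> 0" using \<beta> by simp
    moreover have "c (Suc n) = c n * ((\<alpha> + n) / ((\<beta> + n) * (n + 1)))" by (simp add: c_def)
    moreover have "x * (p / q) * q = x * p" if "q \<noteq> 0" for x p q :: real using that by simp
    ultimately show ?thesis by (simp only:)
  qed
  define K where "K = \<bar>\<alpha>\<bar> + 1"
  have K: "K > 0" by (simp add: K_def)
  have cb: "\<bar>c n\<bar> \<le> K ^ n / fact n" for n
  proof (induction n)
    case (Suc n)
    \<comment> \<open>Since \<beta> is at least 1, the ratio of successive coefficients is at most
      K/(n+1), so the series is dominated by that of e^(K z).\<close>
    have "\<bar>\<alpha> + n\<bar> \<le> K * (\<beta> + n)"
    proof -
      have "\<bar>\<alpha> + n\<bar> \<le> \<bar>\<alpha>\<bar> * 1 + n" by simp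
      also have "\<dots> \<le> \<bar>\<alpha>\<bar> * (\<beta> + n) + (\<beta> + n)" using \<beta> by (intro add_mono mult_left_mono) auto
      finally show ?thesis by (simp add: K_def algebra_simps)
    qed
    then have q: "\<bar>\<alpha> + n\<bar> / \<bar>\<beta> + n\<bar> \<le> K" using \<beta> by (simp add: divide_le_eq)
    have "\<bar>c (Suc n)\<bar> = \<bar>c n\<bar> * (\<bar>\<alpha> + n\<bar> / \<bar>\<beta> + n\<bar>) / (n + 1)"
    proof -
      have "c (Suc n) = c n * ((\<alpha> + n) / (\<beta> + n)) / (n + 1)" by (simp add: c_def)
      then show ?thesis by (simp only: abs_mult abs_divide)
    qed
    also have "\<dots> \<le> (K ^ n / fact n) * K / (n + 1)"
      using Suc q K by (intro divide_right_mono mult_mono) auto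
    also have "\<dots> = K ^ Suc n / fact (Suc n)" by (simp add: field_simps)
    finally show ?case .
  qed (simp add: c_def)
  have R: "fps_conv_radius F = \<infinity>"
  proof (rule fps_conv_radius_infinity_if_bounded)
    fix \<rho> :: real assume \<rho>: "\<rho> > 0"
    have "norm (fps_nth F n) * \<rho> ^ n \<le> exp (K * \<rho>)" for n
    proof -
      have "norm (fps_nth F n) * \<rho> ^ n \<le> (K ^ n / fact n) * \<rho> ^ n"
        using cb[of n] \<rho> by (intro mult_right_mono) (auto simp: F_def)
      also have "\<dots> = (K * \<rho>) ^ n / fact n" by (simp add: power_mult_distrib)
      also have "\<dots> \<le> exp (K * \<rho>)" using K \<rho> by (intro power_fact_le_exp) auto
      finally show ?thesis .
    qed
    then show "\<exists>A. \<forall>n. norm (fps_nth F n) * \<rho> ^ n \<le> A" by metis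
  qed
  have R1: "fps_conv_radius (fps_deriv F) = \<infinity>" using fps_conv_radius_deriv[of F] R by simp
  have R2: "fps_conv_radius (fps_deriv (fps_deriv F)) = \<infinity>" using fps_conv_radius_deriv[of "fps_deriv F"] R1 by simp
  have cm: "eval_fps (G * H) z = eval_fps G z * eval_fps H z" and cr: "fps_conv_radius (G * H) = \<infinity>"
    if "fps_conv_radius G = \<infinity>" "fps_conv_radius H = \<infinity>" for G H :: "complex fps" and z
    using that fps_conv_radius_mult[of G H] by (simp_all add: eval_fps_mult)
  have ode: "fps_X * fps_deriv (fps_deriv F) + fps_const (of_real \<beta>) * fps_deriv F
      = fps_X * fps_deriv F + fps_const (of_real \<alpha>) * F"
  proof (rule fps_ext)
    fix n
    have e: "of_real (\<beta> + n) * (of_nat (n + 1) * of_real (c (Suc n))) = (of_real (c n) * of_real (\<alpha> + n) :: complex)"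
      using arg_cong[OF cS[of n], of complex_of_real] by (simp add: algebra_simps)
    show "fps_nth (fps_X * fps_deriv (fps_deriv F) + fps_const (of_real \<beta>) * fps_deriv F) n
      = fps_nth (fps_X * fps_deriv F + fps_const (of_real \<alpha>) * F) n"
      using e by (cases n) (simp_all add: F_def algebra_simps)
  qed
  let ?M = "eval_fps F" and ?M' = "eval_fps (fps_deriv F)" and ?M'' = "eval_fps (fps_deriv (fps_deriv F))"
  have "z * ?M'' z + (of_real \<beta> - z) * ?M' z - of_real \<alpha> * ?M z = 0" for z
  proof -
    have "eval_fps (fps_X * fps_deriv (fps_deriv F) + fps_const (of_real \<beta>) * fps_deriv F) z
      = z * ?M'' z + of_real \<beta> * ?M' z"
      by (simp add: eval_fps_add cr cm R1 R2)
    moreover have "eval_fps (fps_X * fps_deriv F + fps_const (of_real \<alpha>) * F) z = z * ?M' z + of_real \<alpha> * ?M z"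
      by (simp add: eval_fps_add cr cm R1 R)
    ultimately show ?thesis using ode by (simp add: algebra_simps)
  qed
  moreover have "(?M has_field_derivative ?M' z) (at z)" "(?M' has_field_derivative ?M'' z) (at z)" for z
    by (rule has_field_derivative_eval_fps, simp add: R R1)+
  moreover have "?M 0 = 1" by (simp add: eval_fps_at_0 F_def c_def)
  ultimately show ?thesis by (intro exI[of _ ?M] exI[of _ ?M'] exI[of _ ?M'']) simp
qed

text \<open>Abel's formula: (1-b) w + e^w is a primitive of the coefficient of V'.\<close>

lemma log_kummer_wronskian:
  assumes S: "convex S" and V: "log_kummer_on S a b V V'" and W: "log_kummer_on S a b W W'"
  shows "\<exists>C. \<forall>w\<in>S. V w * W' w - V' w * W w = C * exp ((1 - of_real b) * w + exp w)"
proof -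
  define G where "G = (\<lambda>w. (V w * W' w - V' w * W w) * exp (- ((1 - of_real b) * w + exp w)))"
  have "\<exists>C. \<forall>w\<in>S. G w = C"
  proof (rule has_field_derivative_zero_constant[OF S])
    fix w assume w: "w \<in> S"
    note d = V[unfolded log_kummer_on_def, rule_format, OF w] W[unfolded log_kummer_on_def, rule_format, OF w]
    have "(G has_field_derivative 0) (at w)"
      unfolding G_def
      by (rule derivative_eq_intros d[THEN conjunct1] d[THEN conjunct2] refl | simp add: algebra_simps)+
    then show "(G has_field_derivative 0) (at w within S)" by (rule has_field_derivative_at_within)
  qed
  then obtain C where C: "\<And>w. w \<in> S \<Longrightarrow> G w = C" by blast
  have "V w * W' w - V' w * W w = C * exp ((1 - of_real b) * w + exp w)" if "w \<in> S" for w
    unfolding C[OF that, symmetric] G_def by (simp only: mult.assoc exp_add[symmetric]) simp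
  then show ?thesis by (intro exI[of _ C]) blast
qed

text \<open>Integrates a bound g on S', depending on the real part only, from w to the vertical line
  Re = l. With compactness of the segment on that line, it turns asymptotics of a derivative as Re w
  tends to -\<infinity> into asymptotics of the function.\<close>

lemma horizontal_bound:
  fixes S S' :: "complex \<Rightarrow> complex" and G g :: "real \<Rightarrow> real"
  assumes w: "Re w \<le> l"
    and S: "\<And>z. Re z \<le> l \<Longrightarrow> (S has_field_derivative S' z) (at z)"
    and G: "\<And>x. x \<le> l \<Longrightarrow> (G has_real_derivative g x) (at x)"
    and bd: "\<And>z. Re z \<le> l \<Longrightarrow> \<bar>Im z\<bar> \<le> 4 \<Longrightarrow> norm (S' z) \<le> g (Re z)" and im: "\<bar>Im w\<bar> \<le> 4"
  shows "norm (S w) \<le> norm (S (Complex l (Im w))) + (G l - G (Re w))"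
proof (cases "Re w = l")
  case True
  then have "Complex l (Im w) = w" by (simp add: complex_eq_iff)
  then show ?thesis using True by simp
next
  case False
  let ?p = "\<lambda>t. S (Complex t (Im w))"
  have p: "(?p has_vector_derivative S' (Complex t (Im w))) (at t)" if "t \<le> l" for t
  proof -
    have 1: "((\<lambda>t. Complex t (Im w)) has_vector_derivative 1) (at t)"
    proof -
      have "((\<lambda>t. of_real t + \<i> * of_real (Im w)) has_vector_derivative 1) (at t)"
        by (auto intro!: derivative_eq_intros has_vector_derivative_of_real)
      then show ?thesis by (simp add: Complex_eq)
    qed
    show ?thesis using field_vector_diff_chain_at[OF 1 S] that by (simp add: o_def)
  qed
  have "norm (?p l - ?p (Re w)) \<le> G l - G (Re w)"
  proof (rule differentiable_bound_general)
    show "Re w < l" using w False by simp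
    show "continuous_on {Re w..l} ?p"
      by (intro continuous_at_imp_continuous_on ballI has_vector_derivative_continuous[OF p]) auto
    show "continuous_on {Re w..l} G"
      by (intro continuous_at_imp_continuous_on ballI DERIV_isCont[OF G]) auto
    show "(?p has_vector_derivative S' (Complex t (Im w))) (at t)" if "t < l" for t using p[of t] that by simp
    show "(G has_vector_derivative g t) (at t)" if "t < l" for t
      using G[of t] that by (simp add: has_real_derivative_iff_has_vector_derivative)
    show "norm (S' (Complex t (Im w))) \<le> g t" if "t < l" for t using bd[of "Complex t (Im w)"] that im by simp
  qed
  moreover have "?p (Re w) = S w" by simp
  ultimately show ?thesis using norm_triangle_sub[of "S w" "?p l"] by (simp add: norm_minus_commute)
qed

lemma bounded_on_vertical_segment:
  fixes S :: "complex \<Rightarrow> complex"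
  assumes "\<And>t. isCont S (Complex l t)"
  shows "\<exists>B. \<forall>t. \<bar>t\<bar> \<le> 4 \<longrightarrow> norm (S (Complex l t)) \<le> B"
proof -
  have "isCont (\<lambda>t. S (Complex l t)) t" for t
  proof (rule isCont_o2[where f = "Complex l" and g = S])
    show "isCont (Complex l) t" unfolding Complex_eq by (intro continuous_intros)
  qed (rule assms)
  then have "continuous_on {-4..4} (\<lambda>t. S (Complex l t))" by (auto intro: continuous_at_imp_continuous_on)
  then have "bounded ((\<lambda>t. S (Complex l t)) ` {-4..4})" by (intro compact_imp_bounded compact_continuous_image) auto
  then obtain B where "\<forall>y\<in>(\<lambda>t. S (Complex l t)) ` {-4..4}. norm y \<le> B" unfolding bounded_iff by blast
  then show ?thesis by (intro exI[of _ B]) (auto simp: abs_le_iff)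
qed


text \<open>The exponents at z = 0 are 0 and \<kappa> = 1 - b \<ge> 0. The solution \<open>E\<close>
  = z^\<kappa> M(a+\<kappa>, 1+\<kappa>, z) belongs to the larger one and is free of logarithms even
  for integral \<kappa>. The quotient X = V/E has the explicit derivative -C e^(-\<kappa>w) H(e^w),
  with C from the Wronskian, and V'/V = E'/E + X'/X where E'/E tends to \<kappa>. If C = 0, X is
  constant; if \<kappa> = 0, X grows like -C w; if \<kappa> > 0, X is asymptotic to (C/\<kappa>)
  e^(-\<kappa>w). Accordingly X'/X tends to 0, 0 or -\<kappa>.\<close>

lemma left_limit_nonneg_exponent:
  assumes V: "log_kummer a b V V'" and nz: "V w1 \<noteq> 0" and b: "b \<le> 1"
  shows "\<exists>r. ((\<lambda>w. V' w / V w) \<longlongrightarrow> r) left_end \<and> eventually (\<lambda>w. V w \<noteq> 0) left_end"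
proof -
  define \<kappa> where "\<kappa> = 1 - b"
  have \<kappa>0: "\<kappa> \<ge> 0" using b by (simp add: \<kappa>_def)
  obtain M M' M'' where M: "\<And>z. (M has_field_derivative M' z) (at z)"
     "\<And>z. (M' has_field_derivative M'' z) (at z)"
     and Mode: "\<And>z. z * M'' z + (of_real (1 + \<kappa>) - z) * M' z - of_real (a + \<kappa>) * M z = 0"
     and M0: "M (0::complex) = (1::complex)"
    using kummer_entire_solution[of "1 + \<kappa>" "a + \<kappa>"] \<kappa>0 by auto
  define E where "E = (\<lambda>w. exp (of_real \<kappa> * w) * M (exp w))"
  define E' where "E' = (\<lambda>w. exp (of_real \<kappa> * w) * (of_real \<kappa> * M (exp w) + exp w * M' (exp w)))"
  have EE: "log_kummer a b E E'"
    unfolding log_kummer_on_def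
  proof (intro ballI conjI)
    fix w
    have dM: "((\<lambda>w. M (exp w)) has_field_derivative M' (exp w) * exp w) (at w)"
      "((\<lambda>w. M' (exp w)) has_field_derivative M'' (exp w) * exp w) (at w)"
      by (rule DERIV_chain'[OF DERIV_exp M(1), THEN DERIV_cong] DERIV_chain'[OF DERIV_exp M(2), THEN DERIV_cong], simp)+
    show "(E has_field_derivative E' w) (at w)"
      unfolding E_def E'_def
      by (rule derivative_eq_intros dM refl | simp add: algebra_simps)+
    define z where "z = exp w"
    have 1: "z * M'' z = of_real (a + \<kappa>) * M z - (of_real (1 + \<kappa>) - z) * M' z"
      using Mode[of z] by (simp only: diff_eq_eq add_0_left eq_diff_eq)
    have "(E' has_field_derivative exp (of_real \<kappa> * w) * (of_real \<kappa> * (of_real \<kappa> * M z + z * M' z)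
        + (of_real \<kappa> * M' z * z + z * M' z + z * (z * M'' z)))) (at w)"
      unfolding E'_def z_def
      by (rule derivative_eq_intros dM refl | simp add: algebra_simps)+
    also have "exp (of_real \<kappa> * w) * (of_real \<kappa> * (of_real \<kappa> * M z + z * M' z)
        + (of_real \<kappa> * M' z * z + z * M' z + z * (z * M'' z)))
        = (1 - of_real b + exp w) * E' w + of_real a * exp w * E w"
      unfolding 1 E'_def E_def z_def[symmetric] by (simp add: \<kappa>_def algebra_simps)
    finally show "(E' has_field_derivative (1 - of_real b + exp w) * E' w + of_real a * exp w * E w) (at w)" .
  qed
  \<comment> \<open>The factor left over when the Wronskian is divided by E^2. It is differentiable
    at 0 with value 1, so H(e^w) - 1 is of order e^(Re w) near the left end.\<close>
  define H where "H = (\<lambda>z. exp z / (M z)\<^sup>2)"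
  have H0: "H 0 = 1" by (simp add: H_def M0)
  have "(H has_field_derivative (exp 0 * (M 0)\<^sup>2 - exp 0 * (2 * M 0 * M' 0)) / ((M 0)\<^sup>2)\<^sup>2) (at 0)"
    unfolding H_def by (rule derivative_eq_intros M(1) refl | simp add: M0 power2_eq_square)+
  then obtain d where d: "(H has_field_derivative d) (at 0)" by blast
  have "((\<lambda>h. norm ((H (0 + h) - H 0) / h)) \<longlongrightarrow> norm d) (at 0)"
    by (rule tendsto_norm) (use d in \<open>simp add: DERIV_def\<close>)
  then have "eventually (\<lambda>h. norm ((H (0 + h) - H 0) / h) < norm d + 1) (at 0)"
    by (rule order_tendstoD) simp
  then have ev1: "eventually (\<lambda>z. z \<noteq> 0 \<longrightarrow> norm (H z - 1) \<le> (norm d + 1) * norm z) (nhds 0)"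
    unfolding eventually_at_filter
    by eventually_elim (auto simp: H0 norm_divide divide_less_eq split: if_splits)
  have "isCont M 0" using M(1) by (rule DERIV_isCont)
  then have "filterlim M (nhds (M 0)) (nhds 0)" by (simp add: tendsto_at_iff_tendsto_nhds isCont_def)
  then have ev2: "eventually (\<lambda>z. M z \<noteq> 0) (nhds 0)"
    by (rule tendsto_imp_eventually_ne) (simp add: M0)
  from eventually_conj[OF ev1 ev2] obtain \<delta> where \<delta>: "\<delta> > 0"
    and near: "\<And>z. norm z < \<delta> \<Longrightarrow> (z \<noteq> 0 \<longrightarrow> norm (H z - 1) \<le> (norm d + 1) * norm z) \<and> M z \<noteq> 0"
    unfolding eventually_nhds_metric by auto
  define K where "K = norm d + 1"
  have K0: "K \<ge> 0" by (simp add: K_def)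
  define l where "l = min 0 (ln \<delta> - 1)"
  have l0: "l \<le> 0" by (simp add: l_def)
  have ex\<delta>: "norm (exp w) < \<delta>" if "Re w \<le> l" for w :: complex
  proof -
    have "Re w < ln \<delta>" using that by (auto simp: l_def)
    then have "exp (Re w) < exp (ln \<delta>)" by (simp only: exp_less_cancel_iff)
    then show ?thesis using \<delta> by simp
  qed
  have Hb: "norm (H (exp w) - 1) \<le> K * exp (Re w)" and E0: "E w \<noteq> 0" if "Re w \<le> l" for w
    using near[OF ex\<delta>[OF that]] by (auto simp: K_def E_def)
  obtain C where C: "\<And>w. V w * E' w - V' w * E w = C * exp ((1 - of_real b) * w + exp w)"
    using log_kummer_wronskian[OF convex_UNIV V EE] by auto
  define X where "X = (\<lambda>w. V w / E w)"
  define X' where "X' = (\<lambda>w. - C * exp (- of_real \<kappa> * w) * H (exp w))"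
  have X'_eq: "X' w = (V' w * E w - V w * E' w) / (E w * E w)" if "Re w \<le> l" for w
  proof -
    define e where "e = exp (of_real \<kappa> * w)"
    have Mz: "M (exp w) \<noteq> 0" using E0[OF that] by (simp add: E_def)
    have e: "e \<noteq> 0" "exp (- of_real \<kappa> * w) = 1 / e" by (simp_all add: e_def exp_minus field_simps)
    have "V' w * E w - V w * E' w = - (C * (e * exp (exp w)))"
      using C[of w] by (simp add: \<kappa>_def e_def algebra_simps flip: exp_add)
    then show ?thesis using e(1) Mz unfolding X'_def E_def e_def[symmetric] e(2) H_def
      by (simp add: field_simps power2_eq_square)
  qed
  have dX: "(X has_field_derivative X' w) (at w)" if "Re w \<le> l" for w
    unfolding X'_eq[OF that] X_def
    by (rule DERIV_divide) (use V EE E0[OF that] in \<open>auto simp: log_kummer_on_def\<close>)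
  have ratio: "V' w / V w = E' w / E w + X' w / X w" if "Re w \<le> l" "X w \<noteq> 0" for w
    unfolding X'_eq[OF that(1)] using E0[OF that(1)] that(2) by (simp add: X_def field_simps)
  have evl: "eventually (\<lambda>w. Re w \<le> l \<and> \<bar>Im w\<bar> \<le> 4) left_end" unfolding eventually_left_end by auto
  have limM: "((\<lambda>w. M (exp w)) \<longlongrightarrow> 1) left_end" "((\<lambda>w. M' (exp w)) \<longlongrightarrow> M' 0) left_end"
    using isCont_tendsto_compose[OF DERIV_isCont[OF M(1)] tendsto_exp_left_end]
      isCont_tendsto_compose[OF DERIV_isCont[OF M(2)] tendsto_exp_left_end] by (simp_all add: M0)
  have limE: "((\<lambda>w. E' w / E w) \<longlongrightarrow> of_real \<kappa>) left_end"
  proof -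
    have "((\<lambda>w. of_real \<kappa> + exp w * M' (exp w) / M (exp w)) \<longlongrightarrow> of_real \<kappa> + 0 * M' 0 / 1) left_end"
      by (intro tendsto_intros limM tendsto_exp_left_end) auto
    moreover have "eventually (\<lambda>w. E' w / E w = of_real \<kappa> + exp w * M' (exp w) / M (exp w)) left_end"
      using evl
    proof eventually_elim
      case (elim w)
      then have "M (exp w) \<noteq> 0" using E0[of w] by (simp add: E_def)
      then show ?case by (simp add: E_def E'_def add_divide_distrib)
    qed
    ultimately show ?thesis by (simp add: tendsto_cong)
  qed
  have limH: "((\<lambda>w. H (exp w)) \<longlongrightarrow> 1) left_end"
    using isCont_tendsto_compose[OF DERIV_isCont[OF d] tendsto_exp_left_end] by (simp add: H0)
  have fin: ?thesis if evX: "eventually (\<lambda>w. X w \<noteq> 0) left_end" and limX: "((\<lambda>w. X' w / X w) \<longlongrightarrow> r) left_end" for r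
  proof -
    have "((\<lambda>w. E' w / E w + X' w / X w) \<longlongrightarrow> of_real \<kappa> + r) left_end"
      by (intro tendsto_add limE limX)
    moreover have "eventually (\<lambda>w. V' w / V w = E' w / E w + X' w / X w) left_end"
      using evl evX by eventually_elim (rule ratio, auto)
    ultimately have "((\<lambda>w. V' w / V w) \<longlongrightarrow> of_real \<kappa> + r) left_end"
      by (simp add: tendsto_cong)
    moreover have "eventually (\<lambda>w. V w \<noteq> 0) left_end"
      using evX by eventually_elim (auto simp: X_def)
    ultimately show ?thesis by blast
  qed
  have contX: "isCont X (Complex l t)" for t by (rule DERIV_isCont[OF dX]) simp
  consider "C = 0" | "C \<noteq> 0" "\<kappa> = 0" | "C \<noteq> 0" "\<kappa> > 0" using \<kappa>0 by fastforce
  then show ?thesis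
  proof cases
    case 1
    have "\<exists>c. \<forall>w\<in>{w. Re w \<le> l}. X w = c"
    proof (rule has_field_derivative_zero_constant)
      show "convex {w. Re w \<le> l}" by (rule convex_halfspace_Re_le)
      show "(X has_field_derivative 0) (at w within {w. Re w \<le> l})" if "w \<in> {w. Re w \<le> l}" for w
        using dX[of w] that 1 by (auto simp: X'_def intro: has_field_derivative_at_within)
    qed
    then obtain c where c: "\<And>w. Re w \<le> l \<Longrightarrow> X w = c" by blast
    have "c \<noteq> 0"
    proof
      assume "c = 0"
      then have v: "V (of_real l) = 0" using c[of "of_real l"] E0[of "of_real l"] by (simp add: X_def)
      then have "V' (of_real l) = 0" using C[of "of_real l"] E0[of "of_real l"] 1 by simp
      then show False using log_kummer_zero_data[OF V v] nz by simp
    qed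
    show ?thesis
    proof (rule fin[of 0])
      show "eventually (\<lambda>w. X w \<noteq> 0) left_end"
        using evl by eventually_elim (use c \<open>c \<noteq> 0\<close> in auto)
      show "((\<lambda>w. X' w / X w) \<longlongrightarrow> 0) left_end" by (simp add: X'_def 1)
    qed
  next
    case 2
    \<comment> \<open>Removes the leading growth of X; the remaining derivative -C (H(e^w) - 1) is
      integrable towards the left, so \<open>S\<close> stays bounded.\<close>
    define S where "S = (\<lambda>w. X w + C * w)"
    have "isCont S (Complex l t)" for t unfolding S_def by (intro continuous_intros contX)
    then obtain B where B: "\<And>t. \<bar>t\<bar> \<le> 4 \<Longrightarrow> norm (S (Complex l t)) \<le> B"
      using bounded_on_vertical_segment by metis
    define B' where "B' = B + norm C * K * exp l"
    have Sb: "norm (S w) \<le> B'" if w: "Re w \<le> l" "\<bar>Im w\<bar> \<le> 4" for w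
    proof -
      have "norm (S w) \<le> norm (S (Complex l (Im w))) + (norm C * K * exp l - norm C * K * exp (Re w))"
      proof (rule horizontal_bound[where S' = "\<lambda>w. X' w + C" and g = "\<lambda>x. norm C * K * exp x", OF w(1) _ _ _ w(2)])
        fix z :: complex assume z: "Re z \<le> l"
        show "(S has_field_derivative X' z + C) (at z)"
          unfolding S_def by (auto intro!: derivative_eq_intros dX z)
        have "X' z + C = - C * (H (exp z) - 1)" using 2 by (simp add: X'_def algebra_simps)
        then show "norm (X' z + C) \<le> norm C * K * exp (Re z)"
          using mult_left_mono[OF Hb[OF z] norm_ge_zero[of C]] by (simp add: norm_mult)
      qed (auto intro!: derivative_eq_intros)
      also have "\<dots> \<le> B + norm C * K * exp l" using B[OF w(2)] K0 by (intro add_mono) auto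
      finally show ?thesis by (simp add: B'_def)
    qed
    have Xlow: "norm C * (- Re w) - B' \<le> norm (X w)" if w: "Re w \<le> l" "\<bar>Im w\<bar> \<le> 4" for w
    proof -
      have "norm (C * w) \<le> norm (S w) + norm (X w)"
        using norm_triangle_ineq4[of "S w" "X w"] by (simp add: S_def)
      moreover have "norm C * (- Re w) \<le> norm (C * w)"
        using abs_Re_le_cmod[of w] unfolding norm_mult by (intro mult_left_mono) auto
      ultimately show ?thesis using Sb[OF w] by linarith
    qed
    have nC: "norm C > 0" using 2 by simp
    have top: "filterlim (\<lambda>x. norm C * (- x) - B') at_top at_bot" using nC by real_asymp
    have evpos: "eventually (\<lambda>w. norm C * (- Re w) - B' > 0) left_end"
    proof -
      have "eventually (\<lambda>x. norm C * (- x) - B' > 0) at_bot"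
        by (rule filterlim_at_top_dense[THEN iffD1, rule_format, OF top])
      then obtain l' where l': "\<forall>x\<le>l'. norm C * (- x) - B' > 0" unfolding eventually_at_bot_linorder ..
      show ?thesis unfolding eventually_left_end
        by (rule exI[of _ l'], intro allI impI, erule l'[rule_format])
    qed
    show ?thesis
    proof (rule fin[of 0])
      show "eventually (\<lambda>w. X w \<noteq> 0) left_end"
        using evl evpos
      proof eventually_elim
        case (elim w)
        then have "norm (X w) > 0" using Xlow[of w] by linarith
        then show ?case by simp
      qed
      define K1 where "K1 = norm C * (1 + K)"
      have "((\<lambda>x. K1 / (norm C * (- x) - B')) \<longlongrightarrow> 0) at_bot"
        by (rule real_tendsto_divide_at_top[OF tendsto_const top])
      then have lim: "((\<lambda>w. K1 / (norm C * (- Re w) - B')) \<longlongrightarrow> 0) left_end"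
        by (rule tendsto_of_real_function_left_end)
      show "((\<lambda>w. X' w / X w) \<longlongrightarrow> 0) left_end"
      proof (rule Lim_null_comparison[OF _ lim])
        show "eventually (\<lambda>w. norm (X' w / X w) \<le> K1 / (norm C * (- Re w) - B')) left_end"
          using evl evpos
        proof eventually_elim
          case (elim w)
          have "norm (H (exp w)) \<le> 1 + norm (H (exp w) - 1)" using norm_triangle_sub[of "H (exp w)" 1] by simp
          also have "norm (H (exp w) - 1) \<le> K * exp (Re w)" using Hb elim by blast
          also have "K * exp (Re w) \<le> K * 1" using elim l0 K0 by (intro mult_left_mono) auto
          finally have "norm (H (exp w)) \<le> 1 + K" by simp
          then have "norm (X' w) \<le> K1" using 2 unfolding X'_def K1_def by (simp add: norm_mult mult_left_mono)
          then show ?case unfolding norm_divide using Xlow[of w] elim by (intro frac_le) (auto intro: order_trans[OF norm_ge_zero])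
        qed
      qed
    qed
  next
    case 3
    \<comment> \<open>The remainder has derivative of order e^((1-\<kappa>)x), whose primitive
      changes form at \<kappa> = 1. For x \<le> 0 it is dominated by e^((\<delta>0-\<kappa>)x) with
      \<delta>0 \<le> 1, and \<delta>0 < \<kappa> keeps that exponent nonzero in all cases.\<close>
    define \<delta>0 where "\<delta>0 = min 1 (\<kappa> / 2)"
    have \<delta>0: "0 < \<delta>0" "\<delta>0 \<le> 1" "\<delta>0 < \<kappa>" using 3 by (auto simp: \<delta>0_def)
    define S where "S = (\<lambda>w. X w - C / of_real \<kappa> * exp (- of_real \<kappa> * w))"
    have "isCont S (Complex l t)" for t unfolding S_def by (intro continuous_intros contX)
    then obtain B where B: "\<And>t. \<bar>t\<bar> \<le> 4 \<Longrightarrow> norm (S (Complex l t)) \<le> B"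
      using bounded_on_vertical_segment by metis
    define K2 where "K2 = norm C * K / (\<kappa> - \<delta>0)"
    have K2: "K2 \<ge> 0" using K0 \<delta>0 by (simp add: K2_def)
    define G where "G = (\<lambda>x. - K2 * exp ((\<delta>0 - \<kappa>) * x))"
    have Sb: "norm (S w) \<le> B + K2 * exp ((\<delta>0 - \<kappa>) * Re w)" if w: "Re w \<le> l" "\<bar>Im w\<bar> \<le> 4" for w
    proof -
      have "norm (S w) \<le> norm (S (Complex l (Im w))) + (G l - G (Re w))"
      proof (rule horizontal_bound[where S' = "\<lambda>w. X' w + C * exp (- of_real \<kappa> * w)"
              and g = "\<lambda>x. norm C * K * exp ((\<delta>0 - \<kappa>) * x)", OF w(1) _ _ _ w(2)])
        fix z :: complex assume z: "Re z \<le> l"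
        show "(S has_field_derivative X' z + C * exp (- of_real \<kappa> * z)) (at z)"
          unfolding S_def using 3 by (auto intro!: derivative_eq_intros dX z)
        have "X' z + C * exp (- of_real \<kappa> * z) = - C * exp (- of_real \<kappa> * z) * (H (exp z) - 1)"
          by (simp add: X'_def algebra_simps)
        then have "norm (X' z + C * exp (- of_real \<kappa> * z)) = norm C * exp (- \<kappa> * Re z) * norm (H (exp z) - 1)"
          by (simp add: norm_mult)
        also have "\<dots> \<le> norm C * exp (- \<kappa> * Re z) * (K * exp (Re z))"
          by (intro mult_left_mono Hb z) auto
        also have "\<dots> = norm C * K * exp ((1 - \<kappa>) * Re z)" by (simp add: algebra_simps flip: exp_add)
        also have "\<dots> \<le> norm C * K * exp ((\<delta>0 - \<kappa>) * Re z)"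
        proof -
          have "(1 - \<delta>0) * Re z \<le> 0" using z l0 \<delta>0 by (intro mult_nonneg_nonpos) auto
          then have "(1 - \<kappa>) * Re z \<le> (\<delta>0 - \<kappa>) * Re z" by (simp add: algebra_simps)
          then show ?thesis using K0 by (intro mult_left_mono) auto
        qed
        finally show "norm (X' z + C * exp (- of_real \<kappa> * z)) \<le> norm C * K * exp ((\<delta>0 - \<kappa>) * Re z)" .
      next
        fix x :: real
        have "(\<delta>0 - \<kappa>) * K2 = - (norm C * K)" using \<delta>0 by (simp add: K2_def field_simps)
        then have eq: "e * (\<delta>0 - \<kappa>) * K2 = - (norm C * K * e)" for e by (simp only: mult.assoc) simp
        have "(G has_real_derivative - (exp ((\<delta>0 - \<kappa>) * x) * (\<delta>0 - \<kappa>) * K2)) (at x)"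
          unfolding G_def by (auto intro!: derivative_eq_intros)
        then show "(G has_real_derivative norm C * K * exp ((\<delta>0 - \<kappa>) * x)) (at x)"
          unfolding eq by simp
      qed
      moreover have "G l \<le> 0" unfolding G_def using K2 by (intro mult_nonpos_nonneg) auto
      ultimately show ?thesis using B[OF w(2)] by (simp add: G_def)
    qed
    have limXe: "((\<lambda>w. X w * exp (of_real \<kappa> * w)) \<longlongrightarrow> C / of_real \<kappa>) left_end"
    proof (rule Lim_transform[OF tendsto_const])
      have lim: "((\<lambda>w. B * exp (\<kappa> * Re w) + K2 * exp (\<delta>0 * Re w)) \<longlongrightarrow> 0) left_end"
      proof (rule tendsto_of_real_function_left_end)
        have "((\<lambda>x. exp (\<kappa> * x)) \<longlongrightarrow> 0) at_bot" "((\<lambda>x. exp (\<delta>0 * x)) \<longlongrightarrow> 0) at_bot"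
          using 3(2) \<delta>0(1) by real_asymp+
        then show "((\<lambda>x. B * exp (\<kappa> * x) + K2 * exp (\<delta>0 * x)) \<longlongrightarrow> 0) at_bot"
          by (intro tendsto_add_zero tendsto_mult_right_zero)
      qed
      have "((\<lambda>w. X w * exp (of_real \<kappa> * w) - C / of_real \<kappa>) \<longlongrightarrow> 0) left_end"
      proof (rule Lim_null_comparison[OF _ lim])
        show "eventually (\<lambda>w. norm (X w * exp (of_real \<kappa> * w) - C / of_real \<kappa>) \<le> B * exp (\<kappa> * Re w) + K2 * exp (\<delta>0 * Re w)) left_end"
          using evl
        proof eventually_elim
          case (elim w)
          have "exp (- of_real \<kappa> * w) * exp (of_real \<kappa> * w) = 1" by (simp flip: exp_add)
          then have "X w * exp (of_real \<kappa> * w) - C / of_real \<kappa> = S w * exp (of_real \<kappa> * w)"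
            unfolding S_def left_diff_distrib by (simp only: mult.assoc mult_1_right)
          then have "norm (X w * exp (of_real \<kappa> * w) - C / of_real \<kappa>) = norm (S w) * exp (\<kappa> * Re w)"
            by (simp add: norm_mult)
          also have "\<dots> \<le> (B + K2 * exp ((\<delta>0 - \<kappa>) * Re w)) * exp (\<kappa> * Re w)"
            using elim by (intro mult_right_mono Sb) auto
          also have "\<dots> = B * exp (\<kappa> * Re w) + K2 * exp (\<delta>0 * Re w)"
            by (simp add: algebra_simps flip: exp_add)
          finally show ?case .
        qed
      qed
      then show "((\<lambda>w. X w * exp (of_real \<kappa> * w) - C / of_real \<kappa>) \<longlongrightarrow> 0) left_end" .
    qed
    have ne: "C / of_real \<kappa> \<noteq> 0" using 3 by simp
    have limX'e: "((\<lambda>w. X' w * exp (of_real \<kappa> * w)) \<longlongrightarrow> - C * 1) left_end"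
    proof -
      have "X' w * exp (of_real \<kappa> * w) = - C * H (exp w)" for w
      proof -
        have "exp (- of_real \<kappa> * w) * exp (of_real \<kappa> * w) = 1" by (simp flip: exp_add)
        moreover have "X' w * exp (of_real \<kappa> * w) = - C * H (exp w) * (exp (- of_real \<kappa> * w) * exp (of_real \<kappa> * w))"
          unfolding X'_def by (simp only: mult_ac)
        ultimately show ?thesis by (simp only: mult_1_right)
      qed
      then show ?thesis by (simp only:) (intro tendsto_intros limH)
    qed
    have evX: "eventually (\<lambda>w. X w \<noteq> 0) left_end"
      using tendsto_imp_eventually_ne[OF limXe ne] by eventually_elim auto
    show ?thesis
    proof (rule fin[OF evX])
      have "((\<lambda>w. (X' w * exp (of_real \<kappa> * w)) / (X w * exp (of_real \<kappa> * w))) \<longlongrightarrow> (- C * 1) / (C / of_real \<kappa>)) left_end"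
        by (intro tendsto_divide limX'e limXe ne)
      then show "((\<lambda>w. X' w / X w) \<longlongrightarrow> (- C * 1) / (C / of_real \<kappa>)) left_end" by simp
    qed
  qed
qed

text \<open>For b > 1 Kummer's transformation applies: z^(b-1) times a solution solves the equation
  with parameters a-b+1 and 2-b. It shifts the logarithmic derivative by the constant b-1.\<close>

lemma log_kummer_left_limit:
  assumes V: "log_kummer a b V V'" and nz: "V w1 \<noteq> 0"
  shows "\<exists>r. ((\<lambda>w. V' w / V w) \<longlongrightarrow> r) left_end \<and> eventually (\<lambda>w. V w \<noteq> 0) left_end"
proof (cases "b \<le> 1")
  case True
  then show ?thesis using left_limit_nonneg_exponent[OF V nz] by blast
next
  case False
  define \<mu> where "\<mu> = b - 1"
  define W where "W = (\<lambda>w. V w * exp (of_real \<mu> * w))"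
  define W' where "W' = (\<lambda>w. (V' w + of_real \<mu> * V w) * exp (of_real \<mu> * w))"
  have "log_kummer (a - \<mu>) (1 - \<mu>) W W'"
    unfolding log_kummer_on_def
  proof (intro ballI conjI)
    fix w
    have d: "(V has_field_derivative V' w) (at w)"
      "(V' has_field_derivative (1 - of_real b + exp w) * V' w + of_real a * exp w * V w) (at w)"
      using V unfolding log_kummer_on_def by auto
    show "(W has_field_derivative W' w) (at w)"
      unfolding W_def W'_def by (rule derivative_eq_intros d refl | simp add: algebra_simps)+
    show "(W' has_field_derivative (1 - of_real (1 - \<mu>) + exp w) * W' w + of_real (a - \<mu>) * exp w * W w) (at w)"
      unfolding W_def W'_def by (rule derivative_eq_intros d refl | simp add: \<mu>_def algebra_simps)+
  qed
  moreover have "W w1 \<noteq> 0" using nz by (simp add: W_def)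
  moreover have "1 - \<mu> \<le> 1" using False by (simp add: \<mu>_def)
  ultimately obtain r where r: "((\<lambda>w. W' w / W w) \<longlongrightarrow> r) left_end" and ev: "eventually (\<lambda>w. W w \<noteq> 0) left_end"
    using left_limit_nonneg_exponent by metis
  have lim: "((\<lambda>w. W' w / W w - of_real \<mu>) \<longlongrightarrow> r - of_real \<mu>) left_end" by (intro tendsto_intros r)
  have ev': "eventually (\<lambda>w. V w \<noteq> 0) left_end" using ev by eventually_elim (simp add: W_def)
  then have "eventually (\<lambda>w. W' w / W w - of_real \<mu> = V' w / V w) left_end"
    by eventually_elim (simp add: W_def W'_def add_divide_distrib)
  from Lim_transform_eventually[OF lim this] ev' show ?thesis
    by (intro exI[of _ "r - of_real \<mu>"] conjI)
qed

section \<open>Tricomi's function\<close>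

text \<open>Provides the margin between the lines Im w = \<plusminus>pi and the edge of the strip of
  half-width 10/3 on which the expansion is available.\<close>

lemma pi_less_ten_thirds: "pi < 10/3"
proof -
  note pi_approx(2)
  also have "31415926535899 / 10 ^ 13 < (10/3 :: real)" by simp
  finally show ?thesis .
qed

lemma exp_in_slit_plane:
  assumes "\<bar>Im w\<bar> < pi"
  shows "exp w \<in> slit_plane"
proof
  assume "exp w \<in> \<real>\<^sub>\<le>\<^sub>0"
  then have 1: "exp (Re w) * cos (Im w) \<le> 0" "exp (Re w) * sin (Im w) = 0"
    by (auto simp: complex_nonpos_Reals_iff Re_exp Im_exp)
  then have "sin (Im w) = 0" by simp
  then have "Im w = 0" using assms by (subst (asm) sin_zero_pi_iff) auto
  then show False using 1 by simp
qed

lemma abs_Im_Ln_less_pi: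
  assumes "z \<in> slit_plane"
  shows "\<bar>Im (Ln z)\<bar> < pi" "z \<noteq> 0"
proof -
  show "z \<noteq> 0" using assms by auto
  then show "\<bar>Im (Ln z)\<bar> < pi" using mpi_less_Im_Ln[of z] Im_Ln_less_pi[of z] assms by auto
qed

lemma open_slit_plane: "open slit_plane"
  using closed_nonpos_Reals_complex by (rule open_Compl)

lemma open_strip: "open {w. \<bar>Im w\<bar> < c}"
  and convex_strip: "convex {w. \<bar>Im w\<bar> < c}"
proof -
  have eq: "{w. \<bar>Im w\<bar> < c} = {w. Im w < c} \<inter> {w. Im w > - c}" by auto
  show "open {w. \<bar>Im w\<bar> < c}" unfolding eq by (intro open_Int open_halfspace_Im_lt open_halfspace_Im_gt)
  show "convex {w. \<bar>Im w\<bar> < c}" unfolding eq by (intro convex_Int convex_halfspace_Im_lt convex_halfspace_Im_gt)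
qed

text \<open>Two solutions asymptotic to \<open>e\<^bsup>-aw\<^esup>\<close> on the positive axis agree: otherwise their Wronskian
  \<open>C e\<^bsup>(1-b)w\<^esup> exp (e\<^sup>w)\<close> would force the quotient of their difference by one of them to blow up.\<close>

lemma recessive_unique:
  assumes V: "log_kummer_on {w. \<bar>Im w\<bar> < pi} a b V V'" and v: "log_kummer_on {w. \<bar>Im w\<bar> < pi} a b v v'"
    and limV: "((\<lambda>x. V (of_real x) * exp (of_real a * of_real x)) \<longlongrightarrow> 1) at_top"
    and limv: "((\<lambda>x. v (of_real x) * exp (of_real a * of_real x)) \<longlongrightarrow> 1) at_top"
    and w: "\<bar>Im w\<bar> < pi"
  shows "v w = V w"
proof -
  define S where "S = {w. \<bar>Im w\<bar> < pi}"
  have rS: "of_real x \<in> S" for x by (simp add: S_def)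
  define d where "d = (\<lambda>w. 1 * v w + (-1) * V w)"
  define d' where "d' = (\<lambda>w. 1 * v' w + (-1) * V' w)"
  have dd: "log_kummer_on S a b d d'" unfolding d_def d'_def S_def by (rule log_kummer_on_lincomb[OF v V])
  obtain C where C: "\<And>w. w \<in> S \<Longrightarrow> V w * d' w - V' w * d w = C * exp ((1 - of_real b) * w + exp w)"
    using log_kummer_wronskian[OF _ V[folded S_def] dd] convex_strip[of pi] unfolding S_def by metis
  \<comment> \<open>Replacing V by Y in 1/V^2 contributes e^(2ax), which joins the factor e^((1-b)x)
    of the Wronskian.\<close>
  define \<kappa> where "\<kappa> = 1 - b + 2 * a"
  define Y where "Y x = V (of_real x) * exp (of_real a * of_real x)" for x :: real
  define y where "y x = d (of_real x) * exp (of_real a * of_real x)" for x :: real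
  have limY: "(Y \<longlongrightarrow> 1) at_top" using limV unfolding Y_def[abs_def] .
  have limy: "(y \<longlongrightarrow> 0) at_top"
    using tendsto_diff[OF limv limV] by (simp add: y_def[abs_def] d_def left_diff_distrib)
  define X where "X x = d (of_real x) / V (of_real x)" for x :: real
  have XY: "X x = y x / Y x" for x by (simp add: X_def y_def Y_def)
  have limX: "(X \<longlongrightarrow> 0) at_top"
    unfolding XY[abs_def] using tendsto_divide[OF limy limY] by simp
  have "((\<lambda>x. Re (1 / (Y x)\<^sup>2)) \<longlongrightarrow> Re (1 / 1\<^sup>2)) at_top"
    by (intro tendsto_intros limY) auto
  then have "eventually (\<lambda>x. Re (1 / (Y x)\<^sup>2) > 1/2) at_top" by (rule order_tendstoD) simp
  moreover have "eventually (\<lambda>x. Y x \<noteq> 0) at_top" using limY by (rule tendsto_imp_eventually_ne) simp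
  moreover have "eventually (\<lambda>x. exp (\<kappa> * x + exp x) > 2) at_top"
  proof -
    have "filterlim (\<lambda>x. exp (\<kappa> * x + exp x)) at_top at_top" by real_asymp
    then show ?thesis by (rule filterlim_at_top_dense[THEN iffD1, rule_format])
  qed
  ultimately have "eventually (\<lambda>x. Re (1 / (Y x)\<^sup>2) > 1/2 \<and> Y x \<noteq> 0 \<and> exp (\<kappa> * x + exp x) > 2) at_top"
    by eventually_elim auto
  then obtain L where L: "\<forall>x\<ge>L. Re (1 / (Y x)\<^sup>2) > 1/2 \<and> Y x \<noteq> 0 \<and> exp (\<kappa> * x + exp x) > 2"
    unfolding eventually_at_top_linorder ..
  define q where "q x = exp (\<kappa> * x + exp x)" for x :: real
  have dX: "(X has_vector_derivative C * of_real (q x) / (Y x)\<^sup>2) (at x)" if x: "x \<ge> L" for x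
  proof -
    have V0: "V (of_real x) \<noteq> 0" using L[rule_format, OF x] by (auto simp: Y_def)
    have "((\<lambda>w. d w / V w) has_field_derivative
        (d' (of_real x) * V (of_real x) - d (of_real x) * V' (of_real x)) / (V (of_real x) * V (of_real x))) (at (of_real x))"
      by (rule DERIV_divide) (use V dd rS[of x] V0 in \<open>auto simp: log_kummer_on_def S_def\<close>)
    also have "d' (of_real x) * V (of_real x) - d (of_real x) * V' (of_real x)
        = C * exp ((1 - of_real b) * of_real x + exp (of_real x))"
      using C[OF rS[of x]] by (simp add: mult.commute)
    also have "C * exp ((1 - of_real b) * of_real x + exp (of_real x)) / (V (of_real x) * V (of_real x))
        = C * of_real (q x) / (Y x)\<^sup>2"
    proof -
      define e where "e = exp (of_real a * complex_of_real x)"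
      have e0: "e \<noteq> 0" by (simp add: e_def)
      have "complex_of_real (q x) = exp (of_real (\<kappa> * x + exp x))" unfolding q_def by (rule exp_of_real[symmetric])
      also have "of_real (\<kappa> * x + exp x) = ((1 - of_real b) * of_real x + exp (of_real x)) + (of_real a * complex_of_real x + of_real a * complex_of_real x)"
        by (simp add: \<kappa>_def algebra_simps exp_of_real)
      finally have "complex_of_real (q x) = exp ((1 - of_real b) * of_real x + exp (of_real x)) * (e * e)"
        by (simp only: exp_add e_def)
      then show ?thesis using e0 V0 by (simp add: Y_def e_def[symmetric] power2_eq_square)
    qed
    finally show ?thesis unfolding X_def[abs_def] by (rule has_vector_derivative_real_field)
  qed
  have C0: "C = 0"
  proof (rule ccontr)
    assume C0: "C \<noteq> 0"
    \<comment> \<open>Division by C turns the derivative of X into q/Y^2, whose real part is at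
      least 1 far out since q > 2 and Re(1/Y^2) > 1/2.\<close>
    define R where "R x = Re (X x / C)" for x
    have dR: "(R has_real_derivative q x * Re (1 / (Y x)\<^sup>2)) (at x)" if x: "x \<ge> L" for x
    proof -
      have "((\<lambda>x. X x / C) has_vector_derivative (C * of_real (q x) / (Y x)\<^sup>2) / C) (at x)"
        using bounded_linear.has_vector_derivative[OF bounded_linear_divide dX[OF x]] .
      then have "(R has_vector_derivative Re ((C * of_real (q x) / (Y x)\<^sup>2) / C)) (at x)"
        unfolding R_def[abs_def] by (rule bounded_linear.has_vector_derivative[OF bounded_linear_Re])
      moreover have "(C * of_real (q x) / (Y x)\<^sup>2) / C = of_real (q x) * (1 / (Y x)\<^sup>2)" using C0 by simp
      moreover have "Re (of_real (q x) * (1 / (Y x)\<^sup>2)) = q x * Re (1 / (Y x)\<^sup>2)"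
        by (simp only: times_complex.sel Re_complex_of_real Im_complex_of_real mult_zero_left diff_zero)
      ultimately show ?thesis
        by (simp only: has_real_derivative_iff_has_vector_derivative)
    qed
    have ge1: "q x * Re (1 / (Y x)\<^sup>2) \<ge> 1" if "x \<ge> L" for x
    proof -
      have "2 * (1/2) \<le> q x * Re (1 / (Y x)\<^sup>2)"
        using L[rule_format, OF that] by (intro mult_mono) (auto simp: q_def)
      then show ?thesis by simp
    qed
    \<comment> \<open>Any increment of at least 2 contradicts |R| < 1 at both ends, which holds
      eventually because X tends to 0.\<close>
    have incr: "R x + 3 \<le> R (x + 3)" if x: "x \<ge> L" for x
    proof -
      have "R x - x \<le> R (x + 3) - (x + 3)"
      proof (rule DERIV_nonneg_imp_nondecreasing[of x "x + 3" "\<lambda>x. R x - x"])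
        fix t assume t: "x \<le> t" "t \<le> x + 3"
        have "((\<lambda>x. R x - x) has_real_derivative q t * Re (1 / (Y t)\<^sup>2) - 1) (at t)"
          using dR[of t] t x by (auto intro!: derivative_eq_intros)
        then show "\<exists>y. ((\<lambda>x. R x - x) has_real_derivative y) (at t) \<and> 0 \<le> y"
          using ge1[of t] t x by (intro exI conjI) auto
      qed simp
      then show ?thesis by simp
    qed
    have "((\<lambda>x. Re (X x / C)) \<longlongrightarrow> Re (0 / C)) at_top" by (intro tendsto_intros limX C0)
    then have limR: "(R \<longlongrightarrow> 0) at_top" by (simp add: R_def[abs_def])
    then have "eventually (\<lambda>x. \<bar>R x\<bar> < 1) at_top"
      using order_tendstoD(2)[OF tendsto_rabs_zero[OF limR], of 1] by simp
    then obtain N where N: "\<forall>x\<ge>N. \<bar>R x\<bar> < 1" unfolding eventually_at_top_linorder ..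
    define x where "x = max L N"
    have "\<bar>R x\<bar> < 1" "\<bar>R (x + 3)\<bar> < 1" "R x + 3 \<le> R (x + 3)"
      using N incr[of x] by (auto simp: x_def)
    then show False by linarith
  qed
  have "\<exists>c. \<forall>x\<in>{L..}. X x = c"
    by (rule has_vector_derivative_zero_constant[of "{L..}" X])
       (use dX C0 in \<open>auto intro: has_vector_derivative_at_within\<close>)
  then obtain c where c: "\<And>x. x \<ge> L \<Longrightarrow> X x = c" by auto
  have "((\<lambda>x. c) \<longlongrightarrow> 0) (at_top :: real filter)"
    by (rule Lim_transform_eventually[OF limX]) (rule eventually_mono[OF eventually_ge_at_top[of L]], rule c)
  then have "c = 0" using tendsto_const_iff[of "at_top :: real filter"] by auto
  then have d0: "d (of_real x) = 0" if "x \<ge> L" for x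
    using c[OF that] L[rule_format, OF that] by (auto simp: X_def Y_def)
  \<comment> \<open>The difference vanishes on a real ray, hence on the whole strip by the identity
    theorem.\<close>
  have "d w = 0"
  proof (rule analytic_continuation[where S = S and U = "of_real ` {L..}" and \<xi> = "of_real (L + 1)" and f = d])
    show "d holomorphic_on S"
      using dd unfolding log_kummer_on_def
      by (intro holomorphic_onI) (auto simp: field_differentiable_def intro: has_field_derivative_at_within)
    show "open S" "connected S"
      unfolding S_def by (auto intro: open_strip convex_strip convex_connected)
    show "complex_of_real (L + 1) islimpt of_real ` {L..}"
      unfolding islimpt_approachable
    proof (intro allI impI)
      fix e :: real assume "e > 0"
      then show "\<exists>x'\<in>complex_of_real ` {L..}. x' \<noteq> of_real (L + 1) \<and> dist x' (of_real (L + 1)) < e"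
        by (intro bexI[of _ "of_real (L + 1 + e/2)"]) (auto simp: dist_norm simp flip: of_real_add of_real_diff)
    qed
  qed (use w d0 rS in \<open>auto simp: S_def\<close>)
  then show ?thesis by (simp add: d_def)
qed

lemma log_kummer_on_subset: "log_kummer_on S a b V V' \<Longrightarrow> T \<subseteq> S \<Longrightarrow> log_kummer_on T a b V V'"
  unfolding log_kummer_on_def by blast

text \<open>Shows that the definite description denotes the function built here. The recessive
  solution composed with Ln has the required asymptotics; conversely, composing any candidate with
  exp gives a solution on |Im w| < pi with the same limit on the positive axis. The estimates on the
  wider strip stay attached to V because \<open>tricomi_U\<close> alone does not see beyond the cut.
  The symmetry under conjugation holds since the conjugate solution is recessive with the same
  normalisation.\<close>

lemma tricomi_representation:
  "\<exists>V V' C L. log_kummer a b V V' \<and>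
     (\<forall>w. Re w \<ge> L \<longrightarrow> \<bar>Im w\<bar> \<le> 7/2 \<longrightarrow>
        norm (V w * exp (of_real a * w) - 1) \<le> C * exp (- Re w) \<and>
        norm ((V' w + of_real a * V w) * exp (of_real a * w)) \<le> C * exp (- Re w)) \<and>
     (\<forall>w. V (cnj w) = cnj (V w)) \<and>
     tricomi_U a b = (\<lambda>z. if z \<in> slit_plane then V (Ln z) else 0)"
proof -
  obtain V V' C L where V: "log_kummer a b V V'" and asym: "\<forall>w. Re w \<ge> L \<longrightarrow> \<bar>Im w\<bar> \<le> 7/2 \<longrightarrow>
        norm (V w * exp (of_real a * w) - 1) \<le> C * exp (- Re w) \<and>
        norm ((V' w + of_real a * V w) * exp (of_real a * w)) \<le> C * exp (- Re w)"
    using recessive_solution[of a b] by metis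
  have d: "(V has_field_derivative V' w) (at w)"
    "(V' has_field_derivative (1 - of_real b + exp w) * V' w + of_real a * exp w * V w) (at w)" for w
    using V unfolding log_kummer_on_def by auto
  have VS: "log_kummer_on {w. \<bar>Im w\<bar> < pi} a b V V'" by (rule log_kummer_on_subset[OF V]) simp
  have limV: "((\<lambda>x. V (of_real x) * exp (of_real a * of_real x)) \<longlongrightarrow> 1) at_top"
  proof (rule Lim_transform[OF tendsto_const])
    have lim: "((\<lambda>x. C * exp (- x)) \<longlongrightarrow> 0) at_top" by real_asymp
    show "((\<lambda>x. V (of_real x) * exp (of_real a * of_real x) - 1) \<longlongrightarrow> 0) at_top"
      by (rule Lim_null_comparison[OF _ lim])
         (use eventually_ge_at_top[of L] in eventually_elim, use asym[rule_format, of "of_real _"] in simp)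
  qed
  define U where "U = (\<lambda>z. if z \<in> slit_plane then V (Ln z) else 0)"
  define U1 where "U1 = (\<lambda>z. V' (Ln z) / z)"
  have dLn: "(Ln has_field_derivative inverse z) (at z)" if "z \<in> slit_plane" for z
    using that by (intro has_field_derivative_Ln) auto
  have dU: "(U has_field_derivative U1 z) (at z)" if z: "z \<in> slit_plane" for z
  proof (rule has_field_derivative_transform_within_open[OF _ open_slit_plane z])
    show "((\<lambda>z. V (Ln z)) has_field_derivative U1 z) (at z)"
      using DERIV_chain'[OF dLn[OF z] d(1)] by (simp add: U1_def divide_inverse)
  qed (simp add: U_def)
  define U2 where "U2 = (\<lambda>z. ((1 - of_real b + z) * V' (Ln z) + of_real a * z * V (Ln z) - V' (Ln z)) / z\<^sup>2)"
  have dU1: "(U1 has_field_derivative U2 z) (at z)" if z: "z \<in> slit_plane" for z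
  proof -
    have z0: "z \<noteq> 0" by (rule abs_Im_Ln_less_pi[OF z])
    have "((\<lambda>z. V' (Ln z)) has_field_derivative
       ((1 - of_real b + exp (Ln z)) * V' (Ln z) + of_real a * exp (Ln z) * V (Ln z)) * inverse z) (at z)"
      using DERIV_chain'[OF dLn[OF z] d(2)] by simp
    from DERIV_divide[OF this DERIV_ident z0] show ?thesis
      unfolding U1_def U2_def by (rule DERIV_cong) (use z0 in \<open>simp add: power2_eq_square mult.assoc\<close>)
  qed
  have deriv1: "deriv U z = U1 z" if "z \<in> slit_plane" for z by (rule DERIV_imp_deriv[OF dU[OF that]])
  have deriv2: "deriv (deriv U) z = U2 z" if z: "z \<in> slit_plane" for z
    by (rule DERIV_imp_deriv, rule has_field_derivative_transform_within_open[OF dU1[OF z] open_slit_plane z])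
       (simp add: deriv1)
  have is_U: "is_tricomi_U a b U"
    unfolding is_tricomi_U_def
  proof (intro conjI ballI)
    show "U holomorphic_on slit_plane"
      using dU open_slit_plane by (meson field_differentiable_def holomorphic_onI has_field_derivative_at_within)
    show "U z = 0" if "z \<in> \<real>\<^sub>\<le>\<^sub>0" for z using that by (simp add: U_def)
    fix z assume z: "z \<in> slit_plane"
    have z0: "z \<noteq> 0" by (rule abs_Im_Ln_less_pi[OF z])
    have "z * U2 z = ((1 - of_real b + z) * V' (Ln z) + of_real a * z * V (Ln z) - V' (Ln z)) / z"
      using z0 by (simp add: U2_def power2_eq_square)
    moreover have "of_real a * U z = (of_real a * z * V (Ln z)) / z" using z z0 by (simp add: U_def)
    moreover have "(of_real b - z) * U1 z = ((of_real b - z) * V' (Ln z)) / z" by (simp add: U1_def)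
    ultimately have "z * U2 z + (of_real b - z) * U1 z - of_real a * U z =
       (((1 - of_real b + z) * V' (Ln z) + of_real a * z * V (Ln z) - V' (Ln z)) + (of_real b - z) * V' (Ln z) - of_real a * z * V (Ln z)) / z"
      by (simp only: add_divide_distrib diff_divide_distrib)
    also have "\<dots> = 0" by (simp add: algebra_simps)
    finally show "z * deriv (deriv U) z + (of_real b - z) * deriv U z - of_real a * U z = 0"
      by (simp only: deriv1[OF z] deriv2[OF z])
  next
    show "((\<lambda>z. U z * z powr of_real a) \<longlongrightarrow> 1) (inf at_infinity (principal slit_plane))"
    proof (rule Lim_transform[OF tendsto_const])
      have "((\<lambda>z::complex. C * norm (inverse z)) \<longlongrightarrow> 0) at_infinity"
        by (intro tendsto_mult_right_zero tendsto_norm_zero tendsto_inverse_0)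
      then have lim: "((\<lambda>z::complex. C * norm (inverse z)) \<longlongrightarrow> 0) (inf at_infinity (principal slit_plane))"
        by (rule tendsto_mono[OF inf_le1])
      show "((\<lambda>z. U z * z powr of_real a - 1) \<longlongrightarrow> 0) (inf at_infinity (principal slit_plane))"
      proof (rule Lim_null_comparison[OF _ lim])
        have "eventually (\<lambda>z::complex. norm z \<ge> exp L) at_infinity"
          unfolding eventually_at_infinity by blast
        then show "eventually (\<lambda>z. norm (U z * z powr of_real a - 1) \<le> C * norm (inverse z)) (inf at_infinity (principal slit_plane))"
          unfolding eventually_inf_principal
        proof eventually_elim
          case (elim z)
          show ?case
          proof
            assume z: "z \<in> slit_plane"
            have z0: "z \<noteq> 0" and im: "\<bar>Im (Ln z)\<bar> < pi" by (rule abs_Im_Ln_less_pi[OF z])+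
            have "ln (exp L) \<le> ln (norm z)" using elim z0 by (subst ln_le_cancel_iff) auto
            then have "Re (Ln z) \<ge> L" using z0 by simp
            moreover have "\<bar>Im (Ln z)\<bar> \<le> 7/2" using im pi_less_ten_thirds by linarith
            ultimately have "norm (V (Ln z) * exp (of_real a * Ln z) - 1) \<le> C * exp (- Re (Ln z))"
              using asym by blast
            moreover have "exp (- Re (Ln z)) = norm (inverse z)"
              using z0 by (simp add: exp_minus norm_inverse)
            moreover have "U z * z powr of_real a = V (Ln z) * exp (of_real a * Ln z)"
              using z z0 by (simp add: U_def powr_def)
            ultimately show "norm (U z * z powr of_real a - 1) \<le> C * norm (inverse z)" by simp
          qed
        qed
      qed
    qed
  qed
  have unique: "u = U" if u: "is_tricomi_U a b u" for u
  proof
    fix z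
    show "u z = U z"
    proof (cases "z \<in> slit_plane")
      case False
      then show ?thesis using u by (auto simp: is_tricomi_U_def U_def)
    next
      case z: True
      define v where "v = (\<lambda>w. u (exp w))"
      define v' where "v' = (\<lambda>w. deriv u (exp w) * exp w)"
      have hol: "u holomorphic_on slit_plane" "deriv u holomorphic_on slit_plane"
        using u by (auto simp: is_tricomi_U_def intro: holomorphic_deriv open_slit_plane)
      have v: "log_kummer_on {w. \<bar>Im w\<bar> < pi} a b v v'"
        unfolding log_kummer_on_def
      proof (intro ballI conjI)
        fix w :: complex assume "w \<in> {w. \<bar>Im w\<bar> < pi}"
        then have e: "exp w \<in> slit_plane" using exp_in_slit_plane by simp
        have du: "(u has_field_derivative deriv u (exp w)) (at (exp w))"
          "(deriv u has_field_derivative deriv (deriv u) (exp w)) (at (exp w))"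
          using holomorphic_derivI[OF hol(1) open_slit_plane e] holomorphic_derivI[OF hol(2) open_slit_plane e] by auto
        show "(v has_field_derivative v' w) (at w)"
          unfolding v_def v'_def by (rule DERIV_chain'[OF DERIV_exp du(1), THEN DERIV_cong]) simp
        have "((\<lambda>w. deriv u (exp w)) has_field_derivative deriv (deriv u) (exp w) * exp w) (at w)"
          by (rule DERIV_chain'[OF DERIV_exp du(2), THEN DERIV_cong]) simp
        from DERIV_mult[OF this DERIV_exp]
        have "(v' has_field_derivative (exp w * deriv (deriv u) (exp w)) * exp w + deriv u (exp w) * exp w) (at w)"
          unfolding v'_def by (simp add: algebra_simps)
        moreover have "exp w * deriv (deriv u) (exp w) = of_real a * u (exp w) - (of_real b - exp w) * deriv u (exp w)"
        proof -
          have "exp w * deriv (deriv u) (exp w) + (of_real b - exp w) * deriv u (exp w) - of_real a * u (exp w) = 0"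
            using u e unfolding is_tricomi_U_def by blast
          then show ?thesis by (simp only: diff_eq_eq add_0_left eq_diff_eq)
        qed
        ultimately have "(v' has_field_derivative (of_real a * u (exp w) - (of_real b - exp w) * deriv u (exp w)) * exp w + deriv u (exp w) * exp w) (at w)"
          by (simp only:)
        then show "(v' has_field_derivative (1 - of_real b + exp w) * v' w + of_real a * exp w * v w) (at w)"
          by (rule DERIV_cong) (simp add: v_def v'_def algebra_simps)
      qed
      have "((\<lambda>z. u z * z powr of_real a) \<longlongrightarrow> 1) (inf at_infinity (principal slit_plane))"
        using u by (simp add: is_tricomi_U_def)
      moreover have "filterlim (\<lambda>x::real. complex_of_real (exp x)) (inf at_infinity (principal slit_plane)) at_top"
        unfolding filterlim_inf filterlim_principal
      proof
        show "filterlim (\<lambda>x::real. complex_of_real (exp x)) at_infinity at_top"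
          by (rule filterlim_norm_at_top_imp_at_infinity) (simp add: exp_at_top)
        have "complex_of_real (exp x) \<in> slit_plane" for x
          using exp_in_slit_plane[of "of_real x"] by (simp add: exp_of_real)
        then show "\<forall>\<^sub>F x in at_top. complex_of_real (exp x) \<in> slit_plane" by simp
      qed
      ultimately have "((\<lambda>x. u (of_real (exp x)) * of_real (exp x) powr of_real a) \<longlongrightarrow> 1) at_top"
        by (rule filterlim_compose)
      moreover have "u (of_real (exp x)) * of_real (exp x) powr of_real a = v (of_real x) * exp (of_real a * of_real x)" for x :: real
        unfolding v_def powr_def exp_of_real[symmetric] by simp
      ultimately have limv: "((\<lambda>x. v (of_real x) * exp (of_real a * of_real x)) \<longlongrightarrow> 1) at_top" by (simp only:)
      have "v (Ln z) = V (Ln z)"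
        by (rule recessive_unique[OF VS v limV limv abs_Im_Ln_less_pi(1)[OF z]])
      then show ?thesis using z abs_Im_Ln_less_pi(2)[OF z] by (simp add: v_def U_def)
    qed
  qed
  have eqU: "tricomi_U a b = U"
    unfolding tricomi_U_def by (rule the_equality[where P = "is_tricomi_U a b", OF is_U unique])
  have real: "V (cnj w) = cnj (V w)" for w
  proof -
    let ?V = "\<lambda>w. cnj (V (cnj w))" and ?V' = "\<lambda>w. cnj (V' (cnj w))"
    have V2: "log_kummer a b ?V ?V'" by (rule log_kummer_cnj[OF V])
    have V2S: "log_kummer_on {w. \<bar>Im w\<bar> < pi} a b ?V ?V'" by (rule log_kummer_on_subset[OF V2]) simp
    have "((\<lambda>x. cnj (V (of_real x) * exp (of_real a * of_real x))) \<longlongrightarrow> cnj 1) at_top"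
      by (intro tendsto_cnj limV)
    then have lim2: "((\<lambda>x. ?V (of_real x) * exp (of_real a * of_real x)) \<longlongrightarrow> 1) at_top"
      by (simp add: exp_cnj)
    have eq: "?V w = V w" if "\<bar>Im w\<bar> < pi" for w by (rule recessive_unique[OF VS V2S limV lim2 that])
    \<comment> \<open>Agreement is known only for |Im w| < pi so far; equal Cauchy data at 0 carry
      it to the whole plane.\<close>
    have "?V' 0 = V' 0"
    proof (rule DERIV_unique)
      show "(V has_field_derivative V' 0) (at 0)" by (rule d)
      have "(?V has_field_derivative ?V' 0) (at 0)"
        using V2[unfolded log_kummer_on_def, rule_format, OF UNIV_I] by (rule conjunct1)
      then show "(V has_field_derivative ?V' 0) (at 0)"
        by (rule has_field_derivative_transform_within_open[OF _ open_strip[of pi]]) (simp, rule eq, simp)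
    qed
    then have "?V w = V w"
      by (rule log_kummer_unique(1)[OF V2 V _, of 0, rotated]) (rule eq, simp)
    from arg_cong[OF this, of cnj] show ?thesis by (simp only: complex_cnj_cnj)
  qed
  show ?thesis
    by (rule exI[of _ V], rule exI[of _ V'], rule exI[of _ C], rule exI[of _ L])
       (intro conjI V asym allI real eqU[unfolded U_def])
qed

section \<open>The generating function in the logarithmic variable\<close>

lemma conv_seq_1: "conv_seq \<alpha>1 \<alpha>2 \<alpha>3 (Suc 0) = 1"
  by (subst conv_seq.simps) simp

text \<open>Comparing f(z) \<sim> sum (-1)^n u_n z^(-n) with (k/a) U'/U at kz, the coefficient h_n
  of e^(-nw) in V'/V belongs to u_(n+1): one power of z comes from U' = V'/z, and u_0 goes into the
  additive constant. The powers of \<alpha>1 come from k = 1/\<alpha>1. The convolution of the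
  sequence then becomes the square in the Riccati equation.\<close>

lemma riccati_coefficients:
  fixes \<alpha>1 \<alpha>2 \<alpha>3 :: real
  assumes "\<alpha>1 \<noteq> 0"
  defines "a \<equiv> \<alpha>3 / \<alpha>1" and "b \<equiv> - 1 - \<alpha>2 / \<alpha>1"
  defines "h \<equiv> \<lambda>n. a * (-1) ^ Suc n * conv_seq \<alpha>1 \<alpha>2 \<alpha>3 (Suc n) / \<alpha>1 ^ n"
  shows "h 0 = - a" "h (Suc n) = (b - 1 - real n) * h n + (\<Sum>i\<le>n. h i * h (n - i))"
proof -
  let ?u = "conv_seq \<alpha>1 \<alpha>2 \<alpha>3"
  show "h 0 = - a" by (simp add: h_def conv_seq_1)
  define S where "S = (\<Sum>i\<le>n. ?u (Suc i) * ?u (Suc (n - i)))"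
  have "(\<Sum>j\<in>{1..Suc n}. ?u j * ?u (Suc (Suc n) - j)) = S"
    unfolding S_def by (rule sum.reindex_bij_witness[of _ Suc "\<lambda>j. j - 1"]) (auto simp: Suc_diff_le)
  then have u: "?u (Suc (Suc n)) = (\<alpha>1 * real (n + 2) + \<alpha>2) * ?u (Suc n) + \<alpha>3 * S"
    by (subst conv_seq.simps) simp
  have "(\<Sum>i\<le>n. h i * h (n - i)) = (\<Sum>i\<le>n. a\<^sup>2 * (-1) ^ n / \<alpha>1 ^ n * (?u (Suc i) * ?u (Suc (n - i))))"
  proof (rule sum.cong[OF refl])
    fix i assume "i \<in> {..n}"
    then have "(-1) ^ Suc i * (-1) ^ Suc (n - i) = ((-1) ^ n :: real)" "\<alpha>1 ^ i * \<alpha>1 ^ (n - i) = \<alpha>1 ^ n"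
      by (simp_all flip: power_add)
    moreover have "h i * h (n - i) = a\<^sup>2 * ((-1) ^ Suc i * (-1) ^ Suc (n - i)) * (?u (Suc i) * ?u (Suc (n - i))) / (\<alpha>1 ^ i * \<alpha>1 ^ (n - i))"
      by (simp add: h_def power2_eq_square)
    ultimately show "h i * h (n - i) = a\<^sup>2 * (-1) ^ n / \<alpha>1 ^ n * (?u (Suc i) * ?u (Suc (n - i)))" by simp
  qed
  then have sum: "(\<Sum>i\<le>n. h i * h (n - i)) = a\<^sup>2 * (-1) ^ n / \<alpha>1 ^ n * S"
    by (simp add: S_def sum_distrib_left)
  have "h (Suc n) = a * (-1) ^ n * ((\<alpha>1 * real (n + 2) + \<alpha>2) * ?u (Suc n) + \<alpha>3 * S) / (\<alpha>1 * \<alpha>1 ^ n)"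
    unfolding h_def u by simp
  also have "\<dots> = (b - 1 - real n) * h n + a\<^sup>2 * (-1) ^ n / \<alpha>1 ^ n * S"
    using assms(1) by (simp add: h_def a_def b_def field_simps power2_eq_square)
  finally show "h (Suc n) = (b - 1 - real n) * h n + (\<Sum>i\<le>n. h i * h (n - i))" unfolding sum .
qed

lemma exp_shift_2pi_i: "exp (w + 2 * of_real pi * \<i>) = exp w"
  by (simp add: exp_add exp_two_pi_i)

text \<open>Collects all that is needed of the generating function. The factor k in the argument is
  a translation of w by s = ln k, under which e^(-w) is multiplied by \<alpha>1 and the coefficients
  lose their powers of \<alpha>1.\<close>

lemma gen_fun_model:
  fixes \<alpha>1 \<alpha>2 \<alpha>3 :: real
  assumes \<alpha>1: "\<alpha>1 > 0" and \<alpha>3: "\<alpha>3 \<noteq> 0"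
  defines "a \<equiv> \<alpha>3 / \<alpha>1"
  shows "\<exists>W W' c r.
     (\<forall>w. (W has_field_derivative W' w) (at w)) \<and>
     (\<forall>w. W w = 0 \<longrightarrow> W' w \<noteq> 0) \<and>
     (\<forall>w. W (cnj w) = cnj (W w)) \<and>
     (\<forall>w0. W w0 = 0 \<longrightarrow> W (w0 + 2 * of_real pi * \<i>) = 0 \<longrightarrow>
        (\<exists>q. q \<noteq> 0 \<and> (\<forall>w. W (w + 2 * of_real pi * \<i>) = q * W w))) \<and>
     (\<forall>N. \<exists>K L. \<forall>w. Re w \<ge> L \<longrightarrow> \<bar>Im w\<bar> \<le> 10/3 \<longrightarrow> W w \<noteq> 0 \<and>
        norm (W' w / W w - (\<Sum>n<N. of_real (a * (-1) ^ Suc n * conv_seq \<alpha>1 \<alpha>2 \<alpha>3 (Suc n)) * exp (- w) ^ n))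
          \<le> K * exp (- Re w) ^ N) \<and>
     ((\<lambda>w. W' w / W w) \<longlongrightarrow> r) left_end \<and> eventually (\<lambda>w. W w \<noteq> 0) left_end \<and>
     (\<forall>z\<in>slit_plane. gen_fun \<alpha>1 \<alpha>2 \<alpha>3 z = W' (Ln z) / (of_real a * z * W (Ln z)) - c)"
proof -
  define b where "b = - 1 - \<alpha>2 / \<alpha>1"
  have a0: "a \<noteq> 0" using assms by simp
  obtain V V' C L where V: "log_kummer a b V V'"
    and asym: "\<forall>w. Re w \<ge> L \<longrightarrow> \<bar>Im w\<bar> \<le> 7/2 \<longrightarrow>
        norm (V w * exp (of_real a * w) - 1) \<le> C * exp (- Re w) \<and>
        norm ((V' w + of_real a * V w) * exp (of_real a * w)) \<le> C * exp (- Re w)"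
    and cnjV: "\<forall>w. V (cnj w) = cnj (V w)"
    and U: "tricomi_U a b = (\<lambda>z. if z \<in> slit_plane then V (Ln z) else 0)"
    using tricomi_representation[of a b] by (elim exE conjE) (rule that)
  have d: "(V has_field_derivative V' w) (at w)" for w
    using V unfolding log_kummer_on_def by auto
  define h where "h = (\<lambda>n. a * (-1) ^ Suc n * conv_seq \<alpha>1 \<alpha>2 \<alpha>3 (Suc n) / \<alpha>1 ^ n)"
  have h0: "complex_of_real (h 0) = - of_real a"
    using riccati_coefficients(1)[of \<alpha>1 \<alpha>3 \<alpha>2] \<alpha>1 by (simp add: h_def a_def)
  have hS: "complex_of_real (h (Suc n)) = (of_real b - 1 - of_nat n) * of_real (h n) + (\<Sum>i\<le>n. of_real (h i) * of_real (h (n - i)))" for n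
  proof -
    have "h (Suc n) = (b - 1 - real n) * h n + (\<Sum>i\<le>n. h i * h (n - i))"
      unfolding h_def a_def b_def by (rule riccati_coefficients(2)) (use \<alpha>1 in simp)
    then show ?thesis by simp
  qed
  have expansion: "\<exists>K L'. \<forall>w. Re w \<ge> L' \<longrightarrow> \<bar>Im w\<bar> \<le> 10/3 \<longrightarrow>
           V w \<noteq> 0 \<and> norm (V' w / V w - (\<Sum>n<N. of_real (h n) * exp (- w) ^ n)) \<le> K * exp (- Re w) ^ N" for N
    by (rule log_derivative_expansion[OF V asym[rule_format] h0 hS]) auto
  obtain w1 where w1: "V w1 \<noteq> 0"
  proof -
    obtain K L' where "\<forall>w. Re w \<ge> L' \<longrightarrow> \<bar>Im w\<bar> \<le> 10/3 \<longrightarrow>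
           V w \<noteq> 0 \<and> norm (V' w / V w - (\<Sum>n<0. of_real (h n) * exp (- w) ^ n)) \<le> K * exp (- Re w) ^ 0"
      using expansion[of 0] by (elim exE) (rule that)
    from this[rule_format, of "of_real L'"] show ?thesis using that[of "of_real L'"] by simp
  qed
  have simple: "V' w \<noteq> 0" if "V w = 0" for w
  proof
    assume "V' w = 0"
    from log_kummer_zero_data[OF V that this, of w1] w1 show False by simp
  qed
  obtain r where r: "((\<lambda>w. V' w / V w) \<longlongrightarrow> r) left_end" "eventually (\<lambda>w. V w \<noteq> 0) left_end"
    using log_kummer_left_limit[OF V w1] by (elim exE conjE) (rule that)
  define s where "s = ln (1 / \<alpha>1)"
  have exps1: "exp s = 1 / \<alpha>1" unfolding s_def using \<alpha>1 by (intro exp_ln) simp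
  then have exps: "exp s = 1 / \<alpha>1" "exp (- s) = \<alpha>1" by (simp_all add: exp_minus)
  have expsc: "exp (complex_of_real s) = 1 / of_real \<alpha>1" "exp (- complex_of_real s) = of_real \<alpha>1"
    using exps1 by (simp_all add: exp_of_real exp_minus)
  define W where "W = (\<lambda>w. V (w + of_real s))"
  define W' where "W' = (\<lambda>w. V' (w + of_real s))"
  define c where "c = complex_of_real (if b = 0 then 0 else (1 / \<alpha>1) / b)"
  have "(W has_field_derivative W' w) (at w)" for w
    unfolding W_def W'_def using d[of "w + of_real s"] by (simp add: DERIV_shift)
  moreover have "W w = 0 \<longrightarrow> W' w \<noteq> 0" for w using simple by (simp add: W_def W'_def)
  moreover have "W (cnj w) = cnj (W w)" for w
    using cnjV[rule_format, of "w + of_real s"] by (simp add: W_def)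
  moreover have "W w0 = 0 \<longrightarrow> W (w0 + 2 * of_real pi * \<i>) = 0 \<longrightarrow>
        (\<exists>q. q \<noteq> 0 \<and> (\<forall>w. W (w + 2 * of_real pi * \<i>) = q * W w))" for w0
  proof (intro impI)
    assume 0: "W w0 = 0" "W (w0 + 2 * of_real pi * \<i>) = 0"
    define V1 where "V1 = (\<lambda>w. V (w + 2 * of_real pi * \<i>))"
    define V1' where "V1' = (\<lambda>w. V' (w + 2 * of_real pi * \<i>))"
    \<comment> \<open>The coefficients of the equation have period 2 pi i, so the translate is a
      solution too. Two solutions with a common zero are proportional, since the zeros of V are
      simple.\<close>
    have V1: "log_kummer a b V1 V1'"
      unfolding log_kummer_on_def
    proof (intro ballI conjI)
      fix w
      note V[unfolded log_kummer_on_def, rule_format, of "w + 2 * of_real pi * \<i>", simplified exp_shift_2pi_i, OF UNIV_I]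
      then show "(V1 has_field_derivative V1' w) (at w)"
          "(V1' has_field_derivative (1 - of_real b + exp w) * V1' w + of_real a * exp w * V1 w) (at w)"
        unfolding V1_def V1'_def by (simp_all add: DERIV_shift)
    qed
    define w2 where "w2 = w0 + of_real s"
    have z: "V w2 = 0" "V1 w2 = 0" using 0 by (simp_all add: W_def V1_def w2_def algebra_simps)
    define q where "q = V1' w2 / V' w2"
    have lam: "log_kummer a b (\<lambda>w. q * V w + 0 * V w) (\<lambda>w. q * V' w + 0 * V' w)"
      by (rule log_kummer_on_lincomb[OF V V])
    have V1eq: "V1 w = q * V w" for w
    proof -
      have "V1 w = q * V w + 0 * V w"
        by (rule log_kummer_unique(1)[OF V1 lam, of w2]) (use z simple[OF z(1)] in \<open>simp_all add: q_def\<close>)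
      then show ?thesis by simp
    qed
    have "q \<noteq> 0"
    proof
      assume "q = 0"
      then have "V1 (w1 - 2 * of_real pi * \<i>) = 0" using V1eq by simp
      then show False using w1 by (simp add: V1_def)
    qed
    then show "\<exists>q. q \<noteq> 0 \<and> (\<forall>w. W (w + 2 * of_real pi * \<i>) = q * W w)"
    proof (intro exI[of _ q] conjI allI)
      show "W (w + 2 * of_real pi * \<i>) = q * W w" for w
        using V1eq[of "w + of_real s"] by (simp add: W_def V1_def add_ac)
    qed
  qed
  moreover have "\<exists>K L. \<forall>w. Re w \<ge> L \<longrightarrow> \<bar>Im w\<bar> \<le> 10/3 \<longrightarrow> W w \<noteq> 0 \<and>
        norm (W' w / W w - (\<Sum>n<N. of_real (a * (-1) ^ Suc n * conv_seq \<alpha>1 \<alpha>2 \<alpha>3 (Suc n)) * exp (- w) ^ n))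
          \<le> K * exp (- Re w) ^ N" for N
  proof -
    obtain K L' where KL: "\<forall>w. Re w \<ge> L' \<longrightarrow> \<bar>Im w\<bar> \<le> 10/3 \<longrightarrow>
           V w \<noteq> 0 \<and> norm (V' w / V w - (\<Sum>n<N. of_real (h n) * exp (- w) ^ n)) \<le> K * exp (- Re w) ^ N"
      using expansion[of N] by (elim exE) (rule that)
    show ?thesis
    proof (rule exI[of _ "K * \<alpha>1 ^ N"], rule exI[of _ "L' - s"], intro allI impI)
      fix w assume w: "Re w \<ge> L' - s" "\<bar>Im w\<bar> \<le> 10/3"
      have "of_real (h n) * exp (- (w + of_real s)) ^ n
          = of_real (a * (-1) ^ Suc n * conv_seq \<alpha>1 \<alpha>2 \<alpha>3 (Suc n)) * exp (- w) ^ n" for n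
      proof -
        have "exp (- (w + of_real s)) = exp (- w) * of_real \<alpha>1"
          unfolding minus_add_distrib exp_add expsc(2) ..
        moreover have "complex_of_real \<alpha>1 ^ n \<noteq> 0" using \<alpha>1 by simp
        ultimately show ?thesis using \<alpha>1 by (simp add: h_def power_mult_distrib)
      qed
      moreover have "exp (- Re (w + of_real s)) = exp (- Re w) * \<alpha>1"
        using exps(2) by (simp add: exp_add exp_diff exp_minus field_simps)
      ultimately show "W w \<noteq> 0 \<and>
        norm (W' w / W w - (\<Sum>n<N. of_real (a * (-1) ^ Suc n * conv_seq \<alpha>1 \<alpha>2 \<alpha>3 (Suc n)) * exp (- w) ^ n))
          \<le> K * \<alpha>1 ^ N * exp (- Re w) ^ N"
        using KL[rule_format, of "w + of_real s"] w
        by (simp only: W_def W'_def power_mult_distrib plus_complex.sel Re_complex_of_real Im_complex_of_real) (simp add: mult_ac)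
    qed
  qed
  moreover have shift: "filterlim (\<lambda>w. w + of_real s) left_end left_end"
    unfolding filterlim_iff eventually_left_end
  proof (intro allI impI)
    fix P assume "\<exists>l. \<forall>w. Re w \<le> l \<longrightarrow> \<bar>Im w\<bar> \<le> 4 \<longrightarrow> P w"
    then obtain l where "\<forall>w. Re w \<le> l \<longrightarrow> \<bar>Im w\<bar> \<le> 4 \<longrightarrow> P w" ..
    then show "\<exists>l. \<forall>w. Re w \<le> l \<longrightarrow> \<bar>Im w\<bar> \<le> 4 \<longrightarrow> P (w + of_real s)"
      by (intro exI[of _ "l - s"]) simp
  qed
  moreover have "((\<lambda>w. W' w / W w) \<longlongrightarrow> r) left_end"
    unfolding W_def W'_def by (rule filterlim_compose[OF r(1) shift])
  moreover have "eventually (\<lambda>w. W w \<noteq> 0) left_end"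
    unfolding W_def by (rule eventually_compose_filterlim[OF r(2) shift])
  moreover have "gen_fun \<alpha>1 \<alpha>2 \<alpha>3 z = W' (Ln z) / (of_real a * z * W (Ln z)) - c" if z: "z \<in> slit_plane" for z
  proof -
    have z0: "z \<noteq> 0" and im: "\<bar>Im (Ln z)\<bar> < pi" by (rule abs_Im_Ln_less_pi[OF z])+
    define y where "y = complex_of_real (1 / \<alpha>1) * z"
    have ey: "exp (Ln z + of_real s) = y" using z0 expsc by (simp add: y_def exp_add)
    have Lny: "Ln y = Ln z + of_real s" by (rule Ln_unique[OF ey]) (use im in auto)
    have ys: "y \<in> slit_plane" using exp_in_slit_plane[of "Ln z + of_real s"] im ey by simp
    have "(tricomi_U a b has_field_derivative V' (Ln y) * inverse y) (at y)"
    proof (rule has_field_derivative_transform_within_open[OF _ open_slit_plane ys])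
      show "((\<lambda>z. V (Ln z)) has_field_derivative V' (Ln y) * inverse y) (at y)"
        by (rule DERIV_chain'[OF _ d, THEN DERIV_cong]) (use ys in \<open>auto intro: has_field_derivative_Ln\<close>)
    qed (simp add: U)
    then have "deriv (tricomi_U a b) y = W' (Ln z) / y"
      unfolding Lny W'_def by (simp add: DERIV_imp_deriv divide_inverse)
    moreover have "tricomi_U a b y = W (Ln z)" using ys by (simp add: U Lny W_def)
    ultimately have "gen_fun \<alpha>1 \<alpha>2 \<alpha>3 z = of_real (1 / \<alpha>1 / a) * (W' (Ln z) / y / W (Ln z)) - c"
      unfolding gen_fun_def Let_def c_def a_def[symmetric] b_def[symmetric] y_def[symmetric] by simp
    also have "of_real (1 / \<alpha>1 / a) * (W' (Ln z) / y / W (Ln z)) = W' (Ln z) / (of_real a * z * W (Ln z))"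
      unfolding y_def using \<alpha>1 by simp
    finally show ?thesis .
  qed
  ultimately show ?thesis
    by (intro exI[of _ W] exI[of _ W'] exI[of _ c] exI[of _ r] conjI allI ballI)
qed

section \<open>Poles and boundary values\<close>

lemma nonzero_near_simple_zero:
  fixes q :: "complex \<Rightarrow> complex"
  assumes "(q has_field_derivative q') (at \<zeta>)" "q \<zeta> = 0" "q' \<noteq> 0"
  shows "eventually (\<lambda>z. q z \<noteq> 0) (at \<zeta>)"
proof -
  have "((\<lambda>z. (q z - q \<zeta>) / (z - \<zeta>)) \<longlongrightarrow> q') (at \<zeta>)"
    using assms(1) by (simp add: has_field_derivative_iff)
  then have "eventually (\<lambda>z. (q z - q \<zeta>) / (z - \<zeta>) \<noteq> 0) (at \<zeta>)"
    using assms(3) by (rule tendsto_imp_eventually_ne)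
  then show ?thesis by eventually_elim (use assms(2) in auto)
qed

text \<open>Agreement with p/q is asked only where q is nonzero: the values of f at the poles come
  from division by zero and carry no information. With the additive constant moved into p, both the
  poles in the slit plane and those on the cut are covered.\<close>

lemma simple_pole_quotient:
  fixes p q f :: "complex \<Rightarrow> complex"
  assumes p: "p holomorphic_on S" and q: "q holomorphic_on S" and S: "open S" "\<zeta> \<in> S"
    and q': "(q has_field_derivative q') (at \<zeta>)" "q' \<noteq> 0" and z: "q \<zeta> = 0" "p \<zeta> \<noteq> 0"
    and f: "\<And>z. z \<in> S \<Longrightarrow> q z \<noteq> 0 \<Longrightarrow> f z = p z / q z"
  shows "simple_pole_at f \<zeta>" "residue f \<zeta> = p \<zeta> / q'"
proof -
  have ev: "eventually (\<lambda>z. q z \<noteq> 0) (at \<zeta>)"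
    by (rule nonzero_near_simple_zero[OF q'(1) z(1) q'(2)])
  have evS: "eventually (\<lambda>z. z \<in> S) (at \<zeta>)"
    by (rule eventually_at_in_open'[OF S])
  have eq: "eventually (\<lambda>z. f z = p z / q z) (at \<zeta>)"
    using ev evS by eventually_elim (rule f)
  obtain r where r: "r > 0" "ball \<zeta> r \<subseteq> S"
    using S open_contains_ball by blast
  have hol: "p holomorphic_on ball \<zeta> r" "q holomorphic_on ball \<zeta> r"
    using p q r(2) by (auto intro: holomorphic_on_subset)
  have res: "zorder (\<lambda>w. p w / q w) \<zeta> = - 1" "residue (\<lambda>w. p w / q w) \<zeta> = p \<zeta> / q'"
    using porder_simple_pole_deriv[OF hol open_ball _ _ q'(1) z(2,1) q'(2)]
      residue_simple_pole_deriv[OF hol open_ball _ _ q'(1) z(2,1) q'(2)] r(1) by auto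
  have cont: "isCont p \<zeta>" "isCont q \<zeta>"
    using holomorphic_on_imp_continuous_on[OF p] holomorphic_on_imp_continuous_on[OF q] S
    by (auto simp: continuous_on_eq_continuous_at)
  have "filterlim q (at 0) (at \<zeta>)"
    unfolding filterlim_at using ev cont(2) z(1) by (auto simp: isCont_def)
  then have pole: "is_pole (\<lambda>w. p w / q w) \<zeta>" by (rule is_pole_divide[OF cont(1) _ z(2)])
  have iso: "isolated_singularity_at (\<lambda>w. p w / q w) \<zeta>"
  proof -
    from ev obtain d where d: "d > 0" "\<And>z. z \<noteq> \<zeta> \<Longrightarrow> dist z \<zeta> < d \<Longrightarrow> q z \<noteq> 0"
      unfolding eventually_at by auto
    define e where "e = min r d"
    have "(\<lambda>w. p w / q w) holomorphic_on ball \<zeta> e - {\<zeta>}"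
      using d(2) by (intro holomorphic_on_divide holomorphic_on_subset[OF hol(1)] holomorphic_on_subset[OF hol(2)])
        (auto simp: e_def dist_commute)
    then show ?thesis
      by (rule isolated_singularity_at_holomorphic) (use r d in \<open>auto simp: e_def\<close>)
  qed
  show "simple_pole_at f \<zeta>"
    unfolding simple_pole_at_def
    using iso pole res(1) isolated_singularity_at_cong[OF eq refl] is_pole_cong[OF eq refl] zorder_cong[OF eq refl] by simp
  show "residue f \<zeta> = p \<zeta> / q'"
    using residue_cong[OF eq refl] res(2) by simp
qed

text \<open>In the variable z = e^w, f + c is 1/a times the derivative of log W(Ln z). The facts
  listed replace the differential equation from here on: simple zeros, reflection, the behaviour
  under one turn around the origin, and the two ends of the strip.\<close>

locale slit_log_derivative =
  fixes f W W' :: "complex \<Rightarrow> complex" and a :: real and c r :: complex and \<eta> :: "nat \<Rightarrow> complex"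
  assumes a0: "a \<noteq> 0"
    and dW: "(W has_field_derivative W' w) (at w)"
    and simple_zero: "W w = 0 \<Longrightarrow> W' w \<noteq> 0"
    and W_cnj: "W (cnj w) = cnj (W w)"
    and monodromy: "W w = 0 \<Longrightarrow> W (w + 2 * of_real pi * \<i>) = 0 \<Longrightarrow>
       \<exists>q. q \<noteq> 0 \<and> (\<forall>w. W (w + 2 * of_real pi * \<i>) = q * W w)"
    and expansion: "\<exists>K L. \<forall>w. Re w \<ge> L \<longrightarrow> \<bar>Im w\<bar> \<le> 10/3 \<longrightarrow> W w \<noteq> 0 \<and>
        norm (W' w / W w - (\<Sum>n<N. \<eta> n * exp (- w) ^ n)) \<le> K * exp (- Re w) ^ N"
    and left_lim: "((\<lambda>w. W' w / W w) \<longlongrightarrow> r) left_end"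
    and left_nz: "eventually (\<lambda>w. W w \<noteq> 0) left_end"
    and f_eq: "z \<in> slit_plane \<Longrightarrow> f z = W' (Ln z) / (of_real a * z * W (Ln z)) - c"
begin

section \<open>Zeros of W and the singularities of f off the cut\<close>

lemma W_hol: "W holomorphic_on A"
  using dW by (intro holomorphic_onI) (auto simp: field_differentiable_def intro: has_field_derivative_at_within)

lemma W'_hol: "W' holomorphic_on A"
proof -
  have "deriv W = W'" using DERIV_imp_deriv[OF dW] by blast
  then have "W' holomorphic_on UNIV" using holomorphic_deriv[OF W_hol[of UNIV] open_UNIV] by simp
  then show ?thesis by (rule holomorphic_on_subset) simp
qed

lemma W_cont: "isCont W w" and W'_cont: "isCont W' w"
  using holomorphic_on_imp_continuous_on[OF W_hol[of UNIV]] holomorphic_on_imp_continuous_on[OF W'_hol[of UNIV]]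
  by (auto simp: continuous_on_eq_continuous_at)

lemma right_nz: "\<exists>L. \<forall>w. Re w \<ge> L \<longrightarrow> \<bar>Im w\<bar> \<le> 10/3 \<longrightarrow> W w \<noteq> 0"
proof -
  obtain K L where KL: "\<forall>w. Re w \<ge> L \<longrightarrow> \<bar>Im w\<bar> \<le> 10/3 \<longrightarrow> W w \<noteq> 0 \<and>
        norm (W' w / W w - (\<Sum>n<0. \<eta> n * exp (- w) ^ n)) \<le> K * exp (- Re w) ^ 0"
    using expansion[of 0] by (elim exE) (rule that)
  show ?thesis by (rule exI[of _ L], intro allI impI) (use KL[rule_format] in simp)
qed

lemma left_nz': "\<exists>l. \<forall>w. Re w \<le> l \<longrightarrow> \<bar>Im w\<bar> \<le> 4 \<longrightarrow> W w \<noteq> 0"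
  using left_nz unfolding eventually_left_end .

definition zeros :: "complex set" where
  "zeros = {w. W w = 0 \<and> \<bar>Im w\<bar> \<le> 10/3}"

text \<open>An accumulation point would make W vanish identically, against the zero-free region on
  the right.\<close>

lemma finite_zeros_compact:
  assumes "compact K"
  shows "finite {w\<in>K. W w = 0}"
proof (rule ccontr)
  assume "infinite {w\<in>K. W w = 0}"
  then obtain x where x: "x \<in> K" "x islimpt {w\<in>K. W w = 0}"
    using assms unfolding compact_eq_Bolzano_Weierstrass by blast
  obtain L where L: "\<forall>w. Re w \<ge> L \<longrightarrow> \<bar>Im w\<bar> \<le> 10/3 \<longrightarrow> W w \<noteq> 0" using right_nz ..
  have "W (of_real L) = 0"
    by (rule analytic_continuation[of W UNIV "{w\<in>K. W w = 0}" x]) (use x W_hol in auto)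
  then show False using L[rule_format, of "of_real L"] by simp
qed

lemma finite_zeros: "finite zeros"
proof -
  obtain L where L: "\<forall>w. Re w \<ge> L \<longrightarrow> \<bar>Im w\<bar> \<le> 10/3 \<longrightarrow> W w \<noteq> 0" using right_nz ..
  obtain l where l: "\<forall>w. Re w \<le> l \<longrightarrow> \<bar>Im w\<bar> \<le> 4 \<longrightarrow> W w \<noteq> 0" using left_nz' ..
  have "zeros \<subseteq> {w\<in>cbox (Complex l (-10/3)) (Complex L (10/3)). W w = 0}"
  proof
    fix w assume "w \<in> zeros"
    then have w: "W w = 0" "\<bar>Im w\<bar> \<le> 10/3" by (auto simp: zeros_def)
    have "\<not> Re w \<ge> L" using L[rule_format, of w] w by blast
    moreover have "\<not> Re w \<le> l" using l[rule_format, of w] w by auto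
    ultimately show "w \<in> {w\<in>cbox (Complex l (-10/3)) (Complex L (10/3)). W w = 0}"
      using w by (auto simp: in_cbox_complex_iff abs_le_iff)
  qed
  then show ?thesis by (rule finite_subset) (rule finite_zeros_compact[OF compact_cbox])
qed

definition slit_zeros :: "complex set" where
  "slit_zeros = {z\<in>slit_plane. W (Ln z) = 0}"

lemma Im_bound: "\<bar>x\<bar> \<le> pi \<Longrightarrow> \<bar>x\<bar> \<le> 10/3"
  using pi_less_ten_thirds by linarith

lemma slit_zeros_eq: "slit_zeros = exp ` {w\<in>zeros. \<bar>Im w\<bar> < pi}"
proof (intro set_eqI iffI)
  fix z assume "z \<in> slit_zeros"
  then have z: "z \<in> slit_plane" "W (Ln z) = 0" by (auto simp: slit_zeros_def)
  then have "\<bar>Im (Ln z)\<bar> < pi" "z \<noteq> 0" using abs_Im_Ln_less_pi by blast+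
  then show "z \<in> exp ` {w\<in>zeros. \<bar>Im w\<bar> < pi}"
    using z Im_bound[of "Im (Ln z)"] by (intro image_eqI[of _ _ "Ln z"]) (auto simp: zeros_def)
next
  fix z assume "z \<in> exp ` {w\<in>zeros. \<bar>Im w\<bar> < pi}"
  then obtain w where w: "z = exp w" "W w = 0" "\<bar>Im w\<bar> < pi" by (auto simp: zeros_def)
  then show "z \<in> slit_zeros" using exp_in_slit_plane[OF w(3)] by (simp add: slit_zeros_def)
qed

lemma finite_slit_zeros: "finite slit_zeros"
  unfolding slit_zeros_eq using finite_zeros by simp

lemma f_quotient:
  assumes "z \<in> slit_plane" "W (Ln z) \<noteq> 0"
  shows "f z = (W' (Ln z) - c * (of_real a * z * W (Ln z))) / (of_real a * z * W (Ln z))"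
  using assms a0 abs_Im_Ln_less_pi(2)[OF assms(1)] by (simp add: f_eq diff_divide_distrib)

lemma dLn: "z \<in> slit_plane \<Longrightarrow> (Ln has_field_derivative inverse z) (at z)"
  by (rule has_field_derivative_Ln) simp

lemma Ln_hol: "A \<subseteq> slit_plane \<Longrightarrow> Ln holomorphic_on A"
  by (rule holomorphic_on_Ln) auto

lemma comp_Ln_hol: "A \<subseteq> slit_plane \<Longrightarrow> (\<lambda>z. W (Ln z)) holomorphic_on A"
  "A \<subseteq> slit_plane \<Longrightarrow> (\<lambda>z. W' (Ln z)) holomorphic_on A"
  using holomorphic_on_compose[OF Ln_hol W_hol] holomorphic_on_compose[OF Ln_hol W'_hol] by (simp_all add: o_def)

text \<open>As f + c is 1/a times a logarithmic derivative in z, a simple zero of W(Ln z) gives the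
  residue 1/a, the same at every pole.\<close>

lemma slit_zero_pole:
  assumes "\<zeta> \<in> slit_zeros"
  shows "simple_pole_at f \<zeta>" "residue f \<zeta> = 1 / of_real a"
proof -
  have \<zeta>: "\<zeta> \<in> slit_plane" "W (Ln \<zeta>) = 0" using assms by (auto simp: slit_zeros_def)
  have \<zeta>0: "\<zeta> \<noteq> 0" by (rule abs_Im_Ln_less_pi[OF \<zeta>(1)])
  define p where "p = (\<lambda>z. W' (Ln z) - c * (of_real a * z * W (Ln z)))"
  define q where "q = (\<lambda>z. of_real a * z * W (Ln z))"
  have hol: "p holomorphic_on slit_plane" "q holomorphic_on slit_plane"
    unfolding p_def q_def by (intro holomorphic_intros comp_Ln_hol order_refl)+
  have "((\<lambda>z. W (Ln z)) has_field_derivative W' (Ln \<zeta>) * inverse \<zeta>) (at \<zeta>)"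
    by (rule DERIV_chain'[OF dLn[OF \<zeta>(1)] dW, THEN DERIV_cong]) simp
  then have "(q has_field_derivative (of_real a * \<zeta>) * (W' (Ln \<zeta>) * inverse \<zeta>) + of_real a * W (Ln \<zeta>)) (at \<zeta>)"
    unfolding q_def by (auto intro!: derivative_eq_intros)
  then have q': "(q has_field_derivative of_real a * W' (Ln \<zeta>)) (at \<zeta>)"
    by (rule DERIV_cong) (use \<zeta>(2) \<zeta>0 in \<open>simp add: field_simps\<close>)
  have pz: "p \<zeta> = W' (Ln \<zeta>)" "q \<zeta> = 0" by (simp_all add: p_def q_def \<zeta>)
  have nz: "W' (Ln \<zeta>) \<noteq> 0" by (rule simple_zero[OF \<zeta>(2)])
  have q'0: "of_real a * W' (Ln \<zeta>) \<noteq> 0" using nz a0 by simp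
  have p0: "p \<zeta> \<noteq> 0" using nz pz by simp
  have fq: "f z = p z / q z" if "z \<in> slit_plane" "q z \<noteq> 0" for z
    using f_quotient[of z] that by (auto simp: p_def q_def)
  show "simple_pole_at f \<zeta>"
    by (rule simple_pole_quotient(1)[OF hol open_slit_plane \<zeta>(1) q' q'0 pz(2) p0 fq])
  have "residue f \<zeta> = p \<zeta> / (of_real a * W' (Ln \<zeta>))"
    by (rule simple_pole_quotient(2)[OF hol open_slit_plane \<zeta>(1) q' q'0 pz(2) p0 fq])
  then show "residue f \<zeta> = 1 / of_real a" using nz by (simp add: pz)
qed

lemma f_analytic:
  assumes "z \<in> slit_plane" "z \<notin> slit_zeros"
  shows "f analytic_on {z}"
proof -
  define S where "S = slit_plane - slit_zeros"
  have S: "open S" unfolding S_def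
    using open_slit_plane finite_imp_closed[OF finite_slit_zeros] by (rule open_Diff)
  have "(\<lambda>z. W' (Ln z) / (of_real a * z * W (Ln z)) - c) holomorphic_on S"
    by (intro holomorphic_intros comp_Ln_hol) (use a0 in \<open>auto simp: S_def slit_zeros_def\<close>)
  then have "f holomorphic_on S" by (rule holomorphic_transform) (simp add: S_def f_eq)
  then show ?thesis using S assms by (intro holomorphic_on_imp_analytic_at[of f S]) (auto simp: S_def)
qed

lemma slit_poles_eq: "slit_poles f = slit_zeros"
proof (intro set_eqI iffI)
  fix z assume "z \<in> slit_poles f"
  then have z: "z \<in> slit_plane" "is_pole f z" by (auto simp: slit_poles_def simple_pole_at_def)
  then show "z \<in> slit_zeros" using f_analytic[of z] analytic_at_imp_no_pole[of f z] by blast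
next
  fix z assume "z \<in> slit_zeros"
  then show "z \<in> slit_poles f" using slit_zero_pole(1)[of z] by (simp add: slit_poles_def slit_zeros_def)
qed

text \<open>z f(z) is W'/W at Ln z, divided by a, minus c z; and Ln sends z tending to 0 in the slit
  plane to the left end.\<close>

lemma origin_limit: "((\<lambda>z. z * f z) \<longlongrightarrow> r / of_real a) (at 0 within slit_plane)"
proof -
  have "filterlim Ln left_end (at 0 within slit_plane)"
    unfolding filterlim_iff eventually_left_end
  proof (intro allI impI)
    fix P assume "\<exists>l. \<forall>w. Re w \<le> l \<longrightarrow> \<bar>Im w\<bar> \<le> 4 \<longrightarrow> P w"
    then obtain l where l: "\<forall>w. Re w \<le> l \<longrightarrow> \<bar>Im w\<bar> \<le> 4 \<longrightarrow> P w" ..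
    show "eventually (\<lambda>z. P (Ln z)) (at 0 within slit_plane)"
      unfolding eventually_at
    proof (intro exI[of _ "exp l"] conjI ballI impI)
      fix z :: complex assume z: "z \<in> slit_plane" "z \<noteq> 0 \<and> dist z 0 < exp l"
      then have "ln (norm z) \<le> ln (exp l)" by (subst ln_le_cancel_iff) auto
      then have "Re (Ln z) \<le> l" using z by simp
      moreover have "\<bar>Im (Ln z)\<bar> \<le> 4" using abs_Im_Ln_less_pi(1)[OF z(1)] pi_less_ten_thirds by linarith
      ultimately show "P (Ln z)" using l by blast
    qed simp
  qed
  from filterlim_compose[OF left_lim this]
  have "((\<lambda>z. W' (Ln z) / W (Ln z)) \<longlongrightarrow> r) (at 0 within slit_plane)" .
  then have "((\<lambda>z. W' (Ln z) / W (Ln z) / of_real a - c * z) \<longlongrightarrow> r / of_real a - c * 0) (at 0 within slit_plane)"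
    by (intro tendsto_intros) (use a0 in auto)
  then have lim: "((\<lambda>z. W' (Ln z) / W (Ln z) / of_real a - c * z) \<longlongrightarrow> r / of_real a) (at 0 within slit_plane)" by simp
  have "eventually (\<lambda>z. W' (Ln z) / W (Ln z) / of_real a - c * z = z * f z) (at 0 within slit_plane)"
    unfolding eventually_at_filter
  proof (rule always_eventually, intro allI impI)
    fix z :: complex assume "z \<noteq> 0" "z \<in> slit_plane"
    then show "W' (Ln z) / W (Ln z) / of_real a - c * z = z * f z"
      by (simp add: f_eq right_diff_distrib mult.commute)
  qed
  then show ?thesis by (rule Lim_transform_eventually[OF lim])
qed

lemma residue_at_origin_eq: "residue_at_origin f = r / of_real a"
proof -
  have "(0::complex) islimpt slit_plane"
    unfolding islimpt_approachable
  proof (intro allI impI)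
    fix e :: real assume "e > 0"
    then show "\<exists>x'\<in>slit_plane. x' \<noteq> 0 \<and> dist x' 0 < e"
      by (intro bexI[of _ "of_real (e/2)"]) (auto simp: complex_nonpos_Reals_iff)
  qed
  then have "at 0 within slit_plane \<noteq> bot" by (simp add: trivial_limit_within)
  then show ?thesis unfolding residue_at_origin_def by (rule tendsto_Lim[OF _ origin_limit])
qed

lemma simply_represented_f: "simply_represented f"
  unfolding simply_represented_def
proof
  show "\<forall>z\<in>slit_plane. f analytic_on {z} \<or> simple_pole_at f z"
    using f_analytic slit_zero_pole(1) by blast
  show "\<exists>r. ((\<lambda>z. z * f z) \<longlongrightarrow> r) (at 0 within slit_plane)"
    using origin_limit by (rule exI)
qed

section \<open>Boundary values on the two banks of the cut\<close>

lemma Ln_above_cut: "\<epsilon> > 0 \<Longrightarrow> Ln (Complex (- x) \<epsilon>) = Ln (Complex x (- \<epsilon>)) + \<i> * pi"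
  and Ln_below_cut: "\<epsilon> > 0 \<Longrightarrow> Ln (Complex (- x) (- \<epsilon>)) = Ln (Complex x \<epsilon>) - \<i> * pi"
proof -
  have neg: "- Complex x t = Complex (- x) (- t)" for t by (simp add: complex_eq_iff)
  assume \<epsilon>: "\<epsilon> > 0"
  show "Ln (Complex (- x) \<epsilon>) = Ln (Complex x (- \<epsilon>)) + \<i> * pi"
    using Ln_minus[of "Complex x (- \<epsilon>)"] \<epsilon> unfolding neg by (simp add: complex_eq_iff)
  show "Ln (Complex (- x) (- \<epsilon>)) = Ln (Complex x \<epsilon>) - \<i> * pi"
    using Ln_minus[of "Complex x \<epsilon>"] \<epsilon> unfolding neg by (simp add: complex_eq_iff)
qed

lemma cut_point_in_slit: "t \<noteq> 0 \<Longrightarrow> Complex x t \<in> slit_plane"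
  by (auto simp: complex_nonpos_Reals_iff)

lemma f_off_axis:
  "t \<noteq> 0 \<Longrightarrow> f (Complex x t) = W' (Ln (Complex x t)) / (of_real a * Complex x t * W (Ln (Complex x t))) - c"
  by (rule f_eq[OF cut_point_in_slit])

lemma tendsto_Complex_at_right: "((\<lambda>\<epsilon>. Complex x (s * \<epsilon>)) \<longlongrightarrow> of_real x) (at_right 0)"
proof -
  have "((\<lambda>\<epsilon>. complex_of_real x + \<i> * of_real (s * \<epsilon>)) \<longlongrightarrow> of_real x + \<i> * of_real (s * 0)) (at_right 0)"
    by (intro tendsto_intros)
  then show ?thesis by (simp add: Complex_eq)
qed

definition upper :: "real \<Rightarrow> complex" where "upper x = of_real (ln x) + \<i> * of_real pi"
definition lower :: "real \<Rightarrow> complex" where "lower x = of_real (ln x) - \<i> * of_real pi"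

text \<open>Ln is discontinuous at -x, so the limits are taken near the positive point x after
  splitting off \<plusminus>i pi.\<close>

lemma Ln_cut_limits:
  assumes x: "x > 0"
  shows "((\<lambda>\<epsilon>. Ln (Complex (- x) \<epsilon>)) \<longlongrightarrow> upper x) (at_right 0)"
    "((\<lambda>\<epsilon>. Ln (Complex (- x) (- \<epsilon>))) \<longlongrightarrow> lower x) (at_right 0)"
proof -
  have Lnx: "Ln (of_real x) = of_real (ln x)" using x by (rule Ln_of_real)
  have cont: "isCont Ln (of_real x)" using x by (intro continuous_at_Ln) (auto simp: complex_nonpos_Reals_iff)
  have 1: "((\<lambda>\<epsilon>. Ln (Complex x ((-1) * \<epsilon>)) + \<i> * pi) \<longlongrightarrow> Ln (of_real x) + \<i> * pi) (at_right 0)"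
    by (intro tendsto_intros isCont_tendsto_compose[OF cont tendsto_Complex_at_right])
  show "((\<lambda>\<epsilon>. Ln (Complex (- x) \<epsilon>)) \<longlongrightarrow> upper x) (at_right 0)"
    by (rule Lim_transform_eventually[OF 1[unfolded Lnx upper_def[symmetric]]])
       (rule eventually_mono[OF eventually_at_right_less], simp add: Ln_above_cut)
  have 2: "((\<lambda>\<epsilon>. Ln (Complex x (1 * \<epsilon>)) - \<i> * pi) \<longlongrightarrow> Ln (of_real x) - \<i> * pi) (at_right 0)"
    by (intro tendsto_intros isCont_tendsto_compose[OF cont tendsto_Complex_at_right])
  show "((\<lambda>\<epsilon>. Ln (Complex (- x) (- \<epsilon>))) \<longlongrightarrow> lower x) (at_right 0)"
    by (rule Lim_transform_eventually[OF 2[unfolded Lnx lower_def[symmetric]]])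
       (rule eventually_mono[OF eventually_at_right_less], simp add: Ln_below_cut)
qed

lemma W_lower: "W (lower x) = cnj (W (upper x))"
proof -
  have "lower x = cnj (upper x)" by (simp add: lower_def upper_def)
  then show ?thesis by (simp add: W_cnj)
qed

lemma f_cut_limits:
  assumes x: "x > 0" and nz: "W (upper x) \<noteq> 0"
  shows "((\<lambda>\<epsilon>. f (Complex (- x) \<epsilon>)) \<longlongrightarrow> W' (upper x) / (of_real a * of_real (- x) * W (upper x)) - c) (at_right 0)"
    "((\<lambda>\<epsilon>. f (Complex (- x) (- \<epsilon>))) \<longlongrightarrow> W' (lower x) / (of_real a * of_real (- x) * W (lower x)) - c) (at_right 0)"
proof -
  have nz2: "W (lower x) \<noteq> 0" using nz by (simp add: W_lower)
  have 1: "((\<lambda>\<epsilon>. W' (Ln (Complex (- x) \<epsilon>)) / (of_real a * Complex (- x) (1 * \<epsilon>) * W (Ln (Complex (- x) \<epsilon>))) - c)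
     \<longlongrightarrow> W' (upper x) / (of_real a * of_real (- x) * W (upper x)) - c) (at_right 0)"
    by (intro tendsto_intros isCont_tendsto_compose[OF W_cont Ln_cut_limits(1)[OF x]]
        isCont_tendsto_compose[OF W'_cont Ln_cut_limits(1)[OF x]] tendsto_Complex_at_right) (use nz x a0 in auto)
  show "((\<lambda>\<epsilon>. f (Complex (- x) \<epsilon>)) \<longlongrightarrow> W' (upper x) / (of_real a * of_real (- x) * W (upper x)) - c) (at_right 0)"
    by (rule Lim_transform_eventually[OF 1], rule eventually_mono[OF eventually_at_right_less]) (simp add: f_off_axis)
  have 2: "((\<lambda>\<epsilon>. W' (Ln (Complex (- x) (- \<epsilon>))) / (of_real a * Complex (- x) ((-1) * \<epsilon>) * W (Ln (Complex (- x) (- \<epsilon>)))) - c)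
     \<longlongrightarrow> W' (lower x) / (of_real a * of_real (- x) * W (lower x)) - c) (at_right 0)"
    by (intro tendsto_intros isCont_tendsto_compose[OF W_cont Ln_cut_limits(2)[OF x]]
        isCont_tendsto_compose[OF W'_cont Ln_cut_limits(2)[OF x]] tendsto_Complex_at_right) (use nz2 x a0 in auto)
  show "((\<lambda>\<epsilon>. f (Complex (- x) (- \<epsilon>))) \<longlongrightarrow> W' (lower x) / (of_real a * of_real (- x) * W (lower x)) - c) (at_right 0)"
    by (rule Lim_transform_eventually[OF 2], rule eventually_mono[OF eventually_at_right_less]) (simp add: f_off_axis)
qed

text \<open>The additive constants of the two banks cancel, and the factor 1/z = -1/x reverses the
  order, hence lower bank minus upper bank.\<close>

definition cut_jump :: "real \<Rightarrow> complex" where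
  "cut_jump x = (W' (lower x) / W (lower x) - W' (upper x) / W (upper x)) / (of_real a * of_real x)"

lemma jump_diff_limit:
  assumes x: "x > 0" and nz: "W (upper x) \<noteq> 0"
  shows "(jump_diff f x \<longlongrightarrow> cut_jump x) (at_right 0)"
proof -
  have "((\<lambda>\<epsilon>. f (Complex (- x) \<epsilon>) - f (Complex (- x) (- \<epsilon>))) \<longlongrightarrow>
     (W' (upper x) / (of_real a * of_real (- x) * W (upper x)) - c) - (W' (lower x) / (of_real a * of_real (- x) * W (lower x)) - c)) (at_right 0)"
    by (intro tendsto_diff f_cut_limits assms)
  also have "(W' (upper x) / (of_real a * of_real (- x) * W (upper x)) - c) - (W' (lower x) / (of_real a * of_real (- x) * W (lower x)) - c)
     = cut_jump x"
    using x a0 nz by (simp add: cut_jump_def diff_divide_distrib mult_ac)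
  finally show ?thesis unfolding jump_diff_def[abs_def] .
qed

lemma jump_eq: "x > 0 \<Longrightarrow> W (upper x) \<noteq> 0 \<Longrightarrow> jump f x = cut_jump x"
  unfolding jump_def by (rule tendsto_Lim[OF _ jump_diff_limit]) (auto simp: trivial_limit_at_right_real)

text \<open>If W does not vanish at the bank point, f has a finite limit from above, whereas a
  continuation with a pole at -x tends to infinity along the same path.\<close>

lemma cut_simple_pole_imp_zero:
  assumes "cut_simple_pole f x \<rho>"
  shows "W (upper x) = 0"
proof (rule ccontr)
  assume nz: "W (upper x) \<noteq> 0"
  obtain F s where x: "x > 0" and s: "s > 0"
    and F: "\<forall>z\<in>ball (- of_real x) s \<inter> slit_plane. F z = f z" "is_pole F (- of_real x)"
    using assms unfolding cut_simple_pole_def simple_pole_at_def by auto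
  have lim: "((\<lambda>\<epsilon>. Complex (- x) (1 * \<epsilon>)) \<longlongrightarrow> of_real (- x)) (at_right 0)" by (rule tendsto_Complex_at_right)
  have fl: "filterlim (\<lambda>\<epsilon>. Complex (- x) \<epsilon>) (at (- of_real x)) (at_right 0)"
    unfolding filterlim_at using lim by (auto simp: eventually_at_filter complex_eq_iff)
  have "filterlim (\<lambda>\<epsilon>. F (Complex (- x) \<epsilon>)) at_infinity (at_right 0)"
    using F(2) fl unfolding is_pole_def by (rule filterlim_compose)
  moreover have "eventually (\<lambda>\<epsilon>. F (Complex (- x) \<epsilon>) = f (Complex (- x) \<epsilon>)) (at_right 0)"
  proof -
    have "eventually (\<lambda>\<epsilon>. dist (Complex (- x) (1 * \<epsilon>)) (of_real (- x)) < s) (at_right 0)"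
      using lim s by (rule tendstoD)
    moreover have "eventually (\<lambda>\<epsilon>::real. \<epsilon> > 0) (at_right 0)" by (rule eventually_at_right_less)
    ultimately show ?thesis
      by eventually_elim (use F(1) cut_point_in_slit in \<open>simp add: dist_commute\<close>)
  qed
  ultimately have "filterlim (\<lambda>\<epsilon>. f (Complex (- x) \<epsilon>)) at_infinity (at_right 0)"
    using filterlim_cong[OF refl refl] by force
  moreover have "at_right (0::real) \<noteq> bot" by (simp add: trivial_limit_at_right_real)
  ultimately show False
    using not_tendsto_and_filterlim_at_infinity f_cut_limits(1)[OF x nz] by blast
qed

end

section \<open>Monodromy and the poles on the cut\<close>

lemma holomorphic_on_if_has_field_derivative:
  assumes "\<And>z. z \<in> A \<Longrightarrow> (f has_field_derivative f' z) (at z)"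
  shows "f holomorphic_on A"
proof (rule holomorphic_onI)
  fix z assume "z \<in> A"
  from has_field_derivative_at_within[OF assms[OF this]]
  show "f field_differentiable (at z within A)" unfolding field_differentiable_def by (rule exI)
qed

context slit_log_derivative
begin

lemma W'_monodromy:
  assumes q: "\<And>w. W (w + 2 * of_real pi * \<i>) = q * W w"
  shows "W' (w + 2 * of_real pi * \<i>) = q * W' w"
proof (rule DERIV_unique)
  show "((\<lambda>w. W (w + 2 * of_real pi * \<i>)) has_field_derivative W' (w + 2 * of_real pi * \<i>)) (at w)"
    using dW[of "w + 2 * of_real pi * \<i>"] by (simp add: DERIV_shift)
  have "((\<lambda>w. q * W w) has_field_derivative q * W' w) (at w)" by (rule DERIV_cmult[OF dW])
  then show "((\<lambda>w. W (w + 2 * of_real pi * \<i>)) has_field_derivative q * W' w) (at w)" by (simp only: q)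
qed

lemma upper_eq_lower: "upper x = lower x + 2 * of_real pi * \<i>"
  by (simp add: upper_def lower_def algebra_simps)

text \<open>The two bank points over -x are conjugate and differ by 2 pi i, so by reflection a zero
  at one is a zero at both.\<close>

lemma monodromy_of_cut_zero:
  assumes "W (upper x) = 0"
  shows "\<exists>q. q \<noteq> 0 \<and> (\<forall>w. W (w + 2 * of_real pi * \<i>) = q * W w)"
proof (rule monodromy)
  show "W (lower x) = 0" using assms by (simp add: W_lower)
  show "W (lower x + 2 * of_real pi * \<i>) = 0" using assms by (simp add: upper_eq_lower)
qed

text \<open>A zero on the bank makes W(w + 2 pi i) a constant multiple of W(w), so W'/W is
  insensitive to the branch of the logarithm. The formula for f written with a branch that is
  holomorphic across the negative axis therefore agrees with f on both sides of the cut and is the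
  required continuation.\<close>

lemma cut_zero_imp_pole:
  assumes x: "x > 0" and zero: "W (upper x) = 0"
  shows "cut_simple_pole f x (1 / of_real a)"
proof -
  obtain m where m0: "m \<noteq> 0" and m: "\<And>w. W (w + 2 * of_real pi * \<i>) = m * W w"
    using monodromy_of_cut_zero[OF zero] by auto
  note m' = W'_monodromy[OF m]
  define H where "H = {z. Re z < 0}"
  have H: "open H" unfolding H_def by (rule open_halfspace_Re_lt)
  \<comment> \<open>This branch equals Ln z above the negative axis and Ln z + 2 pi i below
    it.\<close>
  define l where "l = (\<lambda>z. Ln (- z) + \<i> * of_real pi)"
  have dl: "(l has_field_derivative inverse z) (at z)" if "z \<in> H" for z
  proof -
    have "- z \<notin> \<real>\<^sub>\<le>\<^sub>0" using that by (auto simp: H_def complex_nonpos_Reals_iff)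
    then show ?thesis unfolding l_def
      by (auto intro!: derivative_eq_intros simp: field_simps)
  qed
  have l_hol: "l holomorphic_on A" if "A \<subseteq> H" for A
    by (rule holomorphic_on_if_has_field_derivative[OF dl]) (use that in blast)
  have Wl_hol: "(\<lambda>z. W (l z)) holomorphic_on A" "(\<lambda>z. W' (l z)) holomorphic_on A" if "A \<subseteq> H" for A
    using holomorphic_on_compose[OF l_hol W_hol] holomorphic_on_compose[OF l_hol W'_hol] that by (simp_all add: o_def)
  define p where "p = (\<lambda>z. W' (l z) - c * (of_real a * z * W (l z)))"
  define q where "q = (\<lambda>z. of_real a * z * W (l z))"
  define F where "F = (\<lambda>z. p z / q z)"
  define y where "y = - complex_of_real x"
  have y: "y \<in> H" "y \<noteq> 0" using x by (auto simp: y_def H_def)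
  have ly: "l y = upper x" using x by (simp add: l_def y_def upper_def Ln_of_real)
  have hol: "p holomorphic_on H" "q holomorphic_on H"
    unfolding p_def q_def by (intro holomorphic_intros Wl_hol order_refl)+
  have "((\<lambda>z. W (l z)) has_field_derivative W' (l y) * inverse y) (at y)"
    by (rule DERIV_chain'[OF dl[OF y(1)] dW, THEN DERIV_cong]) simp
  then have "(q has_field_derivative (of_real a * y) * (W' (l y) * inverse y) + of_real a * W (l y)) (at y)"
    unfolding q_def by (auto intro!: derivative_eq_intros)
  then have q': "(q has_field_derivative of_real a * W' (upper x)) (at y)"
    by (rule DERIV_cong) (use y zero in \<open>simp add: ly field_simps\<close>)
  have nz: "W' (upper x) \<noteq> 0" by (rule simple_zero[OF zero])
  have q'0: "of_real a * W' (upper x) \<noteq> 0" using nz a0 by simp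
  have qy: "q y = 0" and py: "p y = W' (upper x)" by (simp_all add: p_def q_def ly zero)
  have py0: "p y \<noteq> 0" using nz py by simp
  have Fq: "F z = p z / q z" for z by (simp add: F_def)
  have pole: "simple_pole_at F y"
    by (rule simple_pole_quotient(1)[OF hol H y(1) q' q'0 qy py0 Fq])
  have "residue F y = p y / (of_real a * W' (upper x))"
    by (rule simple_pole_quotient(2)[OF hol H y(1) q' q'0 qy py0 Fq])
  then have res: "residue F y = 1 / of_real a" using nz by (simp add: py)
  have "eventually (\<lambda>z. q z \<noteq> 0) (at y)"
    by (rule nonzero_near_simple_zero[OF q' qy q'0])
  then obtain d where d: "d > 0" "\<forall>z. z \<noteq> y \<and> dist z y < d \<longrightarrow> q z \<noteq> 0"
    unfolding eventually_at by auto
  \<comment> \<open>Keeps the disc inside the left half-plane and free of further zeros of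
    q.\<close>
  define s where "s = min d x"
  have s: "s > 0" using d x by (simp add: s_def)
  have ballH: "z \<in> H" if "z \<in> ball y s" for z
  proof -
    have "\<bar>Re (z - y)\<bar> < x" using abs_Re_le_cmod[of "z - y"] that by (simp add: s_def dist_norm norm_minus_commute)
    then show ?thesis by (simp add: H_def y_def)
  qed
  have "F holomorphic_on ball y s - {y}"
    unfolding F_def
  proof (rule holomorphic_on_divide)
    show "p holomorphic_on ball y s - {y}" by (rule holomorphic_on_subset[OF hol(1)]) (use ballH in auto)
    show "q holomorphic_on ball y s - {y}" by (rule holomorphic_on_subset[OF hol(2)]) (use ballH in auto)
    show "q z \<noteq> 0" if "z \<in> ball y s - {y}" for z
      using d(2)[rule_format, of z] that by (simp add: s_def dist_commute)
  qed
  moreover have "F z = f z" if z: "z \<in> ball y s \<inter> slit_plane" for z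
  proof -
    have Re: "Re z < 0" using ballH z by (auto simp: H_def)
    have Im: "Im z \<noteq> 0" using z Re by (auto simp: complex_nonpos_Reals_iff)
    have z0: "z \<noteq> 0" using Re by auto
    have ratio: "W' (l z) / W (l z) = W' (Ln z) / W (Ln z) \<and> (W (l z) = 0 \<longleftrightarrow> W (Ln z) = 0)"
    proof (cases "Im z > 0")
      case True
      have "Ln (- (- z)) = Ln (- z) + \<i> * pi" using Ln_minus[of "- z"] z0 True by simp
      then show ?thesis by (simp add: l_def)
    next
      case False
      then have "Im z < 0" using Im by simp
      then have "Ln (- (- z)) = Ln (- z) - \<i> * pi" using Ln_minus[of "- z"] z0 by simp
      then have "l z = Ln z + 2 * of_real pi * \<i>" by (simp add: l_def algebra_simps)
      then have "W (l z) = m * W (Ln z)" "W' (l z) = m * W' (Ln z)" by (simp_all only: m m')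
      then show ?thesis using m0 by simp
    qed
    show ?thesis
    proof (cases "z = y")
      case True
      then have False using z by (simp add: y_def complex_nonpos_Reals_iff x less_imp_le)
      then show ?thesis ..
    next
      case False
      then have "q z \<noteq> 0" using d(2)[rule_format, of z] z by (simp add: s_def dist_commute)
      then have Wl: "W (l z) \<noteq> 0" by (auto simp: q_def)
      have "F z = W' (l z) / W (l z) / (of_real a * z) - c"
        using Wl a0 z0 by (simp add: F_def p_def q_def diff_divide_distrib mult.commute)
      also have "\<dots> = f z" using ratio z by (simp add: f_eq mult.commute)
      finally show ?thesis .
    qed
  qed
  ultimately show ?thesis
    unfolding cut_simple_pole_def y_def[symmetric] using x s pole res by (intro conjI exI[of _ F] exI[of _ s]) auto
qed

text \<open>Makes the description in \<open>cut_residue\<close> meaningful: two continuations agree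
  off the cut, hence by continuity on the punctured disc, and so have the same residue.\<close>

lemma cut_simple_pole_unique:
  assumes "cut_simple_pole f x \<rho>1" "cut_simple_pole f x \<rho>2"
  shows "\<rho>1 = \<rho>2"
proof -
  define y where "y = - complex_of_real x"
  obtain F1 s1 where x: "x > 0" and 1: "s1 > 0" "F1 holomorphic_on ball y s1 - {y}"
    "\<forall>z\<in>ball y s1 \<inter> slit_plane. F1 z = f z" "residue F1 y = \<rho>1"
    using assms(1) unfolding cut_simple_pole_def y_def by auto
  obtain F2 s2 where 2: "s2 > 0" "F2 holomorphic_on ball y s2 - {y}"
    "\<forall>z\<in>ball y s2 \<inter> slit_plane. F2 z = f z" "residue F2 y = \<rho>2"
    using assms(2) unfolding cut_simple_pole_def y_def by auto
  define s where "s = min s1 s2"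
  have s: "s > 0" using 1 2 by (simp add: s_def)
  define B where "B = ball y s - {y}"
  have B: "open B" unfolding B_def by (intro open_delete open_ball)
  define D where "D = (\<lambda>z. F1 z - F2 z)"
  have "D holomorphic_on B" unfolding D_def
    by (intro holomorphic_on_diff holomorphic_on_subset[OF 1(2)] holomorphic_on_subset[OF 2(2)]) (auto simp: B_def s_def)
  then have cont: "isCont D z" if "z \<in> B" for z
    using that B holomorphic_on_imp_continuous_on continuous_on_eq_continuous_at by blast
  have D0: "D z = 0" if "z \<in> B" "z \<in> slit_plane" for z
    using that 1(3) 2(3) by (simp add: D_def B_def s_def)
  have "F1 z = F2 z" if z: "z \<in> B" for z
  proof (cases "z \<in> slit_plane")
    case True
    then show ?thesis using D0[OF z] by (simp add: D_def)
  next
    case False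
    then have "Im z = 0" by (simp add: complex_nonpos_Reals_iff)
    then have z': "of_real (Re z) = z" by (simp add: complex_eq_iff)
    have lim: "((\<lambda>\<epsilon>. Complex (Re z) (1 * \<epsilon>)) \<longlongrightarrow> z) (at_right 0)"
      using tendsto_Complex_at_right[of "Re z" 1] unfolding z' .
    have limD: "((\<lambda>\<epsilon>. D (Complex (Re z) (1 * \<epsilon>))) \<longlongrightarrow> D z) (at_right 0)"
      by (rule isCont_tendsto_compose[OF cont[OF z] lim])
    have "eventually (\<lambda>\<epsilon>. Complex (Re z) (1 * \<epsilon>) \<in> B) (at_right 0)"
      by (rule topological_tendstoD[OF lim B z])
    moreover have "eventually (\<lambda>\<epsilon>::real. 0 < \<epsilon>) (at_right 0)" by (rule eventually_at_right_less)
    ultimately have "eventually (\<lambda>\<epsilon>. D (Complex (Re z) (1 * \<epsilon>)) = 0) (at_right 0)"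
      by eventually_elim (rule D0, assumption, rule cut_point_in_slit, simp)
    then have "((\<lambda>\<epsilon>::real. 0) \<longlongrightarrow> D z) (at_right 0)"
      by (rule Lim_transform_eventually[OF limD])
    then have "D z = 0" by (simp add: tendsto_const_iff trivial_limit_at_right_real)
    then show ?thesis by (simp add: D_def)
  qed
  moreover have "eventually (\<lambda>z. z \<in> B) (at y)"
    unfolding B_def using eventually_at_in_open[of "ball y s" y] s by simp
  ultimately have "eventually (\<lambda>z. F1 z = F2 z) (at y)" by (auto elim: eventually_mono)
  then have "residue F1 y = residue F2 y" by (rule residue_cong) simp
  then show ?thesis using 1(4) 2(4) by simp
qed

lemma cut_poles_eq: "cut_poles f = {x. x > 0 \<and> W (upper x) = 0}"
proof (intro set_eqI iffI)
  fix x assume "x \<in> cut_poles f"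
  then obtain \<rho> where \<rho>: "cut_simple_pole f x \<rho>" by (auto simp: cut_poles_def)
  then have "x > 0" by (simp add: cut_simple_pole_def)
  then show "x \<in> {x. x > 0 \<and> W (upper x) = 0}" using cut_simple_pole_imp_zero[OF \<rho>] by simp
next
  fix x assume "x \<in> {x. x > 0 \<and> W (upper x) = 0}"
  then have "cut_simple_pole f x (1 / of_real a)" by (intro cut_zero_imp_pole) auto
  then show "x \<in> cut_poles f" by (auto simp: cut_poles_def)
qed

lemma cut_residue_eq:
  assumes "x \<in> cut_poles f"
  shows "cut_residue f x = 1 / of_real a"
proof -
  have "x > 0" "W (upper x) = 0" using assms by (auto simp: cut_poles_eq)
  then have pole: "cut_simple_pole f x (1 / of_real a)" by (rule cut_zero_imp_pole)
  show ?thesis unfolding cut_residue_def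
    by (rule the_equality[where P = "cut_simple_pole f x", OF pole]) (rule cut_simple_pole_unique[OF _ pole])
qed

lemma Im_upper [simp]: "Im (upper x) = pi" and Im_lower [simp]: "Im (lower x) = - pi"
  and Re_upper [simp]: "Re (upper x) = ln x" and Re_lower [simp]: "Re (lower x) = ln x"
  by (simp_all add: upper_def lower_def)

lemma exp_upper: "x > 0 \<Longrightarrow> exp (upper x) = - of_real x"
  and exp_lower: "x > 0 \<Longrightarrow> exp (lower x) = - of_real x"
  by (simp_all add: upper_def lower_def exp_add exp_diff exp_of_real mult.commute[of \<i>])

lemma upper_zeros: "{w\<in>zeros. Im w = pi} = upper ` cut_poles f"
proof (intro set_eqI iffI)
  fix w assume w: "w \<in> {w\<in>zeros. Im w = pi}"
  have "w = upper (exp (Re w))" using w by (simp add: complex_eq_iff)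
  moreover have "exp (Re w) \<in> cut_poles f"
    using w unfolding cut_poles_eq by (simp add: zeros_def flip: \<open>w = upper (exp (Re w))\<close>)
  ultimately show "w \<in> upper ` cut_poles f" by (rule image_eqI)
next
  fix w assume "w \<in> upper ` cut_poles f"
  then show "w \<in> {w\<in>zeros. Im w = pi}" using Im_bound[of pi] by (auto simp: cut_poles_eq zeros_def)
qed

lemma inj_on_upper: "inj_on upper (cut_poles f)"
proof (rule inj_onI)
  fix x y assume xy: "x \<in> cut_poles f" "y \<in> cut_poles f" "upper x = upper y"
  have "ln x = ln y" using arg_cong[OF xy(3), of Re] by simp
  then show "x = y" using xy(1,2) by (simp add: cut_poles_eq)
qed

lemma finite_cut_poles: "finite (cut_poles f)"
proof -
  have "finite (upper ` cut_poles f)" unfolding upper_zeros[symmetric] using finite_zeros by simp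
  then show ?thesis using inj_on_upper by (rule finite_imageD)
qed

section \<open>The rectangle contour in the logarithmic plane\<close>

text \<open>G dw is the pull-back of a z^m (f(z) + c) dz under z = e^w.\<close>

definition G :: "nat \<Rightarrow> complex \<Rightarrow> complex" where
  "G m w = exp w ^ m * W' w / W w"

lemma G_cont: "(\<And>w. w \<in> A \<Longrightarrow> W w \<noteq> 0) \<Longrightarrow> continuous_on A (G m)"
  unfolding G_def
  by (intro continuous_intros holomorphic_on_imp_continuous_on W_hol W'_hol) auto

lemma contour_integral_horizontal:
  fixes h :: "complex \<Rightarrow> complex"
  assumes AB: "A \<le> B" and cont: "continuous_on (closed_segment (Complex A t) (Complex B t)) h"
  shows "contour_integral (linepath (Complex A t) (Complex B t)) h = integral {A..B} (\<lambda>u. h (Complex u t))"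
proof -
  have img: "Complex u t \<in> closed_segment (Complex A t) (Complex B t)" if "u \<in> {A..B}" for u
    using that by (auto simp: closed_segment_same_Im closed_segment_eq_real_ivl)
  have "continuous_on {A..B} (\<lambda>u. Complex u t)" unfolding Complex_eq by (intro continuous_intros)
  then have ch: "continuous_on {A..B} (\<lambda>u. h (Complex u t))"
    by (rule continuous_on_compose2[OF cont]) (use img in auto)
  have "((\<lambda>x. (B - A) *\<^sub>R h (Complex (A + x * (B - A)) t)) has_integral
      integral {A + 0 * (B - A)..A + 1 * (B - A)} (\<lambda>u. h (Complex u t))) {0..1}"
  proof (rule has_integral_substitution[where c = A and d = B])
    show "(\<lambda>x. A + x * (B - A)) ` {0..1} \<subseteq> {A..B}"
    proof (clarsimp, intro conjI)
      fix x :: real assume x: "0 \<le> x" "x \<le> 1"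
      show "0 \<le> x * (B - A)" using x AB by simp
      have "x * (B - A) \<le> 1 * (B - A)" using x AB by (intro mult_right_mono) auto
      then show "A + x * (B - A) \<le> B" by simp
    qed
  qed (use AB ch in \<open>auto intro!: derivative_eq_intros\<close>)
  moreover have "h (linepath (Complex A t) (Complex B t) x) * (Complex B t - Complex A t)
      = (B - A) *\<^sub>R h (Complex (A + x * (B - A)) t)" for x
  proof -
    have "linepath (Complex A t) (Complex B t) x = Complex (A + x * (B - A)) t"
      by (simp add: linepath_def complex_eq_iff algebra_simps)
    moreover have "Complex B t - Complex A t = of_real (B - A)" by (simp add: complex_eq_iff)
    ultimately show ?thesis by (simp add: scaleR_conv_of_real mult.commute)
  qed
  ultimately have "(h has_contour_integral integral {A..B} (\<lambda>u. h (Complex u t))) (linepath (Complex A t) (Complex B t))"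
    unfolding has_contour_integral_linepath by simp
  then show ?thesis by (rule contour_integral_unique)
qed

lemma residue_G:
  assumes "W w = 0"
  shows "residue (G m) w = exp w ^ m"
proof -
  have "residue (\<lambda>w. (exp w ^ m * W' w) / W w) w = (exp w ^ m * W' w) / W' w"
    by (rule residue_simple_pole_deriv[of _ UNIV])
       (use assms simple_zero[OF assms] in \<open>auto intro!: holomorphic_intros W_hol W'_hol dW\<close>)
  then show ?thesis using simple_zero[OF assms] by (simp add: G_def[abs_def])
qed

text \<open>The residue theorem on a positively oriented rectangle. The bottom is traversed to the
  right and the top to the left, so bottom minus top is isolated on the left-hand side; by
  \<open>residue_G\<close> each zero w contributes e^(mw).\<close>

lemma rectangle_identity:
  assumes AB: "A < B" and t: "t0 < t1"
    and vert: "\<And>t. t0 \<le> t \<Longrightarrow> t \<le> t1 \<Longrightarrow> W (Complex A t) \<noteq> 0 \<and> W (Complex B t) \<noteq> 0"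
    and hor: "\<And>u. A \<le> u \<Longrightarrow> u \<le> B \<Longrightarrow> W (Complex u t0) \<noteq> 0 \<and> W (Complex u t1) \<noteq> 0"
  shows "integral {A..B} (\<lambda>u. G m (Complex u t0) - G m (Complex u t1))
     = 2 * of_real pi * \<i> * (\<Sum>w\<in>{w. W w = 0 \<and> A < Re w \<and> Re w < B \<and> t0 < Im w \<and> Im w < t1}. exp w ^ m)
       - contour_integral (linepath (Complex B t0) (Complex B t1)) (G m)
       + contour_integral (linepath (Complex A t0) (Complex A t1)) (G m)"
proof -
  define p1 p2 p3 p4 where "p1 = Complex A t0" and "p2 = Complex B t0" and "p3 = Complex B t1" and "p4 = Complex A t1"
  note pd = p1_def p2_def p3_def p4_def
  define Z where "Z = {w. W w = 0 \<and> A < Re w \<and> Re w < B \<and> t0 < Im w \<and> Im w < t1}"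
  have seg: "W w \<noteq> 0" if "w \<in> closed_segment p1 p2 \<union> closed_segment p2 p3 \<union> closed_segment p3 p4 \<union> closed_segment p4 p1" for w
  proof -
    have "(A \<le> Re w \<and> Re w \<le> B \<and> (Im w = t0 \<or> Im w = t1)) \<or> ((Re w = A \<or> Re w = B) \<and> t0 \<le> Im w \<and> Im w \<le> t1)"
      using that AB t unfolding pd
      by (auto simp: closed_segment_same_Im closed_segment_same_Re closed_segment_eq_real_ivl split: if_splits)
    then show ?thesis using vert[of "Im w"] hor[of "Re w"] by (auto simp: complex.collapse)
  qed
  have cont: "continuous_on (closed_segment p1 p2) (G m)" "continuous_on (closed_segment p2 p3) (G m)"
    "continuous_on (closed_segment p3 p4) (G m)" "continuous_on (closed_segment p4 p1) (G m)"
    by (rule G_cont, rule seg, blast)+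
  note ci = cont[THEN contour_integrable_continuous_linepath]
  define g where "g = rectpath p1 p3"
  have geq: "g = linepath p1 p2 +++ linepath p2 p3 +++ linepath p3 p4 +++ linepath p4 p1"
    unfolding g_def rectpath_def Let_def pd by simp
  have sides: "contour_integral g (G m) = contour_integral (linepath p1 p2) (G m) + (contour_integral (linepath p2 p3) (G m)
      + (contour_integral (linepath p3 p4) (G m) + contour_integral (linepath p4 p1) (G m)))"
    unfolding geq using ci by (simp add: contour_integrable_joinI)
  have r34: "contour_integral (linepath p3 p4) (G m) = - contour_integral (linepath p4 p3) (G m)"
    by (rule contour_integral_reverse_linepath[OF cont(3)])
  have r41: "contour_integral (linepath p4 p1) (G m) = - contour_integral (linepath p1 p4) (G m)"
    by (rule contour_integral_reverse_linepath[OF cont(4)])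
  have h12: "contour_integral (linepath p1 p2) (G m) = integral {A..B} (\<lambda>u. G m (Complex u t0))"
    unfolding pd by (rule contour_integral_horizontal) (use AB cont(1) in \<open>auto simp: pd\<close>)
  have h43: "contour_integral (linepath p4 p3) (G m) = integral {A..B} (\<lambda>u. G m (Complex u t1))"
    unfolding pd by (rule contour_integral_horizontal) (use AB cont(3) in \<open>auto simp: pd closed_segment_commute\<close>)
  have hdiff: "integral {A..B} (\<lambda>u. G m (Complex u t0) - G m (Complex u t1))
      = integral {A..B} (\<lambda>u. G m (Complex u t0)) - integral {A..B} (\<lambda>u. G m (Complex u t1))"
  proof (rule Henstock_Kurzweil_Integration.integral_diff; rule integrable_continuous_interval)
    have c: "continuous_on {A..B} (\<lambda>u. Complex u t)" for t unfolding Complex_eq by (intro continuous_intros)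
    show "continuous_on {A..B} (\<lambda>u. G m (Complex u t0))"
      by (rule continuous_on_compose2[OF G_cont[of "{w. Im w = t0 \<and> A \<le> Re w \<and> Re w \<le> B}"] c])
        (use hor complex.collapse in \<open>auto, metis\<close>)
    show "continuous_on {A..B} (\<lambda>u. G m (Complex u t1))"
      by (rule continuous_on_compose2[OF G_cont[of "{w. Im w = t1 \<and> A \<le> Re w \<and> Re w \<le> B}"] c])
        (use hor complex.collapse in \<open>auto, metis\<close>)
  qed
  have res: "contour_integral g (G m) = 2 * of_real pi * \<i> * (\<Sum>w\<in>Z. exp w ^ m)"
  proof -
    \<comment> \<open>An open neighbourhood of the closed rectangle. It may contain zeros outside
      the rectangle, whose winding number is 0.\<close>
    define S where "S = box (Complex (A - 1) (t0 - 1)) (Complex (B + 1) (t1 + 1))"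
    define P where "P = {w\<in>S. W w = 0}"
    have finP: "finite P"
    proof (rule finite_subset)
      show "P \<subseteq> {w\<in>cbox (Complex (A - 1) (t0 - 1)) (Complex (B + 1) (t1 + 1)). W w = 0}"
        using box_subset_cbox unfolding P_def S_def by blast
    qed (rule finite_zeros_compact[OF compact_cbox])
    have le: "Re p1 \<le> Re p3" "Im p1 \<le> Im p3" using AB t by (auto simp: pd)
    have image: "path_image g \<subseteq> cbox p1 p3" unfolding g_def by (rule path_image_rectpath_subset_cbox[OF le])
    have cS: "cbox p1 p3 \<subseteq> S" by (auto simp: S_def pd in_cbox_complex_iff in_box_complex_iff)
    have pnz: "W w \<noteq> 0" if "w \<in> path_image g" for w
      using that seg unfolding geq by (simp add: path_image_join)
    have "contour_integral g (G m) = 2 * pi * \<i> * (\<Sum>p\<in>P. winding_number g p * residue (G m) p)"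
    proof (rule Residue_theorem)
      show "open S" "connected S" unfolding S_def by (auto intro: convex_connected)
      show "G m holomorphic_on S - P"
        unfolding G_def[abs_def] by (intro holomorphic_intros W_hol W'_hol) (auto simp: P_def)
      show "path_image g \<subseteq> S - P" using image cS pnz by (auto simp: P_def)
      show "\<forall>z. z \<notin> S \<longrightarrow> winding_number g z = 0"
        unfolding g_def using winding_number_rectpath_outside[OF le] cS by blast
      show "valid_path g" "pathfinish g = pathstart g" by (simp_all add: g_def)
    qed (rule finP)
    also have "(\<Sum>p\<in>P. winding_number g p * residue (G m) p) = (\<Sum>p\<in>Z. exp p ^ m)"
    proof (rule sum.mono_neutral_cong_right[OF finP])
      show "Z \<subseteq> P" by (auto simp: Z_def P_def S_def in_box_complex_iff)
      show "\<forall>p\<in>P - Z. winding_number g p * residue (G m) p = 0"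
      proof
        fix p assume p: "p \<in> P - Z"
        have "p \<notin> box p1 p3" using p by (auto simp: Z_def P_def pd in_box_complex_iff)
        moreover have "p \<notin> path_image g" using p pnz by (auto simp: P_def)
        ultimately have "p \<notin> cbox p1 p3" unfolding g_def path_image_rectpath_cbox_minus_box[OF le] by blast
        then show "winding_number g p * residue (G m) p = 0"
          unfolding g_def using winding_number_rectpath_outside[OF le] by simp
      qed
      show "winding_number g p * residue (G m) p = exp p ^ m" if "p \<in> Z" for p
      proof -
        have "p \<in> box p1 p3" "W p = 0" using that by (auto simp: Z_def pd in_box_complex_iff)
        then show ?thesis unfolding g_def using winding_number_rectpath[of p p1 p3] residue_G[of p m] by simp
      qed
    qed
    finally show ?thesis by simp
  qed
  have "integral {A..B} (\<lambda>u. G m (Complex u t0) - G m (Complex u t1))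
     = contour_integral g (G m) - contour_integral (linepath p2 p3) (G m) + contour_integral (linepath p1 p4) (G m)"
    unfolding hdiff sides r34 r41 h12 h43 by simp
  then show ?thesis unfolding res Z_def pd .
qed


lemma exp_power_primitive:
  "((\<lambda>w. exp w ^ j / of_nat j) has_field_derivative exp w ^ j) (at w within A)" if "j > 0" for j :: nat and w :: complex
proof -
  have "((\<lambda>w. exp (of_nat j * w) / of_nat j) has_field_derivative exp (of_nat j * w)) (at w within A)"
    using that by (auto intro!: derivative_eq_intros)
  then show ?thesis by (simp only: exp_of_nat_mult)
qed

lemma vertical_diff:
  assumes "t1 = t0 + 2 * pi"
  shows "Complex B t1 - Complex B t0 = 2 * of_real pi * \<i>" "norm (Complex B t1 - Complex B t0) = 2 * pi"
proof -
  show eq: "Complex B t1 - Complex B t0 = 2 * of_real pi * \<i>"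
    unfolding assms by (simp add: complex_eq_iff)
  show "norm (Complex B t1 - Complex B t0) = 2 * pi"
    unfolding eq by (simp add: norm_mult)
qed

text \<open>Over one period 2 pi i every positive power of e^w integrates to 0; only the constant
  term, n = m, survives. This is how a single coefficient is picked out.\<close>

lemma contour_vertical_period:
  assumes "t1 = t0 + 2 * pi"
  shows "((\<lambda>w. \<Sum>n<Suc m. \<eta> n * exp w ^ (m - n)) has_contour_integral 2 * of_real pi * \<i> * \<eta> m)
           (linepath (Complex B t0) (Complex B t1))"
proof -
  define Q where "Q = (\<lambda>w. (\<Sum>n<m. \<eta> n * (exp w ^ (m - n) / of_nat (m - n))) + \<eta> m * w)"
  have dQ: "(Q has_field_derivative (\<Sum>n<Suc m. \<eta> n * exp w ^ (m - n))) (at w within UNIV)" for w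
  proof -
    have "((\<lambda>w. \<Sum>n<m. \<eta> n * (exp w ^ (m - n) / of_nat (m - n))) has_field_derivative (\<Sum>n<m. \<eta> n * exp w ^ (m - n))) (at w)"
      by (intro DERIV_sum DERIV_cmult exp_power_primitive) auto
    moreover have "((\<lambda>w. \<eta> m * w) has_field_derivative \<eta> m) (at w)"
      by (auto intro!: derivative_eq_intros)
    ultimately show ?thesis unfolding Q_def by (auto intro: DERIV_add)
  qed
  have "((\<lambda>w. \<Sum>n<Suc m. \<eta> n * exp w ^ (m - n)) has_contour_integral
     (Q (pathfinish (linepath (Complex B t0) (Complex B t1))) - Q (pathstart (linepath (Complex B t0) (Complex B t1)))))
       (linepath (Complex B t0) (Complex B t1))"
    by (rule contour_integral_primitive[OF dQ]) auto
  moreover have "Q (Complex B t1) - Q (Complex B t0) = 2 * of_real pi * \<i> * \<eta> m"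
  proof -
    have "Complex B t1 = Complex B t0 + 2 * of_real pi * \<i>"
      using vertical_diff(1)[OF assms, of B] by (simp only: diff_eq_eq add.commute)
    then have per: "exp (Complex B t1) = exp (Complex B t0)" by (simp only: exp_shift_2pi_i)
    have "Q (Complex B t1) - Q (Complex B t0) = \<eta> m * (Complex B t1 - Complex B t0)"
      unfolding Q_def per by (simp only: add_diff_cancel_left right_diff_distrib)
    then show ?thesis unfolding vertical_diff(1)[OF assms] by (simp only: mult.commute)
  qed
  ultimately show ?thesis by simp
qed

lemma vertical_segment:
  assumes "w \<in> closed_segment (Complex B t0) (Complex B t1)" "t0 \<le> t1"
  shows "Re w = B" "t0 \<le> Im w" "Im w \<le> t1"
  using assms by (auto simp: closed_segment_same_Re closed_segment_eq_real_ivl split: if_splits)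

text \<open>Truncating after m + 1 terms leaves an error of order e^(-(m+1)B), which beats the
  weight e^(mB) by e^(-B).\<close>

lemma right_edge_limit:
  assumes t: "t1 = t0 + 2 * pi" "- (10/3) \<le> t0" "t1 \<le> 10/3"
  shows "((\<lambda>B. contour_integral (linepath (Complex B t0) (Complex B t1)) (G m)) \<longlongrightarrow> 2 * of_real pi * \<i> * \<eta> m) at_top"
proof -
  have t01: "t0 \<le> t1" using t by simp
  obtain K L where KL: "\<forall>w. Re w \<ge> L \<longrightarrow> \<bar>Im w\<bar> \<le> 10/3 \<longrightarrow> W w \<noteq> 0 \<and>
        norm (W' w / W w - (\<Sum>n<Suc m. \<eta> n * exp (- w) ^ n)) \<le> K * exp (- Re w) ^ Suc m"
    using expansion[of "Suc m"] by (elim exE) (rule that)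
  let ?P = "\<lambda>w. \<Sum>n<Suc m. \<eta> n * exp w ^ (m - n)"
  have bound: "norm (contour_integral (linepath (Complex B t0) (Complex B t1)) (G m) - 2 * of_real pi * \<i> * \<eta> m)
      \<le> \<bar>K\<bar> * exp (- B) * (2 * pi)" if B: "B \<ge> L" for B
  proof -
    define S where "S = closed_segment (Complex B t0) (Complex B t1)"
    have S: "Re w = B" "\<bar>Im w\<bar> \<le> 10/3" if "w \<in> S" for w
      using vertical_segment[OF that[unfolded S_def] t01] t by auto
    have nz: "W w \<noteq> 0" if "w \<in> S" for w
      using KL[rule_format, of w] S[OF that] B by simp
    have "G m contour_integrable_on linepath (Complex B t0) (Complex B t1)"
      by (rule contour_integrable_continuous_linepath, rule G_cont) (use nz in \<open>simp add: S_def\<close>)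
    then have d: "((\<lambda>w. G m w - ?P w) has_contour_integral
        contour_integral (linepath (Complex B t0) (Complex B t1)) (G m) - 2 * of_real pi * \<i> * \<eta> m)
        (linepath (Complex B t0) (Complex B t1))"
      by (intro has_contour_integral_diff contour_vertical_period t) (rule has_contour_integral_integral)
    have "norm (contour_integral (linepath (Complex B t0) (Complex B t1)) (G m) - 2 * of_real pi * \<i> * \<eta> m)
       \<le> \<bar>K\<bar> * exp (- B) * norm (Complex B t1 - Complex B t0)"
    proof (rule has_contour_integral_bound_linepath[OF d])
      fix w assume w: "w \<in> closed_segment (Complex B t0) (Complex B t1)"
      note Sw = S[unfolded S_def, OF w]
      have "?P w = exp w ^ m * (\<Sum>n<Suc m. \<eta> n * exp (- w) ^ n)"
        unfolding sum_distrib_left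
      proof (rule sum.cong[OF refl])
        fix n assume "n \<in> {..<Suc m}"
        then have "m = (m - n) + n" by simp
        then have "exp w ^ m = exp w ^ (m - n) * exp w ^ n" by (metis power_add)
        moreover have "exp w ^ n * exp (- w) ^ n = 1"
          unfolding power_mult_distrib[symmetric] exp_minus_inverse by simp
        ultimately show "\<eta> n * exp w ^ (m - n) = exp w ^ m * (\<eta> n * exp (- w) ^ n)"
          by (simp add: mult.assoc mult.left_commute)
      qed
      then have "G m w - ?P w = exp w ^ m * (W' w / W w - (\<Sum>n<Suc m. \<eta> n * exp (- w) ^ n))"
        by (simp add: G_def right_diff_distrib)
      then have "norm (G m w - ?P w) = exp B ^ m * norm (W' w / W w - (\<Sum>n<Suc m. \<eta> n * exp (- w) ^ n))"
        using Sw by (simp add: norm_mult norm_power)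
      also have "\<dots> \<le> exp B ^ m * (\<bar>K\<bar> * exp (- B) ^ Suc m)"
      proof (rule mult_left_mono)
        have "norm (W' w / W w - (\<Sum>n<Suc m. \<eta> n * exp (- w) ^ n)) \<le> K * exp (- B) ^ Suc m"
          using KL[rule_format, of w] Sw B by simp
        also have "\<dots> \<le> \<bar>K\<bar> * exp (- B) ^ Suc m" by (intro mult_right_mono) auto
        finally show "norm (W' w / W w - (\<Sum>n<Suc m. \<eta> n * exp (- w) ^ n)) \<le> \<bar>K\<bar> * exp (- B) ^ Suc m" .
      qed simp
      also have "\<dots> = \<bar>K\<bar> * exp (- B) * (exp B * exp (- B)) ^ m" by (simp add: power_mult_distrib)
      also have "\<dots> = \<bar>K\<bar> * exp (- B)" by (simp flip: exp_add)
      finally show "norm (G m w - ?P w) \<le> \<bar>K\<bar> * exp (- B)" .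
    qed simp
    also have "norm (Complex B t1 - Complex B t0) = 2 * pi" by (rule vertical_diff[OF t(1)])
    finally show ?thesis .
  qed
  have lim: "((\<lambda>B. \<bar>K\<bar> * exp (- B) * (2 * pi)) \<longlongrightarrow> 0) at_top" by real_asymp
  have "((\<lambda>B. contour_integral (linepath (Complex B t0) (Complex B t1)) (G m) - 2 * of_real pi * \<i> * \<eta> m) \<longlongrightarrow> 0) at_top"
    by (rule Lim_null_comparison[OF _ lim]) (rule eventually_mono[OF eventually_ge_at_top[of L]], rule bound)
  then show ?thesis by (rule LIM_zero_cancel)
qed

text \<open>On the left edge W'/W tends to r uniformly, and the weight e^(mw) tends to 0 unless m =
  0; hence the factor 0^m. This edge produces the contribution of the origin.\<close>

lemma left_edge_limit:
  assumes t: "t1 = t0 + 2 * pi" "- (10/3) \<le> t0" "t1 \<le> 10/3"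
  shows "((\<lambda>A. contour_integral (linepath (Complex A t0) (Complex A t1)) (G m)) \<longlongrightarrow> 2 * of_real pi * \<i> * (r * 0 ^ m)) at_bot"
proof (rule tendstoI)
  fix e :: real assume e: "e > 0"
  have t01: "t0 \<le> t1" using t by simp
  define e' where "e' = e / (4 * pi)"
  have e': "e' > 0" using e by (simp add: e'_def)
  have "((\<lambda>w. exp w ^ m * (W' w / W w)) \<longlongrightarrow> 0 ^ m * r) left_end"
    by (intro tendsto_intros tendsto_exp_left_end left_lim)
  then have "(G m \<longlongrightarrow> r * 0 ^ m) left_end" by (simp add: G_def[abs_def] mult.commute)
  from tendstoD[OF this e']
  obtain l where l: "\<forall>w. Re w \<le> l \<longrightarrow> \<bar>Im w\<bar> \<le> 4 \<longrightarrow> dist (G m w) (r * 0 ^ m) < e'"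
    unfolding eventually_left_end ..
  obtain l' where l': "\<forall>w. Re w \<le> l' \<longrightarrow> \<bar>Im w\<bar> \<le> 4 \<longrightarrow> W w \<noteq> 0" using left_nz' ..
  have main: "dist (contour_integral (linepath (Complex A t0) (Complex A t1)) (G m)) (2 * of_real pi * \<i> * (r * 0 ^ m)) < e"
    if A: "A \<le> min l l'" for A
  proof -
    define S where "S = closed_segment (Complex A t0) (Complex A t1)"
    have S: "Re w = A" "\<bar>Im w\<bar> \<le> 4" if "w \<in> S" for w
      using vertical_segment[OF that[unfolded S_def] t01] t by auto
    have nz: "W w \<noteq> 0" if "w \<in> S" for w
      using l'[rule_format, of w] S[OF that] A by simp
    have "G m contour_integrable_on linepath (Complex A t0) (Complex A t1)"
      by (rule contour_integrable_continuous_linepath, rule G_cont) (use nz in \<open>simp add: S_def\<close>)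
    moreover have "((\<lambda>w. r * 0 ^ m) has_contour_integral (r * 0 ^ m) * (Complex A t1 - Complex A t0)) (linepath (Complex A t0) (Complex A t1))"
      by (rule has_contour_integral_const_linepath)
    ultimately have d: "((\<lambda>w. G m w - r * 0 ^ m) has_contour_integral
        contour_integral (linepath (Complex A t0) (Complex A t1)) (G m) - (r * 0 ^ m) * (2 * of_real pi * \<i>))
        (linepath (Complex A t0) (Complex A t1))"
      unfolding vertical_diff(1)[OF t(1)] by (intro has_contour_integral_diff has_contour_integral_integral)
    have "norm (contour_integral (linepath (Complex A t0) (Complex A t1)) (G m) - (r * 0 ^ m) * (2 * of_real pi * \<i>))
       \<le> e' * norm (Complex A t1 - Complex A t0)"
    proof (rule has_contour_integral_bound_linepath[OF d])
      fix w assume w: "w \<in> closed_segment (Complex A t0) (Complex A t1)"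
      show "norm (G m w - r * 0 ^ m) \<le> e'"
        using l[rule_format, of w] S[unfolded S_def, OF w] A by (simp add: dist_norm)
    qed (use e' in simp)
    also have "norm (Complex A t1 - Complex A t0) = 2 * pi" by (rule vertical_diff[OF t(1)])
    also have "e' * (2 * pi) = e / 2" by (simp add: e'_def)
    also have "\<dots> < e" using e by simp
    finally show ?thesis by (simp add: dist_norm mult.commute)
  qed
  show "eventually (\<lambda>A. dist (contour_integral (linepath (Complex A t0) (Complex A t1)) (G m)) (2 * of_real pi * \<i> * (r * 0 ^ m)) < e) at_bot"
    unfolding eventually_at_bot_linorder by (rule exI[of _ "min l l'"], intro allI impI, rule main)
qed

text \<open>All zeros in the strip have bounded real part, so once the vertical edges are far out
  the sum over enclosed zeros no longer depends on them. The heights t0 and t1 stay general to allow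
  both the lines \<plusminus>pi and the shifted rectangle.\<close>

lemma strip_identity:
  assumes t: "t1 = t0 + 2 * pi" "- (10/3) \<le> t0" "t1 \<le> 10/3"
    and edges: "\<And>u. W (Complex u t0) \<noteq> 0 \<and> W (Complex u t1) \<noteq> 0"
  shows "\<exists>A0 B0. \<forall>A\<le>A0. \<forall>B\<ge>B0. integral {A..B} (\<lambda>u. G m (Complex u t0) - G m (Complex u t1))
     = 2 * of_real pi * \<i> * (\<Sum>w\<in>{w\<in>zeros. t0 < Im w \<and> Im w < t1}. exp w ^ m)
       - contour_integral (linepath (Complex B t0) (Complex B t1)) (G m)
       + contour_integral (linepath (Complex A t0) (Complex A t1)) (G m)"
proof -
  obtain L where L: "\<forall>w. Re w \<ge> L \<longrightarrow> \<bar>Im w\<bar> \<le> 10/3 \<longrightarrow> W w \<noteq> 0" using right_nz ..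
  obtain l where l: "\<forall>w. Re w \<le> l \<longrightarrow> \<bar>Im w\<bar> \<le> 4 \<longrightarrow> W w \<noteq> 0" using left_nz' ..
  define B0 where "B0 = max L (l + 1)"
  have main: "integral {A..B} (\<lambda>u. G m (Complex u t0) - G m (Complex u t1))
     = 2 * of_real pi * \<i> * (\<Sum>w\<in>{w\<in>zeros. t0 < Im w \<and> Im w < t1}. exp w ^ m)
       - contour_integral (linepath (Complex B t0) (Complex B t1)) (G m)
       + contour_integral (linepath (Complex A t0) (Complex A t1)) (G m)" if A: "A \<le> l" and B: "B \<ge> B0" for A B
  proof -
    have im: "\<bar>x\<bar> \<le> 10/3" if "t0 \<le> x" "x \<le> t1" for x using that t by auto
    have Z: "{w. W w = 0 \<and> A < Re w \<and> Re w < B \<and> t0 < Im w \<and> Im w < t1} = {w\<in>zeros. t0 < Im w \<and> Im w < t1}"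
    proof (intro set_eqI iffI)
      fix w assume "w \<in> {w. W w = 0 \<and> A < Re w \<and> Re w < B \<and> t0 < Im w \<and> Im w < t1}"
      then show "w \<in> {w\<in>zeros. t0 < Im w \<and> Im w < t1}" using im[of "Im w"] by (simp add: zeros_def)
    next
      fix w assume "w \<in> {w\<in>zeros. t0 < Im w \<and> Im w < t1}"
      then have w: "W w = 0" "\<bar>Im w\<bar> \<le> 10/3" "t0 < Im w" "Im w < t1" by (auto simp: zeros_def)
      have "\<not> L \<le> Re w" using L[rule_format, of w] w by blast
      moreover have "\<not> Re w \<le> l" using l[rule_format, of w] w by auto
      ultimately show "w \<in> {w. W w = 0 \<and> A < Re w \<and> Re w < B \<and> t0 < Im w \<and> Im w < t1}"
        using w A B by (auto simp: B0_def)
    qed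
    show ?thesis
      unfolding Z[symmetric]
    proof (rule rectangle_identity)
      show "A < B" using A B by (simp add: B0_def)
      show "t0 < t1" using t by simp
      show "W (Complex A t) \<noteq> 0 \<and> W (Complex B t) \<noteq> 0" if "t0 \<le> t" "t \<le> t1" for t
        using l[rule_format, of "Complex A t"] L[rule_format, of "Complex B t"] im[OF that] A B
        by (simp add: B0_def)
    qed (rule edges)
  qed
  show ?thesis by (rule exI[of _ l], rule exI[of _ B0], intro allI impI, rule main)
qed

end

section \<open>Moments\<close>

lemma set_integrable_inverse_square:
  fixes K X :: real
  assumes X: "X > 0"
  shows "set_integrable lborel {X..} (\<lambda>x. K / x\<^sup>2)"
  unfolding set_integrable_def
proof (rule integrableI_bounded)
  show "(\<lambda>x. indicator {X..} x *\<^sub>R (K / x\<^sup>2)) \<in> borel_measurable lborel" by measurable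
  have "(\<integral>\<^sup>+x. ennreal (norm (indicator {X..} x *\<^sub>R (K / x\<^sup>2))) \<partial>lborel)
      = (\<integral>\<^sup>+x. ennreal (\<bar>K\<bar> / x\<^sup>2) * indicator {X..} x \<partial>lborel)"
    by (intro nn_integral_cong) (simp add: indicator_def)
  also have "\<dots> = ennreal (0 - (- \<bar>K\<bar> / X))"
  proof (rule nn_integral_FTC_atLeast)
    show "((\<lambda>x. - \<bar>K\<bar> / x) has_real_derivative \<bar>K\<bar> / x\<^sup>2) (at x)" if "X \<le> x" for x
      using X that by (auto intro!: derivative_eq_intros simp: power2_eq_square)
    show "((\<lambda>x. - \<bar>K\<bar> / x) \<longlongrightarrow> 0) at_top" by real_asymp
  qed auto
  also have "\<dots> < \<infinity>" by simp
  finally show "(\<integral>\<^sup>+x. ennreal (norm (indicator {X..} x *\<^sub>R (K / x\<^sup>2))) \<partial>lborel) < \<infinity>" .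
qed

lemma finite_positive_lower_bound:
  fixes D :: "real set"
  assumes "finite D" "\<And>d. d \<in> D \<Longrightarrow> d > 0"
  shows "\<exists>\<delta>>0. \<forall>d\<in>D. \<delta> < d"
proof (cases "D = {}")
  case True
  then show ?thesis by (intro exI[of _ 1]) simp
next
  case False
  then have M: "Min D > 0" "\<And>d. d \<in> D \<Longrightarrow> Min D \<le> d" using assms by (auto simp: Min_gr_iff)
  show ?thesis
  proof (rule exI[of _ "Min D / 2"], intro conjI ballI)
    show "Min D / 2 > 0" using M(1) by simp
    show "Min D / 2 < d" if "d \<in> D" for d using M(1) M(2)[OF that] by linarith
  qed
qed

context slit_log_derivative
begin

lemma sum_slit_zeros: "(\<Sum>\<zeta>\<in>slit_zeros. \<zeta> ^ m) = (\<Sum>w\<in>{w\<in>zeros. \<bar>Im w\<bar> < pi}. exp w ^ m)"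
proof -
  have "inj_on exp {w\<in>zeros. \<bar>Im w\<bar> < pi}"
    by (rule inj_on_inverseI[of _ Ln]) (auto simp: abs_less_iff)
  then show ?thesis unfolding slit_zeros_eq by (simp add: sum.reindex)
qed

text \<open>2 pi i times this is what the residue theorem on the strip |Im w| < pi assigns to the
  integral of G over the bottom line minus that over the top line when the lines are free of
  zeros.\<close>

definition moment_const :: "nat \<Rightarrow> complex" where
  "moment_const m = (\<Sum>\<zeta>\<in>slit_zeros. \<zeta> ^ m) - \<eta> m + r * 0 ^ m"

text \<open>The substitution x = e^u: the factor e^u is dx/du, and (-1)^m appears because e^w = -x
  on both banks.\<close>

lemma G_lower_upper:
  "G m (Complex u (- pi)) - G m (Complex u pi)
     = (-1) ^ m * of_real a * (exp u *\<^sub>R (cut_jump (exp u) * of_real (exp u ^ m)))"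
proof -
  have c: "Complex u (- pi) = lower (exp u)" "Complex u pi = upper (exp u)" by (simp_all add: complex_eq_iff)
  have "(- complex_of_real (exp u)) ^ m = (-1) ^ m * of_real (exp u ^ m)"
    by (subst power_minus) simp
  then have "G m (lower (exp u)) - G m (upper (exp u))
     = (-1) ^ m * of_real (exp u ^ m) * (W' (lower (exp u)) / W (lower (exp u)) - W' (upper (exp u)) / W (upper (exp u)))"
    unfolding G_def by (simp add: exp_lower exp_upper right_diff_distrib)
  moreover have "W' (lower (exp u)) / W (lower (exp u)) - W' (upper (exp u)) / W (upper (exp u))
     = of_real a * of_real (exp u) * cut_jump (exp u)"
    using a0 by (simp add: cut_jump_def)
  ultimately show ?thesis unfolding c by (simp add: scaleR_conv_of_real mult_ac)
qed

lemma cut_jump_moment_continuous: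
  assumes nz: "\<And>x. x > 0 \<Longrightarrow> W (upper x) \<noteq> 0"
  shows "continuous_on {0<..} (\<lambda>x. cut_jump x * of_real (x ^ m))"
proof -
  have low: "continuous_on {0<..} lower" and up: "continuous_on {0<..} upper"
    unfolding lower_def[abs_def] upper_def[abs_def] by (intro continuous_intros; simp)+
  have comp: "continuous_on {0<..} (\<lambda>x. W (lower x))" "continuous_on {0<..} (\<lambda>x. W' (lower x))"
    "continuous_on {0<..} (\<lambda>x. W (upper x))" "continuous_on {0<..} (\<lambda>x. W' (upper x))"
    using continuous_on_compose2[OF holomorphic_on_imp_continuous_on[OF W_hol[of UNIV]] low]
      continuous_on_compose2[OF holomorphic_on_imp_continuous_on[OF W'_hol[of UNIV]] low]
      continuous_on_compose2[OF holomorphic_on_imp_continuous_on[OF W_hol[of UNIV]] up]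
      continuous_on_compose2[OF holomorphic_on_imp_continuous_on[OF W'_hol[of UNIV]] up] by simp_all
  show ?thesis
    unfolding cut_jump_def by (intro continuous_intros comp) (use nz a0 in \<open>auto simp: W_lower\<close>)
qed

text \<open>Truncate the expansion after m + 1 terms. Its partial sum depends on e^(-w) only and so
  is the same on both banks; the difference leaves the remainders, of order x^(-m-1). The further
  1/x in \<open>cut_jump\<close> and the weight x^m give x^(-2).\<close>

lemma cut_jump_moment_decay:
  "\<exists>K X. X > 0 \<and> (\<forall>x\<ge>X. norm (cut_jump x * of_real (x ^ m)) \<le> K / x\<^sup>2)"
proof -
  obtain K L where KL: "\<forall>w. Re w \<ge> L \<longrightarrow> \<bar>Im w\<bar> \<le> 10/3 \<longrightarrow> W w \<noteq> 0 \<and>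
        norm (W' w / W w - (\<Sum>n<Suc m. \<eta> n * exp (- w) ^ n)) \<le> K * exp (- Re w) ^ Suc m"
    using expansion[of "Suc m"] by (elim exE) (rule that)
  have "norm (cut_jump x * of_real (x ^ m)) \<le> (2 * K / \<bar>a\<bar>) / x\<^sup>2" if x: "x \<ge> exp L" for x
  proof -
    have x0: "x > 0" using x by (rule less_le_trans[rotated]) simp
    have lnx: "ln x \<ge> L" using x x0 by (simp add: ln_ge_iff)
    define S where "S = (\<Sum>n<Suc m. \<eta> n * exp (- lower x) ^ n)"
    have e: "exp (- upper x) = exp (- lower x)" using x0 by (simp add: exp_minus exp_lower exp_upper)
    have q: "exp (- ln x) = 1 / x" using x0 by (simp add: exp_minus inverse_eq_divide)
    have 1: "norm (W' (lower x) / W (lower x) - S) \<le> K * (1 / x) ^ Suc m"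
      using KL[rule_format, of "lower x"] lnx Im_bound[of "- pi"] unfolding S_def by (simp add: q)
    have 2: "norm (W' (upper x) / W (upper x) - S) \<le> K * (1 / x) ^ Suc m"
      using KL[rule_format, of "upper x"] lnx Im_bound[of pi] unfolding S_def e[symmetric] by (simp add: q)
    have "norm (W' (lower x) / W (lower x) - W' (upper x) / W (upper x)) \<le> 2 * K * (1 / x) ^ Suc m"
      using norm_triangle_ineq4[of "W' (lower x) / W (lower x) - S" "W' (upper x) / W (upper x) - S"] 1 2 by simp
    then have "norm (W' (lower x) / W (lower x) - W' (upper x) / W (upper x)) / (\<bar>a\<bar> * x) * x ^ m
        \<le> (2 * K * (1 / x) ^ Suc m) / (\<bar>a\<bar> * x) * x ^ m"
      using x0 by (intro mult_right_mono divide_right_mono) auto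
    moreover have "norm (cut_jump x * of_real (x ^ m))
        = norm (W' (lower x) / W (lower x) - W' (upper x) / W (upper x)) / (\<bar>a\<bar> * x) * x ^ m"
      unfolding cut_jump_def norm_mult norm_divide using x0 by (simp add: norm_power)
    ultimately have "norm (cut_jump x * of_real (x ^ m)) \<le> (2 * K * (1 / x) ^ Suc m) / (\<bar>a\<bar> * x) * x ^ m"
      by (simp only:)
    also have "\<dots> = (2 * K / \<bar>a\<bar>) / x\<^sup>2"
      using x0 by (simp add: power_divide power2_eq_square)
    finally show ?thesis .
  qed
  then show ?thesis by (intro exI[of _ "2 * K / \<bar>a\<bar>"] exI[of _ "exp L"]) simp
qed

lemma cut_jump_moment_integrable:
  assumes nz: "\<And>x. x > 0 \<Longrightarrow> W (upper x) \<noteq> 0" and \<epsilon>: "\<epsilon> > 0"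
  shows "set_integrable lborel {\<epsilon>..} (\<lambda>x. cut_jump x * of_real (x ^ m))"
proof -
  define h where "h = (\<lambda>x. cut_jump x * of_real (x ^ m))"
  have cont: "continuous_on {0<..} h" unfolding h_def by (rule cut_jump_moment_continuous[OF nz])
  obtain K X where X: "X > 0" and K: "\<And>x. x \<ge> X \<Longrightarrow> norm (h x) \<le> K / x\<^sup>2"
    using cut_jump_moment_decay[of m] unfolding h_def by auto
  define X' where "X' = max X \<epsilon>"
  have sub: "{X'..} \<subseteq> {0<..}" using \<epsilon> by (auto simp: X'_def)
  have bd: "norm (h x) \<le> norm (K / x\<^sup>2)" if "x \<ge> X'" for x
  proof -
    have "norm (h x) \<le> K / x\<^sup>2" using that by (intro K) (simp add: X'_def)
    then show ?thesis using abs_ge_self[of "K / x\<^sup>2"] unfolding real_norm_def by linarith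
  qed
  have "set_integrable lborel {\<epsilon>..X'} h"
    by (rule borel_integrable_atLeastAtMost', rule continuous_on_subset[OF cont]) (use \<epsilon> in auto)
  moreover have "set_integrable lborel {X'..} h"
  proof (rule set_integrable_bound[OF set_integrable_inverse_square[of X' K]])
    show "X' > 0" using X by (simp add: X'_def)
    show "set_borel_measurable lborel {X'..} h"
      unfolding set_borel_measurable_def
      using borel_measurable_continuous_on_indicator[OF _ continuous_on_subset[OF cont sub]] by simp
    show "AE x in lborel. x \<in> {X'..} \<longrightarrow> norm (h x) \<le> norm (K / x\<^sup>2)"
      using bd by simp
  qed
  ultimately have "set_integrable lborel ({\<epsilon>..X'} \<union> {X'..}) h" by (rule set_integrable_Un) auto
  moreover have "{\<epsilon>..X'} \<union> {X'..} = {\<epsilon>..}" by (auto simp: X'_def)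
  ultimately show ?thesis by (simp add: h_def)
qed

lemma integral_cut_jump_moment:
  assumes nz: "\<And>x. x > 0 \<Longrightarrow> W (upper x) \<noteq> 0" and \<epsilon>: "0 < \<epsilon>" "\<epsilon> \<le> b"
  shows "integral {\<epsilon>..b} (\<lambda>x. cut_jump x * of_real (x ^ m))
      = (-1) ^ m / of_real a * integral {ln \<epsilon>..ln b} (\<lambda>u. G m (Complex u (- pi)) - G m (Complex u pi))"
proof -
  define h where "h = (\<lambda>x. cut_jump x * of_real (x ^ m))"
  have cont: "continuous_on {\<epsilon>..b} h"
    unfolding h_def by (rule continuous_on_subset[OF cut_jump_moment_continuous[OF nz]]) (use \<epsilon> in auto)
  have b: "b > 0" using \<epsilon> by simp
  have "((\<lambda>u. exp u *\<^sub>R h (exp u)) has_integral integral {exp (ln \<epsilon>)..exp (ln b)} h) {ln \<epsilon>..ln b}"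
  proof (rule has_integral_substitution[OF _ _ _ cont])
    show le: "ln \<epsilon> \<le> ln b" using \<epsilon> by simp
    show "exp (ln \<epsilon>) \<le> exp (ln b)" using le by simp
    show "exp ` {ln \<epsilon>..ln b} \<subseteq> {\<epsilon>..b}"
    proof (rule image_subsetI)
      fix u assume "u \<in> {ln \<epsilon>..ln b}"
      then have "exp (ln \<epsilon>) \<le> exp u" "exp u \<le> exp (ln b)" by auto
      then show "exp u \<in> {\<epsilon>..b}" using \<epsilon>(1) b by simp
    qed
  qed (auto intro!: derivative_eq_intros)
  then have "((\<lambda>u. (-1) ^ m * of_real a * (exp u *\<^sub>R h (exp u))) has_integral (-1) ^ m * of_real a * integral {\<epsilon>..b} h) {ln \<epsilon>..ln b}"
    using \<epsilon>(1) b by (intro has_integral_mult_right) simp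
  then have "integral {ln \<epsilon>..ln b} (\<lambda>u. G m (Complex u (- pi)) - G m (Complex u pi)) = (-1) ^ m * of_real a * integral {\<epsilon>..b} h"
    unfolding G_lower_upper h_def by (rule integral_unique)
  moreover have "(-1) ^ m / of_real a * ((-1) ^ m * of_real a * z) = z" for z :: complex
    using a0 by (simp flip: power_mult_distrib)
  ultimately show ?thesis unfolding h_def by (simp only:)
qed

text \<open>The closed half-line suits the continuity arguments; it differs from the open one by a
  single point.\<close>

lemma LINT_jump_no_cut_zero:
  assumes nz: "\<And>x. x > 0 \<Longrightarrow> W (upper x) \<noteq> 0" and \<epsilon>: "0 < \<epsilon>"
  shows "set_integrable lborel {\<epsilon><..} (\<lambda>x. jump f x * of_real (x ^ m))"
    "(LINT x:{\<epsilon><..}|lborel. jump f x * of_real (x ^ m)) = (LINT x:{\<epsilon>..}|lborel. cut_jump x * of_real (x ^ m))"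
proof -
  have eq: "indicator {\<epsilon>..} x *\<^sub>R (cut_jump x * of_real (x ^ m)) = indicator {\<epsilon><..} x *\<^sub>R (jump f x * of_real (x ^ m))"
    if "x \<notin> {\<epsilon>}" for x
    using that \<epsilon> jump_eq[OF _ nz, of x] by (auto simp: indicator_def)
  show "set_integrable lborel {\<epsilon><..} (\<lambda>x. jump f x * of_real (x ^ m))"
    using cut_jump_moment_integrable[OF nz \<epsilon>, of m] unfolding set_integrable_def
    by (rule integrable_discrete_difference[where X = "{\<epsilon>}", THEN iffD1, rotated -1]) (use eq in auto)
  show "(LINT x:{\<epsilon><..}|lborel. jump f x * of_real (x ^ m)) = (LINT x:{\<epsilon>..}|lborel. cut_jump x * of_real (x ^ m))"
    unfolding set_lebesgue_integral_def
    by (rule integral_discrete_difference[where X = "{\<epsilon>}", symmetric]) (use eq in auto)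
qed

text \<open>Integrability lets the upper limit b tend to infinity first, where the right edge yields
  the coefficient; then \<epsilon> tends to 0, where the left edge yields the term at the
  origin.\<close>

lemma no_cut_zero_limit:
  assumes nz: "\<And>x. x > 0 \<Longrightarrow> W (upper x) \<noteq> 0"
  shows "((\<lambda>\<epsilon>. LINT x:{\<epsilon><..}|lborel. jump f x * of_real (x ^ m)) \<longlongrightarrow>
           (-1) ^ m / of_real a * (2 * of_real pi * \<i> * moment_const m)) (at_right 0)"
proof -
  define R where "R B = contour_integral (linepath (Complex B (- pi)) (Complex B pi)) (G m)" for B
  define Z where "Z = (\<Sum>w\<in>{w\<in>zeros. - pi < Im w \<and> Im w < pi}. exp w ^ m)"
  have Z: "Z = (\<Sum>\<zeta>\<in>slit_zeros. \<zeta> ^ m)"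
    unfolding Z_def sum_slit_zeros by (intro sum.cong) auto
  have t: "pi = - pi + 2 * pi" "- (10/3) \<le> - pi" "pi \<le> 10/3" using pi_less_ten_thirds by auto
  have edges: "W (Complex u (- pi)) \<noteq> 0 \<and> W (Complex u pi) \<noteq> 0" for u
  proof -
    have c: "Complex u (- pi) = lower (exp u)" "Complex u pi = upper (exp u)" by (simp_all add: complex_eq_iff)
    show ?thesis unfolding c W_lower using nz[of "exp u"] by simp
  qed
  obtain A0 B0 where AB: "\<forall>A\<le>A0. \<forall>B\<ge>B0. integral {A..B} (\<lambda>u. G m (Complex u (- pi)) - G m (Complex u pi))
      = 2 * of_real pi * \<i> * Z - R B + R A"
    using strip_identity[OF t edges, of m, folded R_def Z_def] by (elim exE) (rule that)
  have limR: "(R \<longlongrightarrow> 2 * of_real pi * \<i> * \<eta> m) at_top" unfolding R_def[abs_def] by (rule right_edge_limit[OF t])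
  have limL: "(R \<longlongrightarrow> 2 * of_real pi * \<i> * (r * 0 ^ m)) at_bot" unfolding R_def[abs_def] by (rule left_edge_limit[OF t])
  have J: "(LINT x:{\<epsilon><..}|lborel. jump f x * of_real (x ^ m))
      = (-1) ^ m / of_real a * (2 * of_real pi * \<i> * Z - 2 * of_real pi * \<i> * \<eta> m + R (ln \<epsilon>))"
    if \<epsilon>: "0 < \<epsilon>" "\<epsilon> < exp A0" for \<epsilon>
  proof -
    define h where "h = (\<lambda>x. indicator {\<epsilon>..} x *\<^sub>R (cut_jump x * of_real (x ^ m)))"
    have int: "integrable lborel h"
      using cut_jump_moment_integrable[OF nz \<epsilon>(1), of m] unfolding set_integrable_def h_def .
    \<comment> \<open>Connects the Lebesgue integral over the half-line with integrals over compact
      intervals, to which the rectangle identity applies.\<close>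
    have lim1: "((\<lambda>b. \<integral>x. indicator {..b} x *\<^sub>R h x \<partial>lborel) \<longlongrightarrow> (\<integral>x. h x \<partial>lborel)) at_top"
      by (rule tendsto_integral_at_top[OF _ int]) simp
    have lnA: "ln \<epsilon> \<le> A0"
    proof -
      have "ln \<epsilon> < ln (exp A0)" using \<epsilon> by (subst ln_less_cancel_iff) auto
      then show ?thesis by simp
    qed
    have fin: "(\<integral>x. indicator {..b} x *\<^sub>R h x \<partial>lborel) = (-1) ^ m / of_real a * (2 * of_real pi * \<i> * Z - R (ln b) + R (ln \<epsilon>))"
      if b: "b \<ge> max \<epsilon> (exp B0)" for b
    proof -
      have "indicator {..b} x *\<^sub>R h x = indicator {\<epsilon>..b} x *\<^sub>R (cut_jump x * of_real (x ^ m))" for x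
        by (auto simp: h_def indicator_def)
      then have "(\<integral>x. indicator {..b} x *\<^sub>R h x \<partial>lborel) = (LINT x:{\<epsilon>..b}|lborel. cut_jump x * of_real (x ^ m))"
        unfolding set_lebesgue_integral_def by simp
      also have "\<dots> = integral {\<epsilon>..b} (\<lambda>x. cut_jump x * of_real (x ^ m))"
        by (rule set_borel_integral_eq_integral(2), rule set_integrable_subset[OF cut_jump_moment_integrable[OF nz \<epsilon>(1)]]) auto
      also have "\<dots> = (-1) ^ m / of_real a * integral {ln \<epsilon>..ln b} (\<lambda>u. G m (Complex u (- pi)) - G m (Complex u pi))"
        by (rule integral_cut_jump_moment[OF nz \<epsilon>(1) order_trans[OF max.cobounded1 b]])
      also have "integral {ln \<epsilon>..ln b} (\<lambda>u. G m (Complex u (- pi)) - G m (Complex u pi)) = 2 * of_real pi * \<i> * Z - R (ln b) + R (ln \<epsilon>)"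
      proof (rule AB[rule_format, OF lnA])
        have "exp B0 \<le> b" by (rule order_trans[OF max.cobounded2 b])
        then have "ln (exp B0) \<le> ln b" using less_le_trans[OF exp_gt_zero] by (subst ln_le_cancel_iff) auto
        then show "ln b \<ge> B0" by simp
      qed
      finally show ?thesis .
    qed
    have "((\<lambda>b. (-1) ^ m / of_real a * (2 * of_real pi * \<i> * Z - R (ln b) + R (ln \<epsilon>))) \<longlongrightarrow>
        (-1) ^ m / of_real a * (2 * of_real pi * \<i> * Z - 2 * of_real pi * \<i> * \<eta> m + R (ln \<epsilon>))) at_top"
      by (intro tendsto_intros filterlim_compose[OF limR ln_at_top])
    moreover have "((\<lambda>b. (-1) ^ m / of_real a * (2 * of_real pi * \<i> * Z - R (ln b) + R (ln \<epsilon>))) \<longlongrightarrow> (\<integral>x. h x \<partial>lborel)) at_top"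
      by (rule Lim_transform_eventually[OF lim1]) (rule eventually_mono[OF eventually_ge_at_top], rule fin)
    ultimately have "(\<integral>x. h x \<partial>lborel) = (-1) ^ m / of_real a * (2 * of_real pi * \<i> * Z - 2 * of_real pi * \<i> * \<eta> m + R (ln \<epsilon>))"
      using tendsto_unique[OF trivial_limit_at_top_linorder] by blast
    moreover have "(LINT x:{\<epsilon><..}|lborel. jump f x * of_real (x ^ m)) = (\<integral>x. h x \<partial>lborel)"
      unfolding h_def set_lebesgue_integral_def[symmetric] by (rule LINT_jump_no_cut_zero(2)[OF nz \<epsilon>(1)])
    ultimately show ?thesis by (simp only:)
  qed
  have "((\<lambda>\<epsilon>. (-1) ^ m / of_real a * (2 * of_real pi * \<i> * Z - 2 * of_real pi * \<i> * \<eta> m + R (ln \<epsilon>))) \<longlongrightarrow>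
      (-1) ^ m / of_real a * (2 * of_real pi * \<i> * Z - 2 * of_real pi * \<i> * \<eta> m + 2 * of_real pi * \<i> * (r * 0 ^ m))) (at_right 0)"
    by (intro tendsto_intros filterlim_compose[OF limL ln_at_0])
  moreover have "eventually (\<lambda>\<epsilon>. 0 < \<epsilon> \<and> \<epsilon> < exp A0) (at_right 0)"
    by (intro eventually_conj eventually_at_right_less eventually_at_rightI[of 0 "exp A0"]) auto
  then have "eventually (\<lambda>\<epsilon>. (-1) ^ m / of_real a * (2 * of_real pi * \<i> * Z - 2 * of_real pi * \<i> * \<eta> m + R (ln \<epsilon>))
     = (LINT x:{\<epsilon><..}|lborel. jump f x * of_real (x ^ m))) (at_right 0)"
    by eventually_elim (use J in auto)
  ultimately have "((\<lambda>\<epsilon>. LINT x:{\<epsilon><..}|lborel. jump f x * of_real (x ^ m)) \<longlongrightarrow>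
     (-1) ^ m / of_real a * (2 * of_real pi * \<i> * Z - 2 * of_real pi * \<i> * \<eta> m + 2 * of_real pi * \<i> * (r * 0 ^ m))) (at_right 0)"
    by (rule Lim_transform_eventually)
  moreover have "2 * of_real pi * \<i> * Z - 2 * of_real pi * \<i> * \<eta> m + 2 * of_real pi * \<i> * (r * 0 ^ m) = 2 * of_real pi * \<i> * moment_const m"
    unfolding moment_const_def Z by (simp only: distrib_left right_diff_distrib)
  ultimately show ?thesis by (simp only:)
qed

section \<open>Moments when there are poles on the cut\<close>

lemma cut_zero_jump:
  assumes zero: "W (upper y) = 0" and x: "x > 0" "W (upper x) \<noteq> 0"
  shows "jump f x = 0"
proof -
  obtain q where q0: "q \<noteq> 0" and q: "\<And>w. W (w + 2 * of_real pi * \<i>) = q * W w"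
    using monodromy_of_cut_zero[OF zero] by auto
  \<comment> \<open>The common factor cancels in W'/W, so both banks give the same value.\<close>
  have "W (upper x) = q * W (lower x)" "W' (upper x) = q * W' (lower x)"
    unfolding upper_eq_lower by (rule q, rule W'_monodromy[OF q])
  then have "cut_jump x = 0" using q0 by (simp add: cut_jump_def)
  then show ?thesis using jump_eq[OF x] by simp
qed

text \<open>The pointwise jump vanishes except possibly on the finite set of cut poles, so only the
  delta terms contribute to \<open>jump_integral\<close>.\<close>

lemma LINT_jump_cut_zero:
  assumes zero: "W (upper y) = 0" and \<epsilon>: "0 < \<epsilon>"
  shows "set_integrable lborel {\<epsilon><..} (\<lambda>x. jump f x * of_real (x ^ m))"
    "(LINT x:{\<epsilon><..}|lborel. jump f x * of_real (x ^ m)) = 0"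
proof -
  have eq: "(0::complex) = indicator {\<epsilon><..} x *\<^sub>R (jump f x * of_real (x ^ m))" if "x \<notin> cut_poles f" for x
    using that \<epsilon> cut_zero_jump[OF zero, of x] by (auto simp: indicator_def cut_poles_eq)
  have c: "countable (cut_poles f)" using finite_cut_poles by (rule countable_finite)
  have "integrable lborel (\<lambda>x::real. 0::complex)" by simp
  then show "set_integrable lborel {\<epsilon><..} (\<lambda>x. jump f x * of_real (x ^ m))"
    unfolding set_integrable_def
    by (rule integrable_discrete_difference[OF c, THEN iffD1, rotated -1]) (use eq in auto)
  have "(\<integral>x. (0::complex) \<partial>(lborel :: real measure)) = (LINT x:{\<epsilon><..}|lborel. jump f x * of_real (x ^ m))"
    unfolding set_lebesgue_integral_def
    by (rule integral_discrete_difference[OF c]) (use eq in auto)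
  then show "(LINT x:{\<epsilon><..}|lborel. jump f x * of_real (x ^ m)) = 0" by simp
qed

text \<open>On the shifted rectangle G has period 2 pi i, so the horizontal sides cancel and the
  residue theorem becomes an identity without an integral. The shift puts the zeros on Im w = pi
  inside and those on Im w = -pi outside, so each pole on the cut is counted once.\<close>

lemma cut_zero_moment_const:
  assumes zero: "W (upper y) = 0"
  shows "moment_const m = - (\<Sum>x\<in>cut_poles f. (- of_real x) ^ m)"
proof -
  obtain q where q0: "q \<noteq> 0" and q: "\<And>w. W (w + 2 * of_real pi * \<i>) = q * W w"
    using monodromy_of_cut_zero[OF zero] by auto
  \<comment> \<open>Everything the shift \<delta> must stay below: the available width above pi, and
    the distances from each of the two lines up to the zeros above it. Then no zero lies on the new
    horizontal sides, and none is gained or lost apart from those on the old lines.\<close>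
  define D where "D = insert (10/3 - pi) ((\<lambda>w. Im w - pi) ` {w\<in>zeros. Im w > pi} \<union> (\<lambda>w. Im w + pi) ` {w\<in>zeros. Im w > - pi})"
  have "\<exists>\<delta>>0. \<forall>d\<in>D. \<delta> < d"
    by (rule finite_positive_lower_bound) (use finite_zeros pi_less_ten_thirds in \<open>auto simp: D_def\<close>)
  then obtain \<delta> where \<delta>: "\<delta> > 0" and less: "\<And>d. d \<in> D \<Longrightarrow> \<delta> < d" by auto
  define t0 t1 where "t0 = - pi + \<delta>" and "t1 = pi + \<delta>"
  have t: "t1 = t0 + 2 * pi" "- (10/3) \<le> t0" "t1 \<le> 10/3"
    using \<delta> less[of "10/3 - pi"] pi_less_ten_thirds by (auto simp: t0_def t1_def D_def)
  have t1z: "\<not> (w \<in> zeros \<and> pi < Im w \<and> Im w \<le> t1)" for w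
    using less[of "Im w - pi"] by (auto simp: D_def t1_def)
  have t0z: "\<not> (w \<in> zeros \<and> - pi < Im w \<and> Im w \<le> t0)" for w
    using less[of "Im w + pi"] by (auto simp: D_def t0_def)
  have abs: "\<bar>t0\<bar> \<le> 10/3" "\<bar>t1\<bar> \<le> 10/3" using t pi_gt_zero by linarith+
  have edges: "W (Complex u t0) \<noteq> 0 \<and> W (Complex u t1) \<noteq> 0" for u
    using t1z[of "Complex u t1"] t0z[of "Complex u t0"] abs \<delta> unfolding zeros_def by (simp add: t0_def t1_def)
  define R where "R B = contour_integral (linepath (Complex B t0) (Complex B t1)) (G m)" for B
  define Z where "Z = (\<Sum>w\<in>{w\<in>zeros. t0 < Im w \<and> Im w < t1}. exp w ^ m)"
  have per: "G m (Complex u t0) - G m (Complex u t1) = 0" for u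
  proof -
    have c: "Complex u t1 = Complex u t0 + 2 * of_real pi * \<i>" using t(1) by (simp add: complex_eq_iff)
    show ?thesis unfolding c G_def q W'_monodromy[OF q] exp_shift_2pi_i using q0 by simp
  qed
  obtain A0 B0 where AB: "\<forall>A\<le>A0. \<forall>B\<ge>B0. integral {A..B} (\<lambda>u. G m (Complex u t0) - G m (Complex u t1))
      = 2 * of_real pi * \<i> * Z - R B + R A"
    using strip_identity[OF t edges, of m, folded R_def Z_def] by (elim exE) (rule that)
  have rel: "R B = 2 * of_real pi * \<i> * Z + R A" if "A \<le> A0" "B \<ge> B0" for A B
    using AB[rule_format, OF that] unfolding per by (simp add: algebra_simps)
  have limR: "(R \<longlongrightarrow> 2 * of_real pi * \<i> * \<eta> m) at_top" unfolding R_def[abs_def] by (rule right_edge_limit[OF t])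
  have limL: "(R \<longlongrightarrow> 2 * of_real pi * \<i> * (r * 0 ^ m)) at_bot" unfolding R_def[abs_def] by (rule left_edge_limit[OF t])
  \<comment> \<open>The right edge is moved to infinity with A fixed; the left edge follows in the
    next step.\<close>
  have RA: "2 * of_real pi * \<i> * \<eta> m = 2 * of_real pi * \<i> * Z + R A" if "A \<le> A0" for A
  proof (rule tendsto_unique[OF trivial_limit_at_top_linorder limR])
    show "(R \<longlongrightarrow> 2 * of_real pi * \<i> * Z + R A) at_top"
      by (rule Lim_transform_eventually[OF tendsto_const])
         (rule eventually_mono[OF eventually_ge_at_top[of B0]], rule rel[OF that, symmetric])
  qed
  have "2 * of_real pi * \<i> * \<eta> m = 2 * of_real pi * \<i> * Z + 2 * of_real pi * \<i> * (r * 0 ^ m)"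
  proof (rule tendsto_unique[OF trivial_limit_at_bot_linorder tendsto_const])
    have "((\<lambda>A. 2 * of_real pi * \<i> * Z + R A) \<longlongrightarrow> 2 * of_real pi * \<i> * Z + 2 * of_real pi * \<i> * (r * 0 ^ m)) at_bot"
      by (intro tendsto_intros limL)
    then show "((\<lambda>A. 2 * of_real pi * \<i> * \<eta> m) \<longlongrightarrow> 2 * of_real pi * \<i> * Z + 2 * of_real pi * \<i> * (r * 0 ^ m)) (at_bot :: real filter)"
      by (rule Lim_transform_eventually)
         (rule eventually_mono[OF eventually_le_at_bot[of A0]], rule RA[symmetric])
  qed
  then have "2 * of_real pi * \<i> * \<eta> m = 2 * of_real pi * \<i> * (Z + r * 0 ^ m)" by (simp only: distrib_left)
  then have \<eta>: "\<eta> m = Z + r * 0 ^ m" by simp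
  have Zeq: "{w\<in>zeros. t0 < Im w \<and> Im w < t1} = {w\<in>zeros. \<bar>Im w\<bar> < pi} \<union> {w\<in>zeros. Im w = pi}"
  proof (intro set_eqI iffI)
    fix w assume w: "w \<in> {w\<in>zeros. t0 < Im w \<and> Im w < t1}"
    then have "Im w \<le> pi" using t1z[of w] by auto
    moreover have "Im w > - pi" using w \<delta> by (auto simp: t0_def)
    ultimately show "w \<in> {w\<in>zeros. \<bar>Im w\<bar> < pi} \<union> {w\<in>zeros. Im w = pi}" using w by auto
  next
    fix w assume "w \<in> {w\<in>zeros. \<bar>Im w\<bar> < pi} \<union> {w\<in>zeros. Im w = pi}"
    then have w: "w \<in> zeros" "- pi < Im w" "Im w \<le> pi" using pi_gt_zero by auto
    then show "w \<in> {w\<in>zeros. t0 < Im w \<and> Im w < t1}" using t0z[of w] \<delta> by (auto simp: t1_def)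
  qed
  have "Z = (\<Sum>w\<in>{w\<in>zeros. \<bar>Im w\<bar> < pi}. exp w ^ m) + (\<Sum>w\<in>{w\<in>zeros. Im w = pi}. exp w ^ m)"
    unfolding Z_def Zeq by (rule sum.union_disjoint) (use finite_zeros in auto)
  also have "(\<Sum>w\<in>{w\<in>zeros. Im w = pi}. exp w ^ m) = (\<Sum>x\<in>cut_poles f. (- of_real x) ^ m)"
    unfolding upper_zeros sum.reindex[OF inj_on_upper] by (intro sum.cong) (auto simp: exp_upper cut_poles_eq)
  finally show ?thesis unfolding moment_const_def sum_slit_zeros \<eta> by simp
qed

text \<open>Both cases have the same value: without cut poles it comes from the integral, with them
  from the delta terms, each of residue 1/a.\<close>

lemma jump_moment_limit:
  "(jump_integral f (\<lambda>x. of_real (x ^ m)) \<longlongrightarrow> (-1) ^ m / of_real a * (2 * of_real pi * \<i> * moment_const m)) (at_right 0)"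
proof (cases "\<exists>y>0. W (upper y) = 0")
  case False
  then have nz: "W (upper x) \<noteq> 0" if "x > 0" for x using that by blast
  have "cut_poles f = {}" using nz by (auto simp: cut_poles_eq)
  then show ?thesis using no_cut_zero_limit[OF nz, of m] by (simp add: jump_integral_def[abs_def])
next
  case True
  then obtain y where zero: "W (upper y) = 0" by blast
  have "\<exists>\<delta>>0. \<forall>d\<in>cut_poles f. \<delta> < d"
    by (rule finite_positive_lower_bound[OF finite_cut_poles]) (simp add: cut_poles_eq)
  then obtain \<delta> where \<delta>: "\<delta> > 0" "\<And>d. d \<in> cut_poles f \<Longrightarrow> \<delta> < d" by auto
  \<comment> \<open>Once \<epsilon> is below all cut poles, the whole expression is constant in
    \<epsilon>.\<close>
  have val: "(-1) ^ m / of_real a * (2 * of_real pi * \<i> * moment_const m) = jump_integral f (\<lambda>x. of_real (x ^ m)) \<epsilon>"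
    if \<epsilon>: "0 < \<epsilon>" "\<epsilon> < \<delta>" for \<epsilon>
  proof -
    have "{x. x \<in> cut_poles f \<and> x > \<epsilon>} = cut_poles f" using \<delta>(2) \<epsilon>(2) by fastforce
    then have "jump_integral f (\<lambda>x. of_real (x ^ m)) \<epsilon> = (\<Sum>x\<in>cut_poles f. - 2 * of_real pi * \<i> * cut_residue f x * of_real (x ^ m))"
      unfolding jump_integral_def LINT_jump_cut_zero(2)[OF zero \<epsilon>(1)] by simp
    also have "\<dots> = (\<Sum>x\<in>cut_poles f. (-1) ^ m / of_real a * (2 * of_real pi * \<i>) * (- ((- of_real x) ^ m)))"
    proof (rule sum.cong[OF refl])
      fix x assume "x \<in> cut_poles f"
      then have res: "cut_residue f x = 1 / of_real a" by (rule cut_residue_eq)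
      have "(-1) ^ m * (- complex_of_real x) ^ m = of_real (x ^ m)"
        unfolding power_mult_distrib[symmetric] by simp
      then show "- 2 * of_real pi * \<i> * cut_residue f x * of_real (x ^ m)
          = (-1) ^ m / of_real a * (2 * of_real pi * \<i>) * (- ((- of_real x) ^ m))"
        unfolding res by (simp add: mult_ac)
    qed
    also have "\<dots> = (-1) ^ m / of_real a * (2 * of_real pi * \<i> * moment_const m)"
      unfolding cut_zero_moment_const[OF zero] by (simp add: sum_distrib_left sum_negf mult.assoc)
    finally show ?thesis ..
  qed
  have "eventually (\<lambda>\<epsilon>. 0 < \<epsilon> \<and> \<epsilon> < \<delta>) (at_right 0)"
    by (intro eventually_conj eventually_at_right_less eventually_at_rightI[of 0 \<delta>]) (use \<delta> in auto)
  then have "eventually (\<lambda>\<epsilon>. (-1) ^ m / of_real a * (2 * of_real pi * \<i> * moment_const m) = jump_integral f (\<lambda>x. of_real (x ^ m)) \<epsilon>) (at_right 0)"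
    by eventually_elim (use val in blast)
  then show ?thesis by (rule Lim_transform_eventually[OF tendsto_const])
qed

lemma jump_moment_integrable:
  assumes "\<epsilon> > 0"
  shows "set_integrable lborel {\<epsilon><..} (\<lambda>x. jump f x * of_real (x ^ m))"
proof (cases "\<exists>y>0. W (upper y) = 0")
  case True
  then show ?thesis using LINT_jump_cut_zero(1)[OF _ assms] by blast
next
  case False
  then have nz: "W (upper x) \<noteq> 0" if "x > 0" for x using that by blast
  show ?thesis by (rule LINT_jump_no_cut_zero(1)[OF nz assms])
qed

lemma moment_formula:
  "- ((-1) ^ m * \<eta> m / of_real a) = 1 / (2 * of_real pi * \<i>) * ((-1) ^ m / of_real a * (2 * of_real pi * \<i> * moment_const m))
     - residue_at_origin f * 0 ^ m - (\<Sum>\<zeta>\<in>slit_poles f. residue f \<zeta> * (- \<zeta>) ^ m)"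
proof -
  have "(\<Sum>\<zeta>\<in>slit_poles f. residue f \<zeta> * (- \<zeta>) ^ m) = (\<Sum>\<zeta>\<in>slit_zeros. (-1) ^ m / of_real a * \<zeta> ^ m)"
    unfolding slit_poles_eq
  proof (rule sum.cong[OF refl])
    fix \<zeta> assume "\<zeta> \<in> slit_zeros"
    then show "residue f \<zeta> * (- \<zeta>) ^ m = (-1) ^ m / of_real a * \<zeta> ^ m"
      using slit_zero_pole(2)[of \<zeta>] by (subst power_minus) simp
  qed
  then have s: "(\<Sum>\<zeta>\<in>slit_poles f. residue f \<zeta> * (- \<zeta>) ^ m) = (-1) ^ m / of_real a * (\<Sum>\<zeta>\<in>slit_zeros. \<zeta> ^ m)"
    by (simp add: sum_distrib_left)
  \<comment> \<open>The sign (-1)^m may be inserted because 0^m vanishes except for m = 0.\<close>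
  have o: "residue_at_origin f * 0 ^ m = (-1) ^ m / of_real a * (r * 0 ^ m)"
    unfolding residue_at_origin_eq by (cases m) auto
  have "1 / (2 * of_real pi * \<i>) * ((-1) ^ m / of_real a * (2 * of_real pi * \<i> * moment_const m)) = (-1) ^ m / of_real a * moment_const m"
  proof -
    have cancel: "1 / z * (A * (z * T)) = A * T" if "z \<noteq> 0" for z A T :: complex using that by simp
    show ?thesis by (rule cancel) simp
  qed
  then show ?thesis unfolding s o moment_const_def by (simp add: algebra_simps)
qed

end

theorem mainTheorem3:
  fixes \<alpha>1 \<alpha>2 \<alpha>3 :: real
  assumes "\<alpha>1 > 0" and "\<alpha>3 \<noteq> 0"
  defines "f \<equiv> gen_fun \<alpha>1 \<alpha>2 \<alpha>3"
  shows "simply_represented f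
    \<and> finite (slit_poles f) \<and> finite (cut_poles f)
    \<and> (\<forall>x>0. x \<notin> cut_poles f \<longrightarrow> (\<exists>l. (jump_diff f x \<longlongrightarrow> l) (at_right 0)))
    \<and> (\<forall>n\<ge>1.
         (\<forall>\<epsilon>>0. set_integrable lborel {\<epsilon><..} (\<lambda>x. jump f x * of_real (x ^ (n - 1)))) \<and>
         (\<exists>I. (jump_integral f (\<lambda>x. of_real (x ^ (n - 1))) \<longlongrightarrow> I) (at_right 0) \<and>
              complex_of_real (conv_seq \<alpha>1 \<alpha>2 \<alpha>3 n)
              = 1 / (2 * of_real pi * \<i>) * I
                - residue_at_origin f * 0 ^ (n - 1)
                - (\<Sum>\<zeta>\<in>slit_poles f. residue f \<zeta> * (- \<zeta>) ^ (n - 1))))"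
proof -
  define a where "a = \<alpha>3 / \<alpha>1"
  have a0: "a \<noteq> 0" using assms by (simp add: a_def)
  \<comment> \<open>The coefficients of W'/W in powers of e^(-w) after rescaling; \<eta> n / a is
    the coefficient (-1)^(n+1) u_(n+1) of z^(-n-1) in f, so the n-th term of the sequence is read
    off at m = n - 1.\<close>
  define \<eta> where "\<eta> = (\<lambda>n. complex_of_real (a * (-1) ^ Suc n * conv_seq \<alpha>1 \<alpha>2 \<alpha>3 (Suc n)))"
  obtain W W' c r where model:
     "\<forall>w. (W has_field_derivative W' w) (at w)"
     "\<forall>w. W w = 0 \<longrightarrow> W' w \<noteq> 0"
     "\<forall>w. W (cnj w) = cnj (W w)"
     "\<forall>w0. W w0 = 0 \<longrightarrow> W (w0 + 2 * of_real pi * \<i>) = 0 \<longrightarrow>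
        (\<exists>q. q \<noteq> 0 \<and> (\<forall>w. W (w + 2 * of_real pi * \<i>) = q * W w))"
     "\<forall>N. \<exists>K L. \<forall>w. Re w \<ge> L \<longrightarrow> \<bar>Im w\<bar> \<le> 10/3 \<longrightarrow> W w \<noteq> 0 \<and>
        norm (W' w / W w - (\<Sum>n<N. of_real (\<alpha>3 / \<alpha>1 * (-1) ^ Suc n * conv_seq \<alpha>1 \<alpha>2 \<alpha>3 (Suc n)) * exp (- w) ^ n))
          \<le> K * exp (- Re w) ^ N"
     "((\<lambda>w. W' w / W w) \<longlongrightarrow> r) left_end" "eventually (\<lambda>w. W w \<noteq> 0) left_end"
     "\<forall>z\<in>slit_plane. gen_fun \<alpha>1 \<alpha>2 \<alpha>3 z = W' (Ln z) / (of_real (\<alpha>3 / \<alpha>1) * z * W (Ln z)) - c"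
    using gen_fun_model[OF assms(1,2), of \<alpha>2] by (elim exE conjE) (rule that)
  interpret slit_log_derivative f W W' a c r \<eta>
    unfolding f_def a_def \<eta>_def
    by unfold_locales (rule a0[unfolded a_def] | rule model[rule_format] | assumption)+
  have jumps: "\<exists>l. (jump_diff f x \<longlongrightarrow> l) (at_right 0)" if "x > 0" "x \<notin> cut_poles f" for x
    using jump_diff_limit[of x] that by (auto simp: cut_poles_eq)
  have moments: "\<exists>I. (jump_integral f (\<lambda>x. of_real (x ^ (n - 1))) \<longlongrightarrow> I) (at_right 0) \<and>
              complex_of_real (conv_seq \<alpha>1 \<alpha>2 \<alpha>3 n)
              = 1 / (2 * of_real pi * \<i>) * I
                - residue_at_origin f * 0 ^ (n - 1)
                - (\<Sum>\<zeta>\<in>slit_poles f. residue f \<zeta> * (- \<zeta>) ^ (n - 1))" if n: "n \<ge> 1" for n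
  proof (intro exI conjI)
    obtain m where m: "n = Suc m" using n by (cases n) auto
    have "(-1) ^ m * (-1) ^ m = (1::complex)" by (simp flip: power_mult_distrib)
    then have "complex_of_real (conv_seq \<alpha>1 \<alpha>2 \<alpha>3 n) = - ((-1) ^ (n - 1) * \<eta> (n - 1) / of_real a)"
      unfolding m \<eta>_def using a0 by (simp add: mult.assoc[symmetric])
    then show "complex_of_real (conv_seq \<alpha>1 \<alpha>2 \<alpha>3 n)
              = 1 / (2 * of_real pi * \<i>) * ((-1) ^ (n - 1) / of_real a * (2 * of_real pi * \<i> * moment_const (n - 1)))
                - residue_at_origin f * 0 ^ (n - 1)
                - (\<Sum>\<zeta>\<in>slit_poles f. residue f \<zeta> * (- \<zeta>) ^ (n - 1))"
      unfolding moment_formula[symmetric] .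
  qed (rule jump_moment_limit)
  show ?thesis
    using simply_represented_f finite_slit_zeros finite_cut_poles jumps moments jump_moment_integrable
    unfolding slit_poles_eq by (intro conjI allI impI)
qed

end
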